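(* Let $r\ge n\ge3$ and $m\ge19$. For a generic choice of an $r\times r$ matrix $R$, an $n\times n$ matrix $M$, and diagonal $r\times r$ matrices $D_1,\dots,D_m$ (i.e., the $r^2+n^2+mr$ entries $R_{ij},M_{ij},(D_i)_{jj}$ chosen generically), let $Z_i=R^{-1}D_iR$ and let $A_i$ be the upper-left $n\times n$ submatrix of $Z_i$, $i\in[m]$. If $$ r\le 2n\left(1-\frac{4}{m-1}\right)-\frac{m^3}{4},$$ then the Commuting Extension Algorithm with input $(A_1,\dots,A_m)$, $r$, $M$ outputs $r\times r$ matrices $(\tilde Z_1,\dots,\tilde Z_m)$ that pairwise commute and such that for each $i\in[m]$ the upper-left $n\times n$ submatrix of $\tilde Z_i$ equals $A_i$.
   Context: Generic: the conclusion holds whenever a fixed nonidentically-zero polynomial in the listed entries is nonzero. Notation: $\sigma(U,i):=(-1)^{|\{j\in U:j<i\}|}$; for a tensor $T\in\mathbb{R}^{n_1\times n_2\times n_3}$, $M(T;p,q)$ has rows $(S,j)$ ($S\subseteq[q]$, $|S|=p$, $j\in[n_2]$), columns $(U,k)$ ($U\subseteq[q]$, $|U|=p+1$, $k\in[n_3]$), entries $\sum_i\mathbf{1}_{U=S\sqcup\{i\}}\sigma(U,i)T_{ijk}$; $M'(T;p,q)$ has rows $(S,k)$ ($|S|=q-p-1$), columns $(U,j)$ ($|U|=q-p$), same entry formula. $Z_{p,q}\subseteq\mathbb{R}^{\binom qp}$ is spanned by basis vectors $e^{(S)}$ with $S\subseteq[p+1]$, and $\varphi_{p,q}:Z_{p,q}\to\mathbb{R}^{p+1}$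 maps $e^{([p+1]\setminus\{i\})}\mapsto(-1)^{i-1}e^{(i)}$. Tensor Decomposition Algorithm (input $T,p,q,r$): form $B:=(\varphi_{p,q}\otimes I)(\mathrm{Colspan}(M(T;p,q))\cap(Z_{p,q}\otimes\mathbb{R}^{n_2}))$ and run the rank-1-element-finding algorithm of Johnston–Lovitz–Vijayaraghavan (Corollary 3 of "Computing linear sections of varieties") on it to get $\hat d^{(\ell)}\otimes\hat b^{(\ell)}$ (fail unless exactly $r$); similarly form $C:=(\varphi_{q-p-1,q}\otimes I)(\mathrm{Colspan}(M'(T;p,q))\cap(Z_{q-p-1,q}\otimes\mathbb{R}^{n_3}))$ and get $\hat f^{(\ell)}\otimes\hat c^{(\ell)}$; find a permutation $\tau$ with the first $\min\{p+1,q-p\}$ entries of $\hat f^{(\tau(\ell))}$ proportional to those of $\hat d^{(\ell)}$; solve $\sum_\ell w^{(\ell)}\otimes\hat b^{(\ell)}\otimes\hat c^{(\tau(\ell))}=T$ for $w^{(\ell)}$ and output the decomposition. Commuting Extension Algorithm (input $(A_1,\dots,A_m)$, $r$, invertible $M$): (1) $T_i=MA_i$, $T$ the $m\times n\times n$ tensor with slices $T_i$; (2) $q$ = largest odd integer $\le m$, $p=(q-1)/2$; (3) run the Tensor Decomposition Algorithm on $T,p,q,r$, obtaining $T=\sum_{\ell=1}^r a^{(\ell)}\otimes b^{(\ell)}\otimes c^{(\ell)}$; (4) $B$ = $n\times r$ matrix with columns $b^{(\ell)}$, $C$ = $r\times n$ matrix with rows $c^{(\ell)\top}$, $\tilde D_i=\mathrm{diag}(a^{(1)}_i,\dots,a^{(r)}_i)$;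 (5) solve for a diagonal $r\times r$ matrix $\hat D$ with $M^{-1}B\hat DC=I_n$; (6) with $U_0:=M^{-1}B\hat D$, extend to $r\times r$ matrices $\tilde U=(U_0^\top\mid A')^\top$, $\tilde V=(C\mid B')$ with $\tilde U\tilde V=I_r$, where $B'$ is any $r\times(r-n)$ matrix with image $\ker(U_0)$ and $A'$ is the unique $r\times(r-n)$ matrix with $A'^\top B'=I_{r-n}$, $A'^\top C=0$; (7) output $\tilde Z_i=\tilde U\hat D^{-1}\tilde D_i\tilde V$. *)

theory Defs
  imports
    "HOL-Library.Function_Algebras"
    "HOL-Combinatorics.Permutations"
    "Jordan_Normal_Form.Matrix"
    "Jordan_Normal_Form.Gauss_Jordan_Elimination"
    "Jordan_Normal_Form.Matrix_Kernel"
    Complex_Main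
begin

text \<open>Index sets \<open>[k]\<close> are rendered as \<open>{..<k}\<close>; all indices below are zero-based.\<close>

subsection \<open>Genericity\<close>

inductive polynomial_in :: "'v set \<Rightarrow> (('v \<Rightarrow> real) \<Rightarrow> real) \<Rightarrow> bool" for V where
  const: "polynomial_in V (\<lambda>x. a)"
| var: "v \<in> V \<Longrightarrow> polynomial_in V (\<lambda>x. x v)"
| add: "polynomial_in V f \<Longrightarrow> polynomial_in V g \<Longrightarrow> polynomial_in V (\<lambda>x. f x + g x)"
| mult: "polynomial_in V f \<Longrightarrow> polynomial_in V g \<Longrightarrow> polynomial_in V (\<lambda>x. f x * g x)"

definition generically :: "'v set \<Rightarrow> (('v \<Rightarrow> real) \<Rightarrow> bool) \<Rightarrow> bool" where
  "generically V Q \<longleftrightarrow>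
     (\<exists>f. polynomial_in V f \<and> (\<exists>x. f x \<noteq> 0) \<and> (\<forall>x. f x \<noteq> 0 \<longrightarrow> Q x))"

subsection \<open>Programs with arbitrary choices and failure\<close>

text \<open>A program is the set of its possible outcomes, \<open>None\<close> being failure. A step asking to find
  some object may return any object with the required property, and fails if there is none.
  Failure is never backtracked, so a statement about all outcomes covers all choices.\<close>

type_synonym 'a program = "'a option set"

definition return :: "'a \<Rightarrow> 'a program" where
  "return a = {Some a}"

definition find_any :: "('a \<Rightarrow> bool) \<Rightarrow> 'a program" where
  "find_any P = (if \<exists>a. P a then Some ` {a. P a} else {None})"

definition fail_unless :: "bool \<Rightarrow> unit program" where
  "fail_unless b = (if b then {Some ()} else {None})"

definition and_then :: "'a program \<Rightarrow> ('a \<Rightarrow> 'b program) \<Rightarrow> 'b program" (infixr \<open>\<rhd>\<close> 54) where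
  "X \<rhd> f = (\<Union>x\<in>X. case x of None \<Rightarrow> {None} | Some a \<Rightarrow> f a)"

subsection \<open>Coordinate spaces\<close>

text \<open>\<open>\<real>\<^sup>I\<close> is the space of functions vanishing outside the finite index set \<open>I\<close>.\<close>

global_interpretation fvs: Vector_Spaces.vector_space "\<lambda>(c::real) (f::'i \<Rightarrow> real) x. c * f x"
  by unfold_locales (auto simp: fun_eq_iff algebra_simps)

definition basis_vec :: "'i \<Rightarrow> 'i \<Rightarrow> real" where
  "basis_vec a = (\<lambda>x. if x = a then 1 else 0)"

definition tensor :: "('i \<Rightarrow> real) \<Rightarrow> ('j \<Rightarrow> real) \<Rightarrow> 'i \<times> 'j \<Rightarrow> real" where
  "tensor u v = (\<lambda>(i, j). u i * v j)"

definition colspan :: "'i set \<Rightarrow> 'j set \<Rightarrow> ('i \<Rightarrow> 'j \<Rightarrow> real) \<Rightarrow> ('i \<Rightarrow> real) set" where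
  "colspan I J A = fvs.span ((\<lambda>c \<rho>. if \<rho> \<in> I then A \<rho> c else 0) ` J)"

definition lin_indep_list :: "('i \<Rightarrow> real) list \<Rightarrow> bool" where
  "lin_indep_list vs \<longleftrightarrow> distinct vs \<and> fvs.independent (set vs)"

subsection \<open>Koszul--Young flattenings\<close>

definition koszul_sign :: "nat set \<Rightarrow> nat \<Rightarrow> real" where
  "koszul_sign U i = (-1) ^ card {j \<in> U. j < i}"

definition subsets_of_size :: "nat \<Rightarrow> nat \<Rightarrow> nat set set" where
  "subsets_of_size q p = {S. S \<subseteq> {..<q} \<and> card S = p}"

definition koszul_entry ::
  "nat \<Rightarrow> (nat \<Rightarrow> nat \<Rightarrow> nat \<Rightarrow> real) \<Rightarrow> nat set \<times> nat \<Rightarrow> nat set \<times> nat \<Rightarrow> real" where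
  "koszul_entry q T = (\<lambda>(S, j) (U, k).
     \<Sum>i<q. if i \<notin> S \<and> U = insert i S then koszul_sign U i * T i j k else 0)"

definition koszul_colspan ::
  "nat \<Rightarrow> nat \<Rightarrow> (nat \<Rightarrow> nat \<Rightarrow> nat \<Rightarrow> real) \<Rightarrow> nat \<Rightarrow> nat \<Rightarrow> (nat set \<times> nat \<Rightarrow> real) set" where
  "koszul_colspan n2 n3 T p q =
     colspan (subsets_of_size q p \<times> {..<n2}) (subsets_of_size q (p + 1) \<times> {..<n3})
       (koszul_entry q T)"

text \<open>\<open>Z\<^bsub>p,q\<^esub> \<otimes> \<real>\<^sup>n\<close>, and the map \<open>\<phi>\<^bsub>p,q\<^esub> \<otimes> I\<close> on it. The sign \<open>(-1)\<^bsup>i-1\<^esup>\<close> of the one-based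
  convention becomes \<open>(-1)\<^sup>i\<close>.\<close>

definition Z_space :: "nat \<Rightarrow> nat \<Rightarrow> nat \<Rightarrow> (nat set \<times> nat \<Rightarrow> real) set" where
  "Z_space p q n =
     fvs.span (basis_vec ` ({S \<in> subsets_of_size q p. S \<subseteq> {..<p + 1}} \<times> {..<n}))"

definition phi_map :: "nat \<Rightarrow> (nat set \<times> nat \<Rightarrow> real) \<Rightarrow> nat \<times> nat \<Rightarrow> real" where
  "phi_map p v = (\<lambda>(i, j). if i < p + 1 then (-1) ^ i * v ({..<p + 1} - {i}, j) else 0)"

definition koszul_space ::
  "nat \<Rightarrow> nat \<Rightarrow> (nat \<Rightarrow> nat \<Rightarrow> nat \<Rightarrow> real) \<Rightarrow> nat \<Rightarrow> nat \<Rightarrow> (nat \<times> nat \<Rightarrow> real) set" where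
  "koszul_space n2 n3 T p q = phi_map p ` (koszul_colspan n2 n3 T p q \<inter> Z_space p q n2)"

subsection \<open>Rank-one elements of a linear subspace (Johnston--Lovitz--Vijayaraghavan)\<close>

text \<open>The symmetric square of \<open>U\<close> intersected with the annihilator of the \<open>2 \<times> 2\<close> minors, each
  minor \<open>x\<^bsub>ij\<^esub> x\<^bsub>i'j'\<^esub> - x\<^bsub>ij'\<^esub> x\<^bsub>i'j\<^esub>\<close> acting as a linear functional on symmetric tensors.\<close>

definition rank_one_annihilator ::
  "(nat \<times> nat \<Rightarrow> real) set \<Rightarrow> ((nat \<times> nat) \<times> (nat \<times> nat) \<Rightarrow> real) set" where
  "rank_one_annihilator U =
     {P \<in> fvs.span ((\<lambda>u. tensor u u) ` U).
        \<forall>i i' j j'. P ((i, j), (i', j')) - P ((i, j'), (i', j)) = 0}"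

definition rank_one :: "(nat \<times> nat \<Rightarrow> real) \<Rightarrow> bool" where
  "rank_one v \<longleftrightarrow> v \<noteq> 0 \<and> (\<exists>d b. v = tensor d b)"

text \<open>Simultaneous diagonalization (Jennrich) of the three-way tensor with slices \<open>Ps\<close>. The slices
  supplied below are linearly independent and there are as many of them as terms, so the first
  factors \<open>z l\<close> are linearly independent as well and the decomposition is unique up to order and
  scaling.\<close>

definition simultaneous_diagonalization :: "('i \<times> 'i \<Rightarrow> real) list \<Rightarrow> ('i \<Rightarrow> real) list program" where
  "simultaneous_diagonalization Ps = find_any (\<lambda>vs.
     length vs = length Ps \<and> lin_indep_list vs \<and>
     (\<exists>z :: nat \<Rightarrow> nat \<Rightarrow> real. \<forall>s<length Ps. \<forall>x y.
        (Ps ! s) (x, y) = (\<Sum>l<length vs. z l s * (vs ! l) x * (vs ! l) y)))"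

definition rank_one_elements ::
  "(nat \<times> nat \<Rightarrow> real) set \<Rightarrow> (nat \<times> nat \<Rightarrow> real) list program" where
  "rank_one_elements U =
     find_any (\<lambda>Ps. lin_indep_list Ps \<and> fvs.span (set Ps) = rank_one_annihilator U) \<rhd> (\<lambda>Ps.
     simultaneous_diagonalization Ps \<rhd> (\<lambda>vs.
     fail_unless (\<forall>v\<in>set vs. v \<in> U \<and> rank_one v) \<rhd> (\<lambda>_.
     return vs)))"

definition rank_one_factors ::
  "(nat \<times> nat \<Rightarrow> real) set \<Rightarrow> nat \<Rightarrow> ((nat \<Rightarrow> nat \<Rightarrow> real) \<times> (nat \<Rightarrow> nat \<Rightarrow> real)) program" where
  "rank_one_factors U r =
     rank_one_elements U \<rhd> (\<lambda>vs.
     fail_unless (length vs = r) \<rhd> (\<lambda>_.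
     find_any (\<lambda>(d, b). \<forall>l<r. vs ! l = tensor (d l) (b l))))"

subsection \<open>Tensor decomposition algorithm\<close>

definition proportional :: "nat \<Rightarrow> (nat \<Rightarrow> real) \<Rightarrow> (nat \<Rightarrow> real) \<Rightarrow> bool" where
  "proportional k u v \<longleftrightarrow> (\<exists>c. c \<noteq> 0 \<and> (\<forall>i<k. u i = c * v i))"

text \<open>\<open>M'(T;p,q)\<close> is \<open>M(T';q-p-1,q)\<close> for the tensor \<open>T'\<close> with the last two modes swapped.
  A result \<open>(a, b, c)\<close> stands for the sum of the \<open>a l \<otimes> b l \<otimes> c l\<close> over \<open>l < r\<close>.\<close>

definition tensor_decomposition ::
  "nat \<Rightarrow> nat \<Rightarrow> nat \<Rightarrow> (nat \<Rightarrow> nat \<Rightarrow> nat \<Rightarrow> real) \<Rightarrow> nat \<Rightarrow> nat \<Rightarrow> nat \<Rightarrow>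
   ((nat \<Rightarrow> nat \<Rightarrow> real) \<times> (nat \<Rightarrow> nat \<Rightarrow> real) \<times> (nat \<Rightarrow> nat \<Rightarrow> real)) program" where
  "tensor_decomposition n1 n2 n3 T p q r =
     rank_one_factors (koszul_space n2 n3 T p q) r \<rhd> (\<lambda>(d, b).
     rank_one_factors (koszul_space n3 n2 (\<lambda>i k j. T i j k) (q - p - 1) q) r \<rhd> (\<lambda>(f, c).
     find_any (\<lambda>\<tau>. \<tau> permutes {..<r} \<and>
       (\<forall>l<r. proportional (min (p + 1) (q - p)) (f (\<tau> l)) (d l))) \<rhd> (\<lambda>\<tau>.
     find_any (\<lambda>w. \<forall>i<n1. \<forall>j<n2. \<forall>k<n3.
       (\<Sum>l<r. w l i * b l j * c (\<tau> l) k) = T i j k) \<rhd> (\<lambda>w.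
     return (w, b, \<lambda>l. c (\<tau> l))))))"

subsection \<open>Commuting extension algorithm\<close>

definition mat_inv :: "real mat \<Rightarrow> real mat" where
  "mat_inv A = the (mat_inverse A)"

definition append_cols :: "real mat \<Rightarrow> real mat \<Rightarrow> real mat" where
  "append_cols A B = four_block_mat A B (0\<^sub>m 0 (dim_col A)) (0\<^sub>m 0 (dim_col B))"

definition upper_left :: "nat \<Rightarrow> real mat \<Rightarrow> real mat" where
  "upper_left n A = mat n n (\<lambda>(i, j). A $$ (i, j))"

definition commuting_extension ::
  "nat \<Rightarrow> nat \<Rightarrow> (nat \<Rightarrow> real mat) \<Rightarrow> nat \<Rightarrow> real mat \<Rightarrow> (nat \<Rightarrow> real mat) program" where
  "commuting_extension m n A r M = (
     let T = (\<lambda>i j k. (M * A i) $$ (j, k));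
         q = Max {q. odd q \<and> q \<le> m};
         p = (q - 1) div 2
     in
     tensor_decomposition m n n T p q r \<rhd> (\<lambda>(a, b, c).
     let B = mat n r (\<lambda>(j, l). b l j);
         C = mat r n (\<lambda>(l, k). c l k);
         Dt = (\<lambda>i. mat_diag r (\<lambda>l. a l i))
     in
     find_any (\<lambda>Dh. Dh \<in> carrier_mat r r \<and> diagonal_mat Dh \<and>
       mat_inv M * B * Dh * C = 1\<^sub>m n) \<rhd> (\<lambda>Dh.
     let U0 = mat_inv M * B * Dh in
     find_any (\<lambda>B'. B' \<in> carrier_mat r (r - n) \<and>
       (\<lambda>x. B' *\<^sub>v x) ` carrier_vec (r - n) = mat_kernel U0) \<rhd> (\<lambda>B'.
     find_any (\<lambda>A'. A' \<in> carrier_mat r (r - n) \<and>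
       A'\<^sup>T * B' = 1\<^sub>m (r - n) \<and> A'\<^sup>T * C = 0\<^sub>m (r - n) n) \<rhd> (\<lambda>A'.
     let Ut = (append_cols (U0\<^sup>T) A')\<^sup>T;
         Vt = append_cols C B'
     in
     fail_unless (invertible_mat Dh) \<rhd> (\<lambda>_.
     return (\<lambda>i. Ut * mat_inv Dh * Dt i * Vt)))))))"

subsection \<open>The free parameters\<close>

datatype parameter = R_entry nat nat | M_entry nat nat | D_entry nat nat

definition parameters :: "nat \<Rightarrow> nat \<Rightarrow> nat \<Rightarrow> parameter set" where
  "parameters m n r =
     {R_entry i j | i j. i < r \<and> j < r} \<union> {M_entry i j | i j. i < n \<and> j < n} \<union>
     {D_entry i j | i j. i < m \<and> j < r}"

end

theory Submission
  imports Defs "Jordan_Normal_Form.Determinant" "HOL-Computational_Algebra.Polynomial"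
begin

text \<open>Write \<open>a\<^sub>l, b\<^sub>l, c\<^sub>l\<close> for the factors of the tensor with slices \<open>M A\<^sub>i\<close>: the entries \<open>(D\<^sub>i)\<^sub>l\<^sub>l\<close>, the
  columns of \<open>M\<close> times the first \<open>n\<close> rows of \<open>R\<^sup>-\<^sup>1\<close>, and the rows of the first \<open>n\<close> columns of \<open>R\<close>. The
  column space of the flattening lies in the sum of the spaces \<open>(a\<^sub>l \<lrcorner> \<Lambda>\<^bsup>p+1\<^esup>) \<otimes> b\<^sub>l\<close>. It equals this sum if
  the spaces \<open>(a\<^sub>l \<and> \<Lambda>\<^sup>p) \<otimes> c\<^sub>l\<close> are independent, and it meets \<open>Z \<otimes> \<real>\<^sup>n\<close> only in the span of the
  \<open>d\<^sub>l \<otimes> b\<^sub>l\<close>, where \<open>d\<^sub>l\<close> is the truncation of \<open>a\<^sub>l\<close>, if the spaces \<open>(a\<^sub>l \<lrcorner> \<Lambda>\<^bsup>p+1\<^esup>) \<otimes> b\<^sub>l\<close> are independent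
  modulo \<open>Z \<otimes> \<real>\<^sup>n\<close> and \<open>d\<^sub>l \<otimes> b\<^sub>l\<close>. The only rank-one elements of that span are the \<open>d\<^sub>l \<otimes> b\<^sub>l\<close> if the
  \<open>(d\<^sub>l \<and> d\<^sub>k) \<otimes> (b\<^sub>l \<and> b\<^sub>k)\<close> are independent. So the algorithm recovers all \<open>b\<^sub>l\<close> and \<open>c\<^sub>l\<close> up to scaling and a
  common permutation, and independence of the \<open>b\<^sub>l \<otimes> c\<^sub>l\<close> pins down the diagonal matrix of step (5).
  All these conditions are independence statements about families with polynomial entries, so each of
  them needs to be verified at a single configuration only. The factors are rational functions of the
  parameters with dense image.\<close>

subsection \<open>Polynomial functions and genericity\<close>

text \<open>The rank bound comes from one degenerate configuration. With first factors
  \<open>e_0 + e_(l mod q)\<close>, at most \<open>q - p + 1 = p + 2\<close> residue classes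
  interfere at a coordinate once earlier coordinates are cleared, and Vandermonde vectors in
  dimension \<open>n\<close> separate them if each class has at most \<open>n div (p + 2)\<close>
  members. So \<open>r \<le> q * (n div (p + 2))\<close> suffices, which for
  \<open>q = 2 * p + 1\<close> is about \<open>2 * n * (1 - 3 / (q + 3))\<close>; the stated bound
  leaves room for even \<open>m\<close> and for rounding. The same \<open>q\<close> gives
  \<open>q - p - 1 = p\<close>. Hence the two flattenings differ only by exchanging \<open>b\<close>
  and \<open>c\<close>, and both truncate the first factors to the same \<open>d\<close>, which
  makes the two recovered orders comparable. The obstacle to a polynomial formulation is that
  \<open>a \<and> a = 0\<close> creates relations among the generators of the exterior and interior
  products. If \<open>a 0 \<noteq> 0\<close>, forms avoiding the index \<open>0\<close> (for
  exterior products) or containing it (for interior products) parametrize these spaces without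
  relations. The factor matrices always satisfy \<open>B C = M\<close>; conversely almost all
  \<open>B\<close>, \<open>C\<close> occur, with \<open>M\<close> defined as
  \<open>B C\<close>.\<close>

lemma polynomial_in_sum:
  assumes "\<And>i. i \<in> I \<Longrightarrow> polynomial_in V (f i)"
  shows "polynomial_in V (\<lambda>x. \<Sum>i\<in>I. f i x)"
  using assms by (induction I rule: infinite_finite_induct) (auto intro: polynomial_in.intros)

lemma polynomial_in_prod:
  assumes "\<And>i. i \<in> I \<Longrightarrow> polynomial_in V (f i)"
  shows "polynomial_in V (\<lambda>x. \<Prod>i\<in>I. f i x)"
  using assms by (induction I rule: infinite_finite_induct) (auto intro: polynomial_in.intros)

lemma polynomial_in_diff:
  assumes "polynomial_in V f" and "polynomial_in V g"
  shows "polynomial_in V (\<lambda>x. f x - g x)"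
  using polynomial_in.add[OF assms(1) polynomial_in.mult[OF polynomial_in.const[of V "-1"] assms(2)]]
  by simp

lemma polynomial_in_power: "polynomial_in V f \<Longrightarrow> polynomial_in V (\<lambda>x. f x ^ k)"
  by (induction k) (auto intro: polynomial_in.intros)

lemma polynomial_in_if:
  assumes "b \<Longrightarrow> polynomial_in V f" and "\<not> b \<Longrightarrow> polynomial_in V g"
  shows "polynomial_in V (\<lambda>x. if b then f x else g x)"
  using assms by (cases b) auto

lemmas polynomial_in_intros = polynomial_in.intros polynomial_in_sum polynomial_in_prod
  polynomial_in_diff polynomial_in_power polynomial_in_if

lemma polynomial_in_det:
  assumes "\<And>i j. i < k \<Longrightarrow> j < k \<Longrightarrow> polynomial_in V (\<lambda>x. A x $$ (i, j))"
    and "\<And>x. A x \<in> carrier_mat k k"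
  shows "polynomial_in V (\<lambda>x. det (A x))"
proof -
  have eq: "det (A x) = (\<Sum>\<pi> \<in> {\<pi>. \<pi> permutes {0..<k}}.
      signof \<pi> * (\<Prod>i = 0..<k. A x $$ (i, \<pi> i)))" for x
    by (rule det_def'[OF assms(2)])
  have "polynomial_in V (\<lambda>x. \<Sum>\<pi> \<in> {\<pi>. \<pi> permutes {0..<k}}.
      signof \<pi> * (\<Prod>i = 0..<k. A x $$ (i, \<pi> i)))"
    by (intro polynomial_in_intros assms(1)) (auto dest: permutes_in_image)
  then show ?thesis unfolding eq .
qed

text \<open>Needed because the point hit by a substitution is prescribed only on the variables of
  \<open>V\<close>; its other coordinates are arbitrary.\<close>

lemma polynomial_in_cong:
  assumes "polynomial_in V f" and "\<And>v. v \<in> V \<Longrightarrow> x v = y v"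
  shows "f x = f y"
  using assms by induction auto

text \<open>Restriction to a line replaces functions of many variables by \<open>real poly\<close>,
  an integral domain whose nonzero elements do not vanish everywhere.\<close>

lemma polynomial_in_line:
  assumes "polynomial_in V f"
  shows "\<exists>P. \<forall>t. f (\<lambda>v. x v + t * (y v - x v)) = poly P t"
  using assms
proof induction
  case (const a)
  show ?case by (rule exI[of _ "[:a:]"]) simp
next
  case (var v)
  show ?case by (rule exI[of _ "[:x v, y v - x v:]"]) (simp add: algebra_simps)
next
  case (add f g)
  then obtain P Q where "\<forall>t. f (\<lambda>v. x v + t * (y v - x v)) = poly P t"
    "\<forall>t. g (\<lambda>v. x v + t * (y v - x v)) = poly Q t" by blast
  then show ?case by (intro exI[of _ "P + Q"]) simp
next
  case (mult f g)
  then obtain P Q where "\<forall>t. f (\<lambda>v. x v + t * (y v - x v)) = poly P t"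
    "\<forall>t. g (\<lambda>v. x v + t * (y v - x v)) = poly Q t" by blast
  then show ?case by (intro exI[of _ "P * Q"]) simp
qed

text \<open>On the line joining a point where \<open>f\<close> does not vanish to one where \<open>g\<close> does not vanish, both
  are nonzero polynomials in one variable.\<close>

lemma polynomial_in_mult_nonzero:
  assumes f: "polynomial_in V f" and g: "polynomial_in V g" and x: "f x \<noteq> 0" and y: "g y \<noteq> 0"
  shows "\<exists>z. f z * g z \<noteq> 0"
proof -
  obtain P where P: "\<And>t. f (\<lambda>v. x v + t * (y v - x v)) = poly P t"
    using polynomial_in_line[OF f] by blast
  obtain Q where Q: "\<And>t. g (\<lambda>v. x v + t * (y v - x v)) = poly Q t"
    using polynomial_in_line[OF g] by blast
  have "P \<noteq> 0" using P[of 0] x by auto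
  moreover have "Q \<noteq> 0" using Q[of 1] y by auto
  ultimately have "P * Q \<noteq> 0" by simp
  then obtain t where "poly (P * Q) t \<noteq> 0" using poly_all_0_iff_0 by blast
  then show ?thesis by (intro exI[of _ "\<lambda>v. x v + t * (y v - x v)"]) (simp add: P Q)
qed

lemma generically_conj:
  assumes "generically V P" and "generically V Q"
  shows "generically V (\<lambda>x. P x \<and> Q x)"
proof -
  obtain f g where f: "polynomial_in V f" "\<exists>x. f x \<noteq> 0" "\<forall>x. f x \<noteq> 0 \<longrightarrow> P x"
    and g: "polynomial_in V g" "\<exists>x. g x \<noteq> 0" "\<forall>x. g x \<noteq> 0 \<longrightarrow> Q x"
    using assms unfolding generically_def by blast
  have "\<exists>x. f x * g x \<noteq> 0"
    using polynomial_in_mult_nonzero[OF f(1) g(1)] f(2) g(2) by blast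
  with f g show ?thesis
    unfolding generically_def by (intro exI[of _ "\<lambda>x. f x * g x"]) (auto intro: polynomial_in.mult)
qed

lemma generically_mono:
  assumes "generically V P" and "\<And>x. P x \<Longrightarrow> Q x"
  shows "generically V Q"
  using assms unfolding generically_def by blast

lemma generically_nonzero:
  assumes "polynomial_in V f" and "f x \<noteq> 0"
  shows "generically V (\<lambda>x. f x \<noteq> 0)"
  using assms unfolding generically_def by blast

lemma generically_ball:
  assumes "finite I" and "\<And>i. i \<in> I \<Longrightarrow> generically V (P i)"
  shows "generically V (\<lambda>x. \<forall>i\<in>I. P i x)"
  using assms
proof (induction I rule: finite_induct)
  case empty
  show ?case unfolding generically_def
    by (intro exI[of _ "\<lambda>x. 1"]) (auto intro: polynomial_in.const)
next
  case (insert i I)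
  then show ?case using generically_conj[of V "P i" "\<lambda>x. \<forall>i\<in>I. P i x"] by simp
qed

lemma generically_point:
  assumes "generically V P"
  shows "\<exists>x. P x"
  using assms unfolding generically_def by blast

section \<open>Pulling genericity back along rational maps\<close>

lemma polynomial_in_rational_substitution:
  assumes "polynomial_in W f" and "\<And>w. w \<in> W \<Longrightarrow> polynomial_in V (\<lambda>x. num x w)"
    and "polynomial_in V den"
  shows "\<exists>g N. polynomial_in V g \<and>
    (\<forall>x. den x \<noteq> 0 \<longrightarrow> g x = den x ^ N * f (\<lambda>w. num x w / den x))"
  using assms(1)
proof induction
  case (const a)
  show ?case by (intro exI[of _ "\<lambda>x. a"] exI[of _ 0]) (auto intro: polynomial_in.intros)
next
  case (var w)
  then show ?case
    by (intro exI[of _ "\<lambda>x. num x w"] exI[of _ 1]) (auto intro: assms(2))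
next
  case (add f1 f2)
  then obtain g1 N1 g2 N2 where
    g: "polynomial_in V g1" "polynomial_in V g2"
      "\<And>x. den x \<noteq> 0 \<Longrightarrow> g1 x = den x ^ N1 * f1 (\<lambda>w. num x w / den x)"
      "\<And>x. den x \<noteq> 0 \<Longrightarrow> g2 x = den x ^ N2 * f2 (\<lambda>w. num x w / den x)" by blast
  show ?case
  proof (intro exI conjI allI impI)
    \<comment> \<open>The summands may carry different powers of \<open>den\<close>; each is padded
      with the other's power so that \<open>N1 + N2\<close> serves both.\<close>
    show "polynomial_in V (\<lambda>x. den x ^ N2 * g1 x + den x ^ N1 * g2 x)"
      by (intro polynomial_in_intros g assms(3))
    show "den x ^ N2 * g1 x + den x ^ N1 * g2 x =
        den x ^ (N1 + N2) * (f1 (\<lambda>w. num x w / den x) + f2 (\<lambda>w. num x w / den x))"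
      if "den x \<noteq> 0" for x
      by (simp add: g(3,4)[OF that] power_add algebra_simps)
  qed
next
  case (mult f1 f2)
  then obtain g1 N1 g2 N2 where
    g: "polynomial_in V g1" "polynomial_in V g2"
      "\<And>x. den x \<noteq> 0 \<Longrightarrow> g1 x = den x ^ N1 * f1 (\<lambda>w. num x w / den x)"
      "\<And>x. den x \<noteq> 0 \<Longrightarrow> g2 x = den x ^ N2 * f2 (\<lambda>w. num x w / den x)" by blast
  show ?case
  proof (intro exI conjI allI impI)
    show "polynomial_in V (\<lambda>x. g1 x * g2 x)"
      by (intro polynomial_in_intros g)
    show "g1 x * g2 x =
        den x ^ (N1 + N2) * (f1 (\<lambda>w. num x w / den x) * f2 (\<lambda>w. num x w / den x))"
      if "den x \<noteq> 0" for x
      by (simp add: g(3,4)[OF that] power_add algebra_simps)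
  qed
qed

text \<open>\<open>dominant\<close> says that the image of the rational map meets every generic set,
  that is, the image is Zariski dense; hence the pulled-back polynomial is not identically
  zero.\<close>

lemma generically_rational_substitution:
  assumes "generically W P" and num: "\<And>w. w \<in> W \<Longrightarrow> polynomial_in V (\<lambda>x. num x w)"
    and den: "polynomial_in V den"
    and dominant: "\<And>Q. generically W Q \<Longrightarrow>
      \<exists>x y. den x \<noteq> 0 \<and> Q y \<and> (\<forall>w\<in>W. num x w / den x = y w)"
  shows "generically V (\<lambda>x. den x \<noteq> 0 \<and> P (\<lambda>w. num x w / den x))"
proof -
  obtain f where f: "polynomial_in W f" "\<exists>y. f y \<noteq> 0" "\<And>y. f y \<noteq> 0 \<Longrightarrow> P y"
    using assms(1) unfolding generically_def by blast
  obtain g N where g: "polynomial_in V g"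
      "\<And>x. den x \<noteq> 0 \<Longrightarrow> g x = den x ^ N * f (\<lambda>w. num x w / den x)"
    using polynomial_in_rational_substitution[of W f V num den, OF f(1) num den] by blast
  have "generically W (\<lambda>y. f y \<noteq> 0)"
    using f(1,2) unfolding generically_def by blast
  from dominant[OF this] obtain x y where x: "den x \<noteq> 0" "f y \<noteq> 0"
      "\<forall>w\<in>W. num x w / den x = y w" by blast
  have "f (\<lambda>w. num x w / den x) = f y"
    using x(3) by (intro polynomial_in_cong[OF f(1)]) auto
  \<comment> \<open>Nothing is known about \<open>g\<close> where \<open>den\<close> vanishes, so
    the certificate is \<open>den * g\<close> and not \<open>g\<close> alone.\<close>
  then have "den x * g x \<noteq> 0" using x g(2)[of x] by simp
  then show ?thesis
    unfolding generically_def
    by (intro exI[of _ "\<lambda>x. den x * g x"])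
      (auto intro: polynomial_in_intros den g simp: g(2) f(3))
qed

subsection \<open>Linear independence is a generic property\<close>

text \<open>Indexed families make repeated vectors count as dependent. Restricting the coordinates
  to \<open>J\<close> expresses independence modulo the vectors that vanish on
  \<open>J\<close>.\<close>

definition indep_family :: "'i set \<Rightarrow> 'j set \<Rightarrow> ('i \<Rightarrow> 'j \<Rightarrow> real) \<Rightarrow> bool" where
  "indep_family I J w \<longleftrightarrow> (\<forall>c. (\<forall>j\<in>J. (\<Sum>i\<in>I. c i * w i j) = 0) \<longrightarrow> (\<forall>i\<in>I. c i = 0))"

lemma indep_familyI:
  "(\<And>c i. (\<And>j. j \<in> J \<Longrightarrow> (\<Sum>i\<in>I. c i * w i j) = 0) \<Longrightarrow> i \<in> I \<Longrightarrow> c i = 0) \<Longrightarrow> indep_family I J w"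
  unfolding indep_family_def by blast

lemma indep_familyD:
  "indep_family I J w \<Longrightarrow> (\<And>j. j \<in> J \<Longrightarrow> (\<Sum>i\<in>I. c i * w i j) = 0) \<Longrightarrow> i \<in> I \<Longrightarrow> c i = 0"
  unfolding indep_family_def by blast

text \<open>Fraction-free Gaussian elimination, one vector at a time; the product of the pivots is the
  polynomial that certifies independence.\<close>

lemma generically_indep_family:
  assumes "finite I" and "\<And>i j. i \<in> I \<Longrightarrow> j \<in> J \<Longrightarrow> polynomial_in V (\<lambda>x. w x i j)"
    and "indep_family I J (w x0)"
  shows "generically V (\<lambda>x. indep_family I J (w x))"
proof -
  have "\<exists>f. polynomial_in V f \<and> f x0 \<noteq> 0 \<and> (\<forall>x. f x \<noteq> 0 \<longrightarrow> indep_family I J (w x))"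
    using assms
  proof (induction I arbitrary: w rule: finite_induct)
    case empty
    show ?case
      by (intro exI[of _ "\<lambda>x. 1"]) (auto intro: polynomial_in.const simp: indep_family_def)
  next
    case (insert i0 I)
    have "\<exists>j\<in>J. w x0 i0 j \<noteq> 0"
    proof (rule ccontr)
      assume "\<not> (\<exists>j\<in>J. w x0 i0 j \<noteq> 0)"
      then have "(\<Sum>i\<in>insert i0 I. (if i = i0 then 1 else 0) * w x0 i j) = 0" if "j \<in> J" for j
        using insert.hyps that by (auto intro!: sum.neutral)
      then show False
        using indep_familyD[OF insert.prems(2), of "\<lambda>i. if i = i0 then 1 else 0" i0] by simp
    qed
    then obtain j0 where j0: "j0 \<in> J" "w x0 i0 j0 \<noteq> 0" by blast
    \<comment> \<open>Cross-multiplication with the pivot clears coordinate \<open>j0\<close>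
      without division, so the entries stay polynomial.\<close>
    define w' where "w' x i j = w x i0 j0 * w x i j - w x i j0 * w x i0 j" for x i j
    have comb: "(\<Sum>i\<in>I. c i * w' x i j) =
        w x i0 j0 * (\<Sum>i\<in>I. c i * w x i j) - (\<Sum>i\<in>I. c i * w x i j0) * w x i0 j" for c x j
      unfolding w'_def by (simp add: sum_subtractf sum_distrib_left sum_distrib_right algebra_simps)
    have "indep_family I J (w' x0)"
    proof (rule indep_familyI)
      fix c i
      assume c: "\<And>j. j \<in> J \<Longrightarrow> (\<Sum>i\<in>I. c i * w' x0 i j) = 0" and i: "i \<in> I"
      \<comment> \<open>A relation among the reduced vectors lifts to the original ones: it is
        multiplied by the pivot, and \<open>i0\<close> receives the coefficient of what the
        elimination subtracted.\<close>
      define c' where "c' k = (if k = i0 then - (\<Sum>i\<in>I. c i * w x0 i j0)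
        else w x0 i0 j0 * c k)" for k
      have "(\<Sum>k\<in>insert i0 I. c' k * w x0 k j) = 0" if "j \<in> J" for j
      proof -
        have "(\<Sum>k\<in>I. c' k * w x0 k j) = w x0 i0 j0 * (\<Sum>i\<in>I. c i * w x0 i j)"
          using insert.hyps by (auto simp: c'_def sum_distrib_left mult.assoc intro!: sum.cong)
        then show ?thesis
          using insert.hyps c[OF that] by (simp add: comb c'_def[of i0])
      qed
      then have "c' i = 0"
        using indep_familyD[OF insert.prems(2), of c' i] i by blast
      then show "c i = 0"
        using i insert.hyps j0 by (auto simp: c'_def split: if_splits)
    qed
    moreover have "polynomial_in V (\<lambda>x. w' x i j)" if "i \<in> I" "j \<in> J" for i j
      unfolding w'_def using that j0 by (intro polynomial_in_intros insert.prems) auto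
    ultimately obtain f where f: "polynomial_in V f" "f x0 \<noteq> 0"
        "\<And>x. f x \<noteq> 0 \<Longrightarrow> indep_family I J (w' x)"
      using insert.IH[of w'] by blast
    show ?case
    proof (intro exI conjI allI impI)
      show "polynomial_in V (\<lambda>x. f x * w x i0 j0)"
        using f j0 by (intro polynomial_in_intros insert.prems) auto
      show "f x0 * w x0 i0 j0 \<noteq> 0" using f j0 by simp
      fix x
      assume x: "f x * w x i0 j0 \<noteq> 0"
      show "indep_family (insert i0 I) J (w x)"
      proof (rule indep_familyI)
        fix c i
        assume c: "\<And>j. j \<in> J \<Longrightarrow> (\<Sum>i\<in>insert i0 I. c i * w x i j) = 0"
          and i: "i \<in> insert i0 I"
        have eq: "(\<Sum>i\<in>I. c i * w x i j) = - (c i0 * w x i0 j)" if "j \<in> J" for j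
          using c[OF that] insert.hyps by simp
        have "(\<Sum>i\<in>I. c i * w' x i j) = 0" if "j \<in> J" for j
          by (simp add: comb eq[OF that] eq[OF j0(1)])
        then have zero: "c k = 0" if "k \<in> I" for k
          using indep_familyD[OF f(3), of x c k] x that by auto
        then have "c i0 * w x i0 j0 = 0" using eq[OF j0(1)] by simp
        then show "c i = 0" using i zero x by auto
      qed
    qed
  qed
  then show ?thesis unfolding generically_def by blast
qed

subsection \<open>Programs that never fail\<close>

text \<open>Nonemptiness is included because the empty program meets every universal requirement on
  its outcomes.\<close>

definition succeeds_with :: "'a program \<Rightarrow> ('a \<Rightarrow> bool) \<Rightarrow> bool" where
  "succeeds_with X P \<longleftrightarrow> X \<noteq> {} \<and> (\<forall>out\<in>X. \<exists>a. out = Some a \<and> P a)"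

lemma succeeds_with_return: "P a \<Longrightarrow> succeeds_with (return a) P"
  by (simp add: succeeds_with_def return_def)

lemma succeeds_with_find_any:
  "\<exists>a. Q a \<Longrightarrow> (\<And>a. Q a \<Longrightarrow> P a) \<Longrightarrow> succeeds_with (find_any Q) P"
  by (auto simp: succeeds_with_def find_any_def)

lemma succeeds_with_fail_unless: "b \<Longrightarrow> P () \<Longrightarrow> succeeds_with (fail_unless b) P"
  by (simp add: succeeds_with_def fail_unless_def)

lemma succeeds_with_and_then:
  assumes "succeeds_with X P" and "\<And>a. P a \<Longrightarrow> succeeds_with (f a) Q"
  shows "succeeds_with (X \<rhd> f) Q"
proof -
  have ok: "\<exists>a. out = Some a \<and> succeeds_with (f a) Q" if "out \<in> X" for out
    using assms that unfolding succeeds_with_def[of X] by blast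
  moreover have "X \<noteq> {}" using assms(1) by (simp add: succeeds_with_def)
  ultimately have "\<exists>a. Some a \<in> X \<and> f a \<noteq> {}"
    unfolding succeeds_with_def by blast
  then have "X \<rhd> f \<noteq> {}" by (force simp: and_then_def)
  moreover have "\<exists>b. out = Some b \<and> Q b" if out: "out \<in> X \<rhd> f" for out
  proof -
    obtain y where y: "y \<in> X" "out \<in> (case y of None \<Rightarrow> {None} | Some a \<Rightarrow> f a)"
      using out by (auto simp: and_then_def)
    obtain a where a: "y = Some a" "succeeds_with (f a) Q" using ok[OF y(1)] by blast
    with y(2) show ?thesis by (simp add: succeeds_with_def)
  qed
  ultimately show ?thesis unfolding succeeds_with_def by blast
qed

subsection \<open>Spans and independence of finite families\<close>

lemma sum_fun_eq: "(\<Sum>i\<in>I. f i) = (\<lambda>x. \<Sum>i\<in>I. f i x :: real)"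
  by (induction I rule: infinite_finite_induct) (auto simp: fun_eq_iff)

lemma span_family:
  assumes "finite I"
  shows "fvs.span (v ` I) = range (\<lambda>c x. \<Sum>i\<in>I. c i * v i x)"
proof
  let ?W = "range (\<lambda>c x. \<Sum>i\<in>I. c i * v i x)"
  have "fvs.subspace ?W"
  proof (rule fvs.subspaceI)
    have "0 = (\<lambda>x. \<Sum>i\<in>I. 0 * v i x)" by (simp add: fun_eq_iff)
    then show "0 \<in> ?W" by (rule range_eqI[of _ _ "\<lambda>_. 0"])
  next
    fix y z assume "y \<in> ?W" "z \<in> ?W"
    then obtain c e where "y = (\<lambda>x. \<Sum>i\<in>I. c i * v i x)" "z = (\<lambda>x. \<Sum>i\<in>I. e i * v i x)" by blast
    then have "y + z = (\<lambda>x. \<Sum>i\<in>I. (c i + e i) * v i x)"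
      by (simp add: fun_eq_iff sum.distrib distrib_right)
    then show "y + z \<in> ?W" by (rule range_eqI[of _ _ "\<lambda>i. c i + e i"])
  next
    fix s y assume "y \<in> ?W"
    then obtain c where "y = (\<lambda>x. \<Sum>i\<in>I. c i * v i x)" by blast
    then have "(\<lambda>x. s * y x) = (\<lambda>x. \<Sum>i\<in>I. (s * c i) * v i x)"
      by (simp add: fun_eq_iff sum_distrib_left mult.assoc)
    then show "(\<lambda>x. s * y x) \<in> ?W" by (rule range_eqI[of _ _ "\<lambda>i. s * c i"])
  qed
  moreover have "v ` I \<subseteq> ?W"
  proof
    fix y assume "y \<in> v ` I"
    then obtain k where k: "k \<in> I" "y = v k" by blast
    have "(\<Sum>i\<in>I. (if i = k then 1 else 0) * v i x) = v k x" for x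
      using k(1) assms by (subst sum.remove[of _ k]) auto
    then have "y = (\<lambda>x. \<Sum>i\<in>I. (if i = k then 1 else 0) * v i x)"
      by (simp add: fun_eq_iff k(2))
    then show "y \<in> ?W" by (rule range_eqI[of _ _ "\<lambda>i. if i = k then 1 else 0"])
  qed
  ultimately show "fvs.span (v ` I) \<subseteq> ?W" by (intro fvs.span_minimal)
  show "?W \<subseteq> fvs.span (v ` I)"
  proof
    fix y assume "y \<in> ?W"
    then obtain c where "y = (\<Sum>i\<in>I. (\<lambda>x. c i * v i x))" unfolding sum_fun_eq by blast
    then show "y \<in> fvs.span (v ` I)"
      by (auto intro!: fvs.span_sum fvs.span_scale intro: fvs.span_base)
  qed
qed

text \<open>Indexed independence already forces distinct entries, so it can replace both conditions
  of \<open>lin_indep_list\<close> in coefficient computations.\<close>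

lemma lin_indep_list_iff:
  "lin_indep_list vs \<longleftrightarrow> indep_family {..<length vs} UNIV (\<lambda>l. vs ! l)"
proof
  assume vs: "lin_indep_list vs"
  show "indep_family {..<length vs} UNIV (\<lambda>l. vs ! l)"
  proof (rule indep_familyI)
    fix c l
    assume c: "\<And>x. x \<in> UNIV \<Longrightarrow> (\<Sum>l<length vs. c l * (vs ! l) x) = 0" and l: "l \<in> {..<length vs}"
    have bij: "bij_betw ((!) vs) {..<length vs} (set vs)"
      using vs by (intro bij_betw_nth) (auto simp: lin_indep_list_def)
    then have inj: "inj_on ((!) vs) {..<length vs}" by (rule bij_betw_imp_inj_on)
    define u where "u = (\<lambda>y. c (the_inv_into {..<length vs} ((!) vs) y))"
    have u: "u (vs ! k) = c k" if "k < length vs" for k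
      unfolding u_def using that the_inv_into_f_f[OF inj, of k] by simp
    have "(\<Sum>y\<in>set vs. (\<lambda>x. u y * y x)) = (\<Sum>k<length vs. (\<lambda>x. u (vs ! k) * (vs ! k) x))"
      by (rule sum.reindex_bij_betw[OF bij, symmetric])
    also have "\<dots> = (\<Sum>k<length vs. (\<lambda>x. c k * (vs ! k) x))"
      by (rule sum.cong) (simp_all add: u)
    also have "\<dots> = 0" using c by (simp add: sum_fun_eq fun_eq_iff)
    finally have "u (vs ! l) = 0"
      using vs l by (intro fvs.independentD[of "set vs" "set vs" u]) (auto simp: lin_indep_list_def)
    then show "c l = 0" using u l by simp
  qed
next
  assume ind: "indep_family {..<length vs} UNIV (\<lambda>l. vs ! l)"
  have dist: "distinct vs"
  proof (rule ccontr)
    assume "\<not> distinct vs"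
    then obtain i j where ij: "i < length vs" "j < length vs" "i \<noteq> j" "vs ! i = vs ! j"
      by (auto simp: distinct_conv_nth)
    define c :: "nat \<Rightarrow> real" where "c l = (if l = i then 1 else if l = j then -1 else 0)" for l
    have "(\<Sum>l<length vs. c l * (vs ! l) x) = (\<Sum>l\<in>{i, j}. c l * (vs ! l) x)" for x
      using ij by (intro sum.mono_neutral_right) (auto simp: c_def)
    then have "(\<Sum>l<length vs. c l * (vs ! l) x) = 0" for x
      using ij by (simp add: c_def)
    then have "c i = 0" using indep_familyD[OF ind, of c i] ij by simp
    then show False by (simp add: c_def)
  qed
  have bij: "bij_betw ((!) vs) {..<length vs} (set vs)"
    using dist by (intro bij_betw_nth) auto
  have "fvs.independent (set vs)"
  proof (rule fvs.independent_if_scalars_zero)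
    fix u y
    assume u: "(\<Sum>y\<in>set vs. (\<lambda>x. u y * y x)) = 0" and y: "y \<in> set vs"
    have "(\<Sum>k<length vs. u (vs ! k) * (vs ! k) x) = 0" for x
    proof -
      have "(\<Sum>k<length vs. (\<lambda>x. u (vs ! k) * (vs ! k) x)) = 0"
        using sum.reindex_bij_betw[OF bij, of "\<lambda>y x. u y * y x"] u by simp
      then show ?thesis by (simp add: sum_fun_eq fun_eq_iff)
    qed
    then have "u (vs ! k) = 0" if "k < length vs" for k
      using indep_familyD[OF ind, of "\<lambda>k. u (vs ! k)" k] that by simp
    then show "u y = 0" using y by (auto simp: in_set_conv_nth)
  qed simp
  with dist show "lin_indep_list vs" by (simp add: lin_indep_list_def)
qed

lemma lin_indep_list_map:
  "lin_indep_list (map v [0..<r]) \<longleftrightarrow> indep_family {..<r} UNIV v"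
  unfolding lin_indep_list_iff by (auto simp: indep_family_def)

lemma indep_family_nonzero:
  assumes "indep_family I J v" and "finite I" and "i \<in> I"
  shows "\<exists>j\<in>J. v i j \<noteq> 0"
proof (rule ccontr)
  assume "\<not> (\<exists>j\<in>J. v i j \<noteq> 0)"
  then have "(\<Sum>k\<in>I. (if k = i then 1 else 0) * v k j) = 0" if "j \<in> J" for j
    using that by (auto intro!: sum.neutral)
  then show False
    using indep_familyD[OF assms(1), of "\<lambda>k. if k = i then 1 else 0" i] assms(3) by simp
qed

lemma indep_family_not_proportional:
  assumes "indep_family I J v" and "finite I" and "i \<in> I" "k \<in> I" "i \<noteq> k"
  shows "\<exists>j\<in>J. v i j \<noteq> s * v k j"
proof (rule ccontr)
  assume eq: "\<not> (\<exists>j\<in>J. v i j \<noteq> s * v k j)"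
  define c :: "'a \<Rightarrow> real" where "c l = (if l = i then 1 else if l = k then -s else 0)" for l
  have "(\<Sum>l\<in>I. c l * v l j) = 0" if "j \<in> J" for j
  proof -
    have "(\<Sum>l\<in>I. c l * v l j) = (\<Sum>l\<in>{i, k}. c l * v l j)"
      using assms by (intro sum.mono_neutral_right) (auto simp: c_def)
    moreover have "v i j = s * v k j" using eq that by blast
    moreover have "c i = 1" "c k = -s" using assms(5) by (auto simp: c_def)
    ultimately show ?thesis using assms(5) by simp
  qed
  then have "c i = 0" using indep_familyD[OF assms(1), of c i] assms(3) by blast
  then show False by (simp add: c_def)
qed

subsection \<open>Jennrich's algorithm on squares of independent vectors\<close>

text \<open>Evaluating the second slot at a point where \<open>v k\<close> does not vanish turns a
  relation among the squares into one among the \<open>v i\<close>.\<close>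

lemma indep_family_squares:
  assumes "indep_family I UNIV v" and "finite I"
  shows "indep_family I UNIV (\<lambda>i. tensor (v i) (v i))"
proof (rule indep_familyI)
  fix c k
  assume c: "\<And>z. z \<in> UNIV \<Longrightarrow> (\<Sum>i\<in>I. c i * tensor (v i) (v i) z) = 0" and k: "k \<in> I"
  obtain y where y: "v k y \<noteq> 0" using indep_family_nonzero[OF assms k] by blast
  have "(\<Sum>i\<in>I. (c i * v i y) * v i x) = 0" for x
    using c[of "(x, y)"] by (simp add: tensor_def mult_ac)
  then have "c k * v k y = 0"
    using indep_familyD[OF assms(1), of "\<lambda>i. c i * v i y" k] k by blast
  then show "c k = 0" using y by simp
qed

text \<open>A symmetric matrix of rank one that is diagonal in independent vectors has only one
  diagonal term. Evaluation at \<open>y0\<close> gives \<open>v\<close> as a combination of the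
  \<open>u i\<close>; comparing coefficients then makes \<open>v\<close> a multiple of any
  \<open>u i\<close> that occurs in it.\<close>

lemma square_in_span_of_squares:
  assumes u: "indep_family I UNIV u" and fin: "finite I" and v: "v y0 \<noteq> 0"
    and eq: "\<And>x y. v x * v y = (\<Sum>i\<in>I. c i * u i x * u i y)"
  shows "\<exists>i\<in>I. \<exists>s. s \<noteq> 0 \<and> v = (\<lambda>x. s * u i x)"
proof -
  define b where "b i = c i * u i y0 / v y0" for i
  have vb: "v x = (\<Sum>i\<in>I. b i * u i x)" for x
  proof -
    have "v x * v y0 = (\<Sum>i\<in>I. b i * u i x) * v y0"
      unfolding eq[of x y0] sum_distrib_right by (rule sum.cong) (use v in \<open>auto simp: b_def\<close>)
    then show ?thesis using v by simp
  qed
  \<comment> \<open>For fixed \<open>y\<close>, these are the coefficients of \<open>u i\<close> in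
    two expansions of \<open>v x * v y\<close> as functions of \<open>x\<close>.\<close>
  have "c i * u i y - b i * v y = 0" if "i \<in> I" for i y
  proof (rule indep_familyD[OF u _ that, of "\<lambda>i. c i * u i y - b i * v y"])
    fix x
    have "(\<Sum>i\<in>I. (c i * u i y - b i * v y) * u i x) =
        (\<Sum>i\<in>I. c i * u i x * u i y) - (\<Sum>i\<in>I. b i * u i x) * v y"
      by (simp add: sum_subtractf sum_distrib_left sum_distrib_right algebra_simps)
    also have "\<dots> = 0" by (simp add: eq[symmetric] vb[symmetric])
    finally show "(\<Sum>i\<in>I. (c i * u i y - b i * v y) * u i x) = 0" .
  qed
  then have cb: "c i * u i y = b i * v y" if "i \<in> I" for i y using that by simp
  have "\<exists>i\<in>I. b i \<noteq> 0"
    using vb[of y0] v by (metis (no_types, lifting) mult_zero_left sum.neutral)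
  then obtain i where i: "i \<in> I" "b i \<noteq> 0" by blast
  have "v = (\<lambda>x. (c i / b i) * u i x)" using cb[OF i(1)] i(2) by (auto simp: fun_eq_iff field_simps)
  moreover from this have "c i / b i \<noteq> 0" using v by (metis mult_zero_left)
  ultimately show ?thesis using i(1) by blast
qed

text \<open>Each \<open>v l\<close> is a multiple of one \<open>u (k l)\<close>. Two multiples of
  the same vector would be dependent, so \<open>k\<close> is injective, and finiteness makes it a
  bijection.\<close>

lemma jennrich_unique:
  fixes r :: nat
  assumes u: "indep_family {..<r} UNIV u" and v: "indep_family {..<r} UNIV v"
    and eq: "\<And>l x y. l < r \<Longrightarrow> v l x * v l y = (\<Sum>i<r. c l i * u i x * u i y)"
  shows "\<exists>\<pi> \<gamma>. \<pi> permutes {..<r} \<and> (\<forall>l<r. \<gamma> l \<noteq> 0 \<and> u l = (\<lambda>x. \<gamma> l * v (\<pi> l) x))"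
proof -
  have "\<exists>k s. k < r \<and> s \<noteq> 0 \<and> v l = (\<lambda>x. s * u k x)" if l: "l < r" for l
  proof -
    obtain y0 where y0: "v l y0 \<noteq> 0" using indep_family_nonzero[OF v finite_lessThan, of l] l by blast
    show ?thesis using square_in_span_of_squares[OF u finite_lessThan y0 eq[OF l]] by auto
  qed
  then obtain k s where ks: "\<And>l. l < r \<Longrightarrow> k l < r \<and> s l \<noteq> 0 \<and> v l = (\<lambda>x. s l * u (k l) x)"
    by metis
  have "inj_on k {..<r}"
  proof (rule inj_onI)
    fix l l' assume l: "l \<in> {..<r}" "l' \<in> {..<r}" "k l = k l'"
    then have "v l x = (s l / s l') * v l' x" for x using ks[of l] ks[of l'] by simp
    then show "l = l'" using indep_family_not_proportional[OF v finite_lessThan, of l l' "s l / s l'"] l by auto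
  qed
  moreover have "k ` {..<r} \<subseteq> {..<r}" using ks by auto
  ultimately have bij: "bij_betw k {..<r} {..<r}"
    by (simp add: bij_betw_def endo_inj_surj)
  \<comment> \<open>The inverse of \<open>k\<close>, extended by the identity because
    \<open>permutes\<close> constrains it outside \<open>{..<r}\<close> too.\<close>
  define \<pi> where "\<pi> l = (if l < r then the_inv_into {..<r} k l else l)" for l
  have "bij_betw (the_inv_into {..<r} k) {..<r} {..<r}" using bij by (rule bij_betw_the_inv_into)
  then have "bij_betw \<pi> {..<r} {..<r}"
    by (rule bij_betw_cong[THEN iffD1, rotated]) (simp add: \<pi>_def)
  then have perm: "\<pi> permutes {..<r}" by (rule bij_imp_permutes) (simp add: \<pi>_def)
  have "1 / s (\<pi> l) \<noteq> 0 \<and> u l = (\<lambda>x. 1 / s (\<pi> l) * v (\<pi> l) x)" if l: "l < r" for l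
  proof -
    have "\<pi> l < r" using permutes_in_image[OF perm, of l] l by simp
    moreover have "k (\<pi> l) = l"
      using l bij f_the_inv_into_f_bij_betw[OF bij, of l] by (simp add: \<pi>_def)
    ultimately show ?thesis using ks[of "\<pi> l"] by (simp add: fun_eq_iff)
  qed
  with perm show ?thesis by (intro exI[of _ \<pi>] exI[of _ "\<lambda>l. 1 / s (\<pi> l)"]) simp
qed

text \<open>A diagonalization expresses the chosen basis \<open>Ps\<close> by squares of its output
  \<open>vs\<close>. The squares of the \<open>v l\<close> lie in the span of \<open>Ps\<close>, so
  \<open>jennrich_unique\<close> identifies \<open>vs\<close> with \<open>v\<close> up to order and
  scale, whatever was chosen.\<close>

lemma succeeds_with_rank_one_elements:
  assumes v: "indep_family {..<r} UNIV v" and ro: "\<And>l. l < r \<Longrightarrow> rank_one (v l)"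
    and U: "U = fvs.span (v ` {..<r})"
    and ann: "rank_one_annihilator U = fvs.span ((\<lambda>l. tensor (v l) (v l)) ` {..<r})"
  shows "succeeds_with (rank_one_elements U) (\<lambda>vs. length vs = r \<and>
    (\<exists>\<pi> \<gamma>. \<pi> permutes {..<r} \<and> (\<forall>l<r. \<gamma> l \<noteq> 0 \<and> vs ! l = (\<lambda>x. \<gamma> l * v (\<pi> l) x))))"
proof -
  let ?sq = "\<lambda>l. tensor (v l) (v l)"
  let ?good = "\<lambda>vs. length vs = r \<and>
    (\<exists>\<pi> \<gamma>. \<pi> permutes {..<r} \<and> (\<forall>l<r. \<gamma> l \<noteq> 0 \<and> vs ! l = (\<lambda>x. \<gamma> l * v (\<pi> l) x)))"
  let ?basis = "\<lambda>Ps. lin_indep_list Ps \<and> fvs.span (set Ps) = fvs.span (?sq ` {..<r})"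
  have sq: "lin_indep_list (map ?sq [0..<r])"
    unfolding lin_indep_list_map by (rule indep_family_squares[OF v]) simp
  have set_sq: "set (map ?sq [0..<r]) = ?sq ` {..<r}" by (auto simp: atLeast0LessThan)
  \<comment> \<open>By comparing dimensions every admissible basis has \<open>r\<close> members, so
    the output also has the length that uniqueness requires.\<close>
  have len: "length Ps = r" if "?basis Ps" for Ps
  proof -
    have "length Ps = card (set Ps)" using that by (simp add: lin_indep_list_def distinct_card)
    also have "\<dots> = fvs.dim (fvs.span (set Ps))"
      using conjunct1[OF that]
      by (simp add: lin_indep_list_def fvs.dim_eq_card_independent fvs.dim_span)
    also have "\<dots> = fvs.dim (fvs.span (set (map ?sq [0..<r])))" using that set_sq by simp
    also have "\<dots> = card (set (map ?sq [0..<r]))"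
      using sq unfolding lin_indep_list_def fvs.dim_span by (intro fvs.dim_eq_card_independent) blast
    also have "\<dots> = r" using sq by (subst distinct_card) (auto simp: lin_indep_list_def)
    finally show ?thesis .
  qed
  have ex_diag: "\<exists>vs. length vs = length Ps \<and> lin_indep_list vs \<and>
     (\<exists>z :: nat \<Rightarrow> nat \<Rightarrow> real. \<forall>s<length Ps. \<forall>x y.
        (Ps ! s) (x, y) = (\<Sum>l<length vs. z l s * (vs ! l) x * (vs ! l) y))" if Ps: "?basis Ps" for Ps
  proof -
    have "\<exists>c. \<forall>x y. (Ps ! s) (x, y) = (\<Sum>l<r. c l * v l x * v l y)" if "s < length Ps" for s
    proof -
      have "Ps ! s \<in> fvs.span (?sq ` {..<r})"
        using Ps that fvs.span_base[of "Ps ! s" "set Ps"] by auto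
      then obtain c where "Ps ! s = (\<lambda>x. \<Sum>l<r. c l * ?sq l x)"
        by (auto simp: span_family)
      then show ?thesis by (auto simp: tensor_def mult.assoc)
    qed
    then obtain z where "\<And>s x y. s < length Ps \<Longrightarrow>
        (Ps ! s) (x, y) = (\<Sum>l<r. z s l * v l x * v l y)" by metis
    then show ?thesis using v len[OF Ps]
      by (intro exI[of _ "map v [0..<r]"] conjI exI[of _ "\<lambda>l s. z s l"])
        (simp_all add: lin_indep_list_map)
  qed
  have diag: "?good vs" if Ps: "?basis Ps" and vs: "length vs = length Ps" "lin_indep_list vs"
    and z: "\<forall>s<length Ps. \<forall>x y.
        (Ps ! s) (x, y) = (\<Sum>l<length vs. z l s * (vs ! l) x * (vs ! l) y)" for Ps vs z
  proof -
    have lvs: "length vs = r" using vs(1) len[OF Ps] by simp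
    have u: "indep_family {..<r} UNIV ((!) vs)" using vs(2) by (simp add: lin_indep_list_iff lvs)
    let ?usq = "(\<lambda>i. tensor (vs ! i) (vs ! i)) ` {..<r}"
    have "set Ps \<subseteq> fvs.span ?usq"
    proof
      fix P assume "P \<in> set Ps"
      then obtain s where s: "s < length Ps" "P = Ps ! s" by (auto simp: in_set_conv_nth)
      have "P = (\<lambda>x. \<Sum>i<r. z i s * tensor (vs ! i) (vs ! i) x)"
        using z s lvs by (auto simp: fun_eq_iff tensor_def mult.assoc)
      then show "P \<in> fvs.span ?usq" by (auto simp: span_family)
    qed
    then have sub: "fvs.span (?sq ` {..<r}) \<subseteq> fvs.span ?usq"
      using fvs.span_minimal[OF _ fvs.subspace_span] conjunct2[OF Ps] by blast
    have "\<exists>c. \<forall>x y. v l x * v l y = (\<Sum>i<r. c i * (vs ! i) x * (vs ! i) y)" if l: "l < r" for l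
    proof -
      have "?sq l \<in> fvs.span ?usq" using sub l fvs.span_base[of "?sq l" "?sq ` {..<r}"] by auto
      then obtain c where "?sq l = (\<lambda>x. \<Sum>i<r. c i * tensor (vs ! i) (vs ! i) x)"
        by (auto simp: span_family)
      then have "?sq l (x, y) = (\<Sum>i<r. c i * tensor (vs ! i) (vs ! i) (x, y))" for x y by metis
      then show ?thesis by (auto simp: tensor_def mult.assoc)
    qed
    then obtain c where "\<And>l x y. l < r \<Longrightarrow>
        v l x * v l y = (\<Sum>i<r. c l i * (vs ! i) x * (vs ! i) y)" by metis
    from jennrich_unique[OF u v this] lvs show ?thesis by blast
  qed
  have check: "\<forall>w\<in>set vs. w \<in> U \<and> rank_one w" if good: "?good vs" for vs
  proof
    fix w assume "w \<in> set vs"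
    then obtain k where k: "k < r" "w = vs ! k" using good by (auto simp: in_set_conv_nth)
    obtain \<pi> \<gamma> where \<pi>: "\<pi> permutes {..<r}" "\<forall>l<r. \<gamma> l \<noteq> 0 \<and> vs ! l = (\<lambda>x. \<gamma> l * v (\<pi> l) x)"
      using good by blast
    have w: "w = (\<lambda>x. \<gamma> k * v (\<pi> k) x)" "\<gamma> k \<noteq> 0" using k \<pi> by auto
    have \<pi>k: "\<pi> k < r" using permutes_in_image[OF \<pi>(1), of k] k by simp
    then have "w \<in> U" unfolding w U by (intro fvs.span_scale fvs.span_base) auto
    moreover have "rank_one w"
    proof -
      obtain d b where db: "v (\<pi> k) = tensor d b" "v (\<pi> k) \<noteq> 0"
        using ro[OF \<pi>k] unfolding rank_one_def by blast
      have "w = tensor (\<lambda>i. \<gamma> k * d i) b" unfolding w db by (auto simp: tensor_def)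
      moreover have "w \<noteq> 0" using db(2) w by (auto simp: fun_eq_iff)
      ultimately show ?thesis unfolding rank_one_def by blast
    qed
    ultimately show "w \<in> U \<and> rank_one w" by blast
  qed
  show ?thesis
    unfolding rank_one_elements_def ann
  proof (rule succeeds_with_and_then)
    show "succeeds_with (find_any ?basis) ?basis"
      using sq set_sq by (intro succeeds_with_find_any exI[of _ "map ?sq [0..<r]"]) auto
    fix Ps assume Ps: "?basis Ps"
    show "succeeds_with (simultaneous_diagonalization Ps \<rhd> (\<lambda>vs.
     fail_unless (\<forall>v\<in>set vs. v \<in> U \<and> rank_one v) \<rhd> (\<lambda>_. return vs))) ?good"
    proof (rule succeeds_with_and_then)
      show "succeeds_with (simultaneous_diagonalization Ps) ?good"
        unfolding simultaneous_diagonalization_def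
        by (rule succeeds_with_find_any[OF ex_diag[OF Ps]]) (use diag[OF Ps] in blast)
      fix vs assume vs: "?good vs"
      show "succeeds_with (fail_unless (\<forall>v\<in>set vs. v \<in> U \<and> rank_one v) \<rhd> (\<lambda>_. return vs)) ?good"
      proof (rule succeeds_with_and_then)
        show "succeeds_with (fail_unless (\<forall>v\<in>set vs. v \<in> U \<and> rank_one v)) (\<lambda>_. True)"
          by (rule succeeds_with_fail_unless[OF check[OF vs]]) simp
        show "succeeds_with (return vs) ?good" by (intro succeeds_with_return vs)
      qed
    qed
  qed
qed

subsection \<open>Rank-one elements of a generic span of rank-one matrices\<close>

definition strict_pairs :: "nat \<Rightarrow> (nat \<times> nat) set" where
  "strict_pairs r = (SIGMA l:{..<r}. {..<l})"

lemma strict_pairs_iff [simp]: "(l, l') \<in> strict_pairs r \<longleftrightarrow> l < r \<and> l' < l"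
  by (auto simp: strict_pairs_def)

lemma finite_strict_pairs [simp]: "finite (strict_pairs r)"
  by (simp add: strict_pairs_def)

lemma sum_symmetric:
  fixes h :: "nat \<Rightarrow> nat \<Rightarrow> real"
  assumes "\<And>l l'. h l l' = h l' l" and "\<And>l. h l l = 0"
  shows "(\<Sum>l<r. \<Sum>l'<r. h l l') = 2 * (\<Sum>(l, l')\<in>strict_pairs r. h l l')"
proof -
  have "(\<Sum>l<r. \<Sum>l'<r. h l l') = 2 * (\<Sum>l<r. \<Sum>l'<l. h l l')"
  proof (induction r)
    case (Suc r)
    have "(\<Sum>l<r. h l r) = (\<Sum>l<r. h r l)" using assms(1) by simp
    then show ?case using Suc assms(2) by (simp add: sum.distrib algebra_simps)
  qed simp
  then show ?thesis by (simp add: strict_pairs_def sum.Sigma)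
qed

text \<open>The coordinates of \<open>(d l \<and> d l') \<otimes> (b l \<and> b l')\<close>. They
  are the polarized 2 by 2 minors evaluated at the pair \<open>tensor (d l) (b l)\<close>,
  \<open>tensor (d l') (b l')\<close>.\<close>

definition wedge_product ::
  "(nat \<Rightarrow> nat \<Rightarrow> real) \<Rightarrow> (nat \<Rightarrow> nat \<Rightarrow> real) \<Rightarrow> nat \<times> nat \<Rightarrow> (nat \<times> nat) \<times> nat \<times> nat \<Rightarrow> real"
where
  "wedge_product d b = (\<lambda>(l, l') ((i, i'), (j, j')).
     (d l i * d l' i' - d l' i * d l i') * (b l j * b l' j' - b l' j * b l j'))"

text \<open>The wedge terms are symmetric in the pair and vanish on the diagonal, so a symmetric
  double sum is twice the sum over strict pairs. The diagonal of \<open>\<alpha>\<close> stays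
  unconstrained.\<close>

lemma wedge_product_zeroD:
  assumes "indep_family (strict_pairs r) UNIV (wedge_product d b)"
    and "\<And>l l'. \<alpha> l l' = \<alpha> l' l"
    and "\<And>i i' j j'. (\<Sum>l<r. \<Sum>l'<r. \<alpha> l l' * wedge_product d b (l, l') ((i, i'), (j, j'))) = 0"
    and "l < r" "l' < r" "l \<noteq> l'"
  shows "\<alpha> l l' = 0"
proof -
  have "(\<Sum>p\<in>strict_pairs r. \<alpha> (fst p) (snd p) * wedge_product d b p z) = 0" for z
  proof -
    obtain i i' j j' where z: "z = ((i, i'), (j, j'))" by (metis surj_pair)
    have "(\<Sum>l<r. \<Sum>l'<r. \<alpha> l l' * wedge_product d b (l, l') z) =
        2 * (\<Sum>(l, l')\<in>strict_pairs r. \<alpha> l l' * wedge_product d b (l, l') z)"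
      by (rule sum_symmetric) (auto simp: z wedge_product_def assms(2) algebra_simps)
    then show ?thesis using assms(3) by (simp add: z case_prod_beta)
  qed
  then have "\<alpha> (fst p) (snd p) = 0" if "p \<in> strict_pairs r" for p
    using indep_familyD[OF assms(1), of "\<lambda>p. \<alpha> (fst p) (snd p)" p] that by blast
  from this[of "(l, l')"] this[of "(l', l)"] show ?thesis
    using assms(2)[of l l'] assms(4-6) by (cases "l < l'") auto
qed

text \<open>Multiplying a relation symmetrically by one further tensor, with index
  \<open>l1 \<noteq> l0\<close>, gives a relation among wedge products whose coefficient at
  \<open>l1\<close>, \<open>l0\<close> is \<open>x l0\<close>. The bound \<open>2 \<le> r\<close>
  provides \<open>l1\<close>.\<close>

lemma indep_family_tensor:
  assumes wedge: "indep_family (strict_pairs r) UNIV (wedge_product d b)" and r: "2 \<le> r"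
  shows "indep_family {..<r} UNIV (\<lambda>l. tensor (d l) (b l))"
proof (rule indep_familyI)
  fix x l0
  assume x: "\<And>z. z \<in> UNIV \<Longrightarrow> (\<Sum>l<r. x l * tensor (d l) (b l) z) = 0" and l0: "l0 \<in> {..<r}"
  have x': "(\<Sum>l<r. x l * (d l i * b l j)) = 0" for i j
    using x[of "(i, j)"] by (simp add: tensor_def)
  define l1 where "l1 = (if l0 = 0 then 1 else (0 :: nat))"
  have l1: "l1 < r" "l1 \<noteq> l0" using r by (auto simp: l1_def)
  define \<alpha> where "\<alpha> l l' = (if l = l1 then x l' else 0) + (if l' = l1 then x l else 0)" for l l'
  have "\<alpha> l1 l0 = 0"
  proof (rule wedge_product_zeroD[OF wedge])
    fix i i' j j'
    let ?w = "\<lambda>l l'. wedge_product d b (l, l') ((i, i'), (j, j'))"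
    have "(\<Sum>l<r. \<Sum>l'<r. \<alpha> l l' * ?w l l') =
        (\<Sum>l<r. \<Sum>l'<r. if l = l1 then x l' * ?w l l' else 0) +
        (\<Sum>l<r. \<Sum>l'<r. if l' = l1 then x l * ?w l l' else 0)"
      unfolding sum.distrib[symmetric] by (intro sum.cong refl) (auto simp: \<alpha>_def algebra_simps)
    also have "(\<Sum>l<r. \<Sum>l'<r. if l = l1 then x l' * ?w l l' else 0) = (\<Sum>l'<r. x l' * ?w l1 l')"
      using l1(1) by (subst sum.swap) simp
    also have "(\<Sum>l<r. \<Sum>l'<r. if l' = l1 then x l * ?w l l' else 0) = (\<Sum>l<r. x l * ?w l l1)"
      using l1(1) by simp
    also have "(\<Sum>l<r. x l * ?w l l1) = (\<Sum>l<r. x l * ?w l1 l)"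
      by (intro sum.cong) (auto simp: wedge_product_def algebra_simps)
    also have "(\<Sum>l<r. x l * ?w l1 l) =
        d l1 i * b l1 j * (\<Sum>l<r. x l * (d l i' * b l j')) -
        d l1 i * b l1 j' * (\<Sum>l<r. x l * (d l i' * b l j)) -
        d l1 i' * b l1 j * (\<Sum>l<r. x l * (d l i * b l j')) +
        d l1 i' * b l1 j' * (\<Sum>l<r. x l * (d l i * b l j))"
      unfolding sum_distrib_left sum.distrib[symmetric] sum_subtractf[symmetric]
      by (intro sum.cong) (auto simp: wedge_product_def algebra_simps)
    finally show "(\<Sum>l<r. \<Sum>l'<r. \<alpha> l l' * ?w l l') = 0" by (simp add: x')
  qed (use l0 l1 in \<open>auto simp: \<alpha>_def\<close>)
  then show "x l0 = 0" using l1 by (simp add: \<alpha>_def)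
qed

text \<open>This makes the matching of the two lists of rank-one factors unambiguous.\<close>

lemma wedge_product_not_proportional:
  assumes wedge: "indep_family (strict_pairs r) UNIV (wedge_product d b)"
    and l: "l < r" "l' < r" "l \<noteq> l'"
  shows "\<exists>i. d l i \<noteq> s * d l' i"
proof (rule ccontr)
  assume "\<not> ?thesis"
  then have eq: "d l i = s * d l' i" for i by blast
  have zero: "wedge_product d b (l, l') z = 0" "wedge_product d b (l', l) z = 0" for z
    by (auto simp: wedge_product_def eq case_prod_beta)
  consider "(l, l') \<in> strict_pairs r" | "(l', l) \<in> strict_pairs r"
    using l by (cases "l < l'") auto
  then show False
  proof cases
    case 1
    show ?thesis
      using indep_family_nonzero[OF wedge finite_strict_pairs 1] unfolding zero(1) by blast
  next
    case 2
    show ?thesis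
      using indep_family_nonzero[OF wedge finite_strict_pairs 2] unfolding zero(2) by blast
  qed
qed

text \<open>An element of the symmetric square is a symmetric combination of the products of
  \<open>v l\<close> and \<open>v l'\<close>. The minors kill the diagonal terms, and on the others
  they act through the independent wedge products, so all off-diagonal coefficients vanish.\<close>

lemma rank_one_annihilator_span:
  fixes r :: nat
  assumes wedge: "indep_family (strict_pairs r) UNIV (wedge_product d b)"
    and v_def: "v = (\<lambda>l. tensor (d l) (b l))"
  shows "rank_one_annihilator (fvs.span (v ` {..<r})) =
    fvs.span ((\<lambda>l. tensor (v l) (v l)) ` {..<r})"
proof
  let ?U = "fvs.span (v ` {..<r})"
  let ?minors = "\<lambda>P :: (nat \<times> nat) \<times> (nat \<times> nat) \<Rightarrow> real. \<forall>i i' j j'. P ((i, j), (i', j')) - P ((i, j'), (i', j)) = (0 :: real)"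
  show "fvs.span ((\<lambda>l. tensor (v l) (v l)) ` {..<r}) \<subseteq> rank_one_annihilator ?U"
  proof (rule fvs.span_minimal)
    show "(\<lambda>l. tensor (v l) (v l)) ` {..<r} \<subseteq> rank_one_annihilator ?U"
      by (auto simp: rank_one_annihilator_def v_def tensor_def intro!: fvs.span_base)
    have "rank_one_annihilator ?U =
        fvs.span ((\<lambda>u. tensor u u) ` ?U) \<inter> {P. ?minors P}"
      by (auto simp: rank_one_annihilator_def)
    moreover have "fvs.subspace {P. ?minors P}"
      by (rule fvs.subspaceI) (auto simp: algebra_simps)
    ultimately show "fvs.subspace (rank_one_annihilator ?U)"
      by (simp only: fvs.subspace_inter[OF fvs.subspace_span])
  qed
  \<comment> \<open>The symmetric square of the span, written with symmetric coefficient
    matrices.\<close>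
  let ?Q = "{P. \<exists>\<alpha>. (\<forall>l l'. \<alpha> l l' = \<alpha> l' l) \<and>
    (\<forall>x y. P (x, y) = (\<Sum>l<r. \<Sum>l'<r. \<alpha> l l' * v l x * v l' y))}"
  have "fvs.subspace ?Q"
  proof (rule fvs.subspaceI)
    show "0 \<in> ?Q" by (auto intro!: exI[of _ "\<lambda>_ _. 0"])
  next
    fix P P' assume "P \<in> ?Q" "P' \<in> ?Q"
    then obtain \<alpha> \<beta> where "\<forall>l l'. \<alpha> l l' = \<alpha> l' l" "\<forall>l l'. \<beta> l l' = \<beta> l' l"
      "\<forall>x y. P (x, y) = (\<Sum>l<r. \<Sum>l'<r. \<alpha> l l' * v l x * v l' y)"
      "\<forall>x y. P' (x, y) = (\<Sum>l<r. \<Sum>l'<r. \<beta> l l' * v l x * v l' y)" by blast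
    then show "P + P' \<in> ?Q"
      by (auto intro!: exI[of _ "\<lambda>l l'. \<alpha> l l' + \<beta> l l'"] simp: sum.distrib algebra_simps)
  next
    fix s P assume "P \<in> ?Q"
    then obtain \<alpha> where "\<forall>l l'. \<alpha> l l' = \<alpha> l' l"
      "\<forall>x y. P (x, y) = (\<Sum>l<r. \<Sum>l'<r. \<alpha> l l' * v l x * v l' y)" by blast
    then show "(\<lambda>x. s * P x) \<in> ?Q"
      by (auto intro!: exI[of _ "\<lambda>l l'. s * \<alpha> l l'"] simp: sum_distrib_left algebra_simps)
  qed
  moreover have "(\<lambda>u. tensor u u) ` ?U \<subseteq> ?Q"
  proof
    fix P assume "P \<in> (\<lambda>u. tensor u u) ` ?U"
    then obtain c where "P = tensor (\<lambda>x. \<Sum>l<r. c l * v l x) (\<lambda>x. \<Sum>l<r. c l * v l x)"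
      by (auto simp: span_family)
    then have "P (x, y) = (\<Sum>l<r. \<Sum>l'<r. (c l * c l') * v l x * v l' y)" for x y
      by (simp add: tensor_def sum_product algebra_simps)
    then show "P \<in> ?Q"
      by (intro CollectI exI[of _ "\<lambda>l l'. c l * c l'"]) (simp add: mult.commute)
  qed
  ultimately have span_Q: "fvs.span ((\<lambda>u. tensor u u) ` ?U) \<subseteq> ?Q" by (intro fvs.span_minimal)
  show "rank_one_annihilator ?U \<subseteq> fvs.span ((\<lambda>l. tensor (v l) (v l)) ` {..<r})"
  proof
    fix P assume P: "P \<in> rank_one_annihilator ?U"
    then have minors: "P ((i, j), (i', j')) - P ((i, j'), (i', j)) = 0" for i i' j j'
      by (simp add: rank_one_annihilator_def)
    have "P \<in> ?Q" using P span_Q by (auto simp: rank_one_annihilator_def)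
    then obtain \<alpha> where sym: "\<And>l l'. \<alpha> l l' = \<alpha> l' l"
      and P_eq: "\<And>x y. P (x, y) = (\<Sum>l<r. \<Sum>l'<r. \<alpha> l l' * v l x * v l' y)" by blast
    have off: "\<alpha> l l' = 0" if "l < r" "l' < r" "l \<noteq> l'" for l l'
    proof (rule wedge_product_zeroD[OF wedge sym _ that])
      fix i i' j j'
      \<comment> \<open>A minor antisymmetrizes only the \<open>b\<close> part; adding the term with
        \<open>l\<close> and \<open>l'\<close> exchanged antisymmetrizes the \<open>d\<close> part
        as well and yields \<open>wedge_product\<close>.\<close>
      define g where "g l l' = \<alpha> l l' * (d l i * d l' i' * (b l j * b l' j' - b l j' * b l' j))" for l l'
      have "(\<Sum>l<r. \<Sum>l'<r. g l l') = P ((i, j), (i', j')) - P ((i, j'), (i', j))"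
        unfolding P_eq sum_subtractf[symmetric] g_def v_def
        by (intro sum.cong) (auto simp: tensor_def algebra_simps)
      then have "(\<Sum>l<r. \<Sum>l'<r. g l l') = 0" using minors by simp
      moreover have "(\<Sum>l<r. \<Sum>l'<r. g l' l) = (\<Sum>l<r. \<Sum>l'<r. g l l')" by (rule sum.swap)
      ultimately have "(\<Sum>l<r. \<Sum>l'<r. g l l' + g l' l) = 0" by (simp add: sum.distrib)
      moreover have "g l l' + g l' l = \<alpha> l l' * wedge_product d b (l, l') ((i, i'), (j, j'))" for l l'
        using sym[of l l'] by (simp add: g_def wedge_product_def algebra_simps)
      ultimately show "(\<Sum>l<r. \<Sum>l'<r. \<alpha> l l' * wedge_product d b (l, l') ((i, i'), (j, j'))) = 0"
        by simp
    qed
    have "P z = (\<Sum>l<r. \<alpha> l l * tensor (v l) (v l) z)" for z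
    proof -
      obtain x y where z: "z = (x, y)" by (cases z)
      have "(\<Sum>l'<r. \<alpha> l l' * v l x * v l' y) = \<alpha> l l * tensor (v l) (v l) z" if "l < r" for l
        using that off by (subst sum.remove[of _ l]) (auto simp: z tensor_def intro!: sum.neutral)
      then show ?thesis by (simp add: z P_eq)
    qed
    then have "P = (\<lambda>z. \<Sum>l<r. \<alpha> l l * tensor (v l) (v l) z)" by (rule ext)
    then show "P \<in> fvs.span ((\<lambda>l. tensor (v l) (v l)) ` {..<r})"
      by (simp add: span_family)
  qed
qed

lemma tensor_proportional:
  assumes "tensor d' b' = (\<lambda>z. \<gamma> * tensor d b z)" and "\<gamma> \<noteq> 0" and "tensor d b \<noteq> 0"
  shows "\<exists>\<mu> \<nu>. \<mu> \<noteq> 0 \<and> \<nu> \<noteq> 0 \<and> d' = (\<lambda>i. \<mu> * d i) \<and> b' = (\<lambda>j. \<nu> * b j)"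
proof -
  have eq: "d' i * b' j = \<gamma> * (d i * b j)" for i j
    using fun_cong[OF assms(1), of "(i, j)"] by (simp add: tensor_def)
  obtain i0 j0 where nz: "d i0 * b j0 \<noteq> 0"
    using assms(3) by (auto simp: tensor_def fun_eq_iff)
  then have nz': "d' i0 * b' j0 \<noteq> 0" using eq assms(2) by simp
  have "d' i = (\<gamma> * b j0 / b' j0) * d i" for i using eq[of i j0] nz' by (simp add: field_simps)
  moreover have "b' j = (\<gamma> * d i0 / d' i0) * b j" for j using eq[of i0 j] nz' by (simp add: field_simps)
  moreover have "\<gamma> * b j0 / b' j0 \<noteq> 0" "\<gamma> * d i0 / d' i0 \<noteq> 0" using nz nz' assms(2) by auto
  ultimately show ?thesis by blast
qed

text \<open>The permutation is a parameter and not quantified here, because one reordering has to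
  serve several factors at once.\<close>

definition rescaled ::
  "nat \<Rightarrow> (nat \<Rightarrow> nat) \<Rightarrow> (nat \<Rightarrow> 'i \<Rightarrow> real) \<Rightarrow> (nat \<Rightarrow> 'i \<Rightarrow> real) \<Rightarrow> bool" where
  "rescaled r \<pi> u v \<longleftrightarrow> (\<exists>s. \<forall>l<r. s l \<noteq> 0 \<and> u l = (\<lambda>i. s l * v (\<pi> l) i))"

lemma succeeds_with_rank_one_factors:
  assumes wedge: "indep_family (strict_pairs r) UNIV (wedge_product d b)" and r: "2 \<le> r"
    and U: "U = fvs.span ((\<lambda>l. tensor (d l) (b l)) ` {..<r})"
  shows "succeeds_with (rank_one_factors U r) (\<lambda>(d', b').
    \<exists>\<pi>. \<pi> permutes {..<r} \<and> rescaled r \<pi> d' d \<and> rescaled r \<pi> b' b)"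
proof -
  let ?v = "\<lambda>l. tensor (d l) (b l)"
  let ?good = "\<lambda>vs. length vs = r \<and>
    (\<exists>\<pi> \<gamma>. \<pi> permutes {..<r} \<and> (\<forall>l<r. \<gamma> l \<noteq> 0 \<and> vs ! l = (\<lambda>x. \<gamma> l * ?v (\<pi> l) x)))"
  have ind: "indep_family {..<r} UNIV ?v" by (rule indep_family_tensor[OF wedge r])
  have nz: "?v l \<noteq> 0" if "l < r" for l
    using indep_family_nonzero[OF ind finite_lessThan, of l] that by (auto simp: fun_eq_iff)
  have elems: "succeeds_with (rank_one_elements U) ?good"
  proof (rule succeeds_with_rank_one_elements[OF ind _ U])
    show "rank_one (?v l)" if "l < r" for l using nz[OF that] by (auto simp: rank_one_def)
    show "rank_one_annihilator U = fvs.span ((\<lambda>l. tensor (?v l) (?v l)) ` {..<r})"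
      unfolding U by (rule rank_one_annihilator_span[OF wedge]) (rule refl)
  qed
  show ?thesis
    unfolding rank_one_factors_def
  proof (rule succeeds_with_and_then[OF elems])
    fix vs assume vs: "?good vs"
    then obtain \<pi> \<gamma> where len: "length vs = r" and \<pi>: "\<pi> permutes {..<r}"
      and \<gamma>: "\<And>l. l < r \<Longrightarrow> \<gamma> l \<noteq> 0 \<and> vs ! l = (\<lambda>x. \<gamma> l * ?v (\<pi> l) x)" by blast
    show "succeeds_with (fail_unless (length vs = r) \<rhd> (\<lambda>_.
        find_any (\<lambda>(d, b). \<forall>l<r. vs ! l = tensor (d l) (b l)))) (\<lambda>(d', b').
        \<exists>\<pi>. \<pi> permutes {..<r} \<and> rescaled r \<pi> d' d \<and> rescaled r \<pi> b' b)"
    proof (rule succeeds_with_and_then[of _ "\<lambda>_. True"])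
      show "succeeds_with (fail_unless (length vs = r)) (\<lambda>_. True)"
        using len by (intro succeeds_with_fail_unless) auto
      show "succeeds_with (find_any (\<lambda>(d, b). \<forall>l<r. vs ! l = tensor (d l) (b l))) (\<lambda>(d', b').
        \<exists>\<pi>. \<pi> permutes {..<r} \<and> rescaled r \<pi> d' d \<and> rescaled r \<pi> b' b)"
      proof (rule succeeds_with_find_any)
        have "vs ! l = tensor (\<lambda>i. \<gamma> l * d (\<pi> l) i) (b (\<pi> l))" if "l < r" for l
          using \<gamma>[OF that] by (auto simp: tensor_def)
        then show "\<exists>a. case a of (d, b) \<Rightarrow> \<forall>l<r. vs ! l = tensor (d l) (b l)"
          by (intro exI[of _ "(\<lambda>l i. \<gamma> l * d (\<pi> l) i, \<lambda>l. b (\<pi> l))"]) simp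
        fix a assume "case a of (d, b) \<Rightarrow> \<forall>l<r. vs ! l = tensor (d l) (b l)"
        then obtain d' b' where a: "a = (d', b')" "\<And>l. l < r \<Longrightarrow> vs ! l = tensor (d' l) (b' l)"
          by (cases a) auto
        have "\<exists>\<mu> \<nu>. \<mu> \<noteq> 0 \<and> \<nu> \<noteq> 0 \<and> d' l = (\<lambda>i. \<mu> * d (\<pi> l) i) \<and> b' l = (\<lambda>j. \<nu> * b (\<pi> l) j)"
          if l: "l < r" for l
        proof (rule tensor_proportional)
          show "tensor (d' l) (b' l) = (\<lambda>z. \<gamma> l * tensor (d (\<pi> l)) (b (\<pi> l)) z)"
            using \<gamma>[OF l] a(2)[OF l] by simp
          show "\<gamma> l \<noteq> 0" using \<gamma>[OF l] by simp
          show "tensor (d (\<pi> l)) (b (\<pi> l)) \<noteq> 0"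
            using nz permutes_in_image[OF \<pi>, of l] l by simp
        qed
        then have "\<exists>\<mu> \<nu>. \<forall>l<r. \<mu> l \<noteq> 0 \<and> \<nu> l \<noteq> 0 \<and>
            d' l = (\<lambda>i. \<mu> l * d (\<pi> l) i) \<and> b' l = (\<lambda>j. \<nu> l * b (\<pi> l) j)" by metis
        then have "rescaled r \<pi> d' d" "rescaled r \<pi> b' b"
          unfolding rescaled_def by blast+
        with \<pi> show "case a of (d', b') \<Rightarrow>
            \<exists>\<pi>. \<pi> permutes {..<r} \<and> rescaled r \<pi> d' d \<and> rescaled r \<pi> b' b"
          unfolding a(1) by auto
      qed
    qed
  qed
qed

subsection \<open>Finite-dimensional duality\<close>

lemma eq_sum_basis_vec:
  assumes "finite I" and "\<And>x. x \<notin> I \<Longrightarrow> f x = 0"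
  shows "f = (\<Sum>x\<in>I. (\<lambda>t. f x * basis_vec x t))"
proof (rule ext)
  fix t
  have "(\<Sum>x\<in>I. f x * basis_vec x t) = (\<Sum>x\<in>I. if x = t then f x else 0)"
    by (rule sum.cong) (auto simp: basis_vec_def)
  also have "\<dots> = f t" using assms by (simp add: sum.delta)
  finally show "f t = (\<Sum>x\<in>I. (\<lambda>t. f x * basis_vec x t)) t" by (simp add: sum_fun_eq)
qed

lemma span_basis_vec:
  assumes "finite I"
  shows "fvs.span (basis_vec ` I) = {f. \<forall>x. x \<notin> I \<longrightarrow> f x = 0}"
proof
  show "fvs.span (basis_vec ` I) \<subseteq> {f. \<forall>x. x \<notin> I \<longrightarrow> f x = 0}"
  proof (rule fvs.span_minimal)
    show "fvs.subspace {f. \<forall>x. x \<notin> I \<longrightarrow> f x = 0}" by (rule fvs.subspaceI) auto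
  qed (auto simp: basis_vec_def)
  show "{f. \<forall>x. x \<notin> I \<longrightarrow> f x = 0} \<subseteq> fvs.span (basis_vec ` I)"
  proof
    fix f :: "'a \<Rightarrow> real" assume "f \<in> {f. \<forall>x. x \<notin> I \<longrightarrow> f x = 0}"
    then have "f = (\<Sum>x\<in>I. (\<lambda>t. f x * basis_vec x t))"
      by (intro eq_sum_basis_vec[OF assms]) auto
    moreover have "(\<Sum>x\<in>I. (\<lambda>t. f x * basis_vec x t)) \<in> fvs.span (basis_vec ` I)"
      by (intro fvs.span_sum fvs.span_scale fvs.span_base) auto
    ultimately show "f \<in> fvs.span (basis_vec ` I)" by simp
  qed
qed

interpretation fvs_functional:
  vector_space_pair "\<lambda>(c::real) (f::'i \<Rightarrow> real) x. c * f x" "(*) :: real \<Rightarrow> real \<Rightarrow> real"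
  by unfold_locales (auto simp: algebra_simps)

text \<open>The double annihilator theorem. If \<open>y\<close> were outside the span, some
  functional would be \<open>1\<close> at \<open>y\<close> and \<open>0\<close> on \<open>A\<close>;
  its values on the basis vectors form an annihilating \<open>z\<close> that does not kill
  \<open>y\<close>.\<close>

lemma in_span_if_annihilated:
  assumes fin: "finite I" and A: "\<And>f x. f \<in> A \<Longrightarrow> x \<notin> I \<Longrightarrow> f x = 0"
    and y: "\<And>x. x \<notin> I \<Longrightarrow> y x = 0"
    and ann: "\<And>z. (\<And>f. f \<in> A \<Longrightarrow> (\<Sum>x\<in>I. z x * f x) = 0) \<Longrightarrow> (\<Sum>x\<in>I. z x * y x) = 0"
  shows "y \<in> fvs.span A"
proof (rule ccontr)
  assume notin: "y \<notin> fvs.span A"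
  obtain B where B: "B \<subseteq> A" "fvs.independent B" "A \<subseteq> fvs.span B"
    by (rule fvs.maximal_independent_subset)
  have yB: "y \<notin> fvs.span B" using notin fvs.span_mono[OF B(1)] by blast
  then have "fvs.independent (insert y B)" using B(2) by (simp add: fvs.independent_insert)
  then obtain g where g: "Vector_Spaces.linear (\<lambda>c f x. c * f x) (*) g"
      "\<forall>f\<in>insert y B. g f = (if f = y then 1 else 0)"
    using fvs_functional.linear_independent_extend[of "insert y B" "\<lambda>f. if f = y then 1 else 0"]
    by blast
  have gsum: "(\<Sum>x\<in>I. g (basis_vec x) * f x) = g f" if "\<And>x. x \<notin> I \<Longrightarrow> f x = 0" for f
  proof -
    have "g f = g (\<Sum>x\<in>I. (\<lambda>t. f x * basis_vec x t))"
      by (rule arg_cong[OF eq_sum_basis_vec[OF fin that]])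
    also have "\<dots> = (\<Sum>x\<in>I. g (\<lambda>t. f x * basis_vec x t))"
      by (rule fvs_functional.linear_sum[OF g(1)])
    also have "\<dots> = (\<Sum>x\<in>I. f x * g (basis_vec x))"
      by (intro sum.cong refl fvs_functional.linear_scale[OF g(1)])
    finally show ?thesis by (simp add: mult.commute)
  qed
  have "g f = 0" if "f \<in> A" for f
  proof (rule fvs_functional.linear_eq_0_on_span[OF g(1)])
    show "f \<in> fvs.span B" using that B(3) by blast
    show "g h = 0" if "h \<in> B" for h using g(2) yB fvs.span_base that by fastforce
  qed
  then have "(\<Sum>x\<in>I. g (basis_vec x) * y x) = 0" by (intro ann) (simp add: gsum A)
  then show False using gsum[of y] y g(2) by simp
qed

subsection \<open>Interior and exterior products\<close>

text \<open>The matrix of exterior multiplication by \<open>a\<close>, with row \<open>U\<close> and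
  column \<open>S\<close>. Its transpose is contraction by \<open>a\<close>; this adjointness
  carries the duality argument for the column space.\<close>

definition koszul_coeff :: "nat \<Rightarrow> (nat \<Rightarrow> real) \<Rightarrow> nat set \<Rightarrow> nat set \<Rightarrow> real" where
  "koszul_coeff q a U S =
     (\<Sum>i<q. if i \<notin> S \<and> U = insert i S then koszul_sign U i * a i else 0)"

definition interior_product :: "nat \<Rightarrow> (nat \<Rightarrow> real) \<Rightarrow> (nat set \<Rightarrow> real) \<Rightarrow> nat set \<Rightarrow> real" where
  "interior_product q a y S =
     (\<Sum>i\<in>{..<q} - S. koszul_sign (insert i S) i * a i * y (insert i S))"

definition exterior_product :: "(nat \<Rightarrow> real) \<Rightarrow> (nat set \<Rightarrow> real) \<Rightarrow> nat set \<Rightarrow> real" where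
  "exterior_product a z U = (\<Sum>i\<in>U. koszul_sign U i * a i * z (U - {i}))"

lemma finite_subsets_of_size [simp]: "finite (subsets_of_size q p)"
  by (rule finite_subset[of _ "Pow {..<q}"]) (auto simp: subsets_of_size_def)

lemma subsets_of_sizeD:
  assumes "S \<in> subsets_of_size q p"
  shows "finite S \<and> S \<subseteq> {..<q} \<and> card S = p"
  using assms finite_subset[of S "{..<q}"] by (simp add: subsets_of_size_def)

lemma insert_in_subsets_of_size:
  assumes "S \<in> subsets_of_size q p" and "i < q" and "i \<notin> S"
  shows "insert i S \<in> subsets_of_size q (p + 1)"
  using subsets_of_sizeD[OF assms(1)] assms(2,3) by (simp add: subsets_of_size_def)

lemma remove_in_subsets_of_size:
  assumes "U \<in> subsets_of_size q (p + 1)" and "i \<in> U"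
  shows "U - {i} \<in> subsets_of_size q p"
proof -
  have "U - {i} \<subseteq> {..<q}" "card (U - {i}) = p"
    using subsets_of_sizeD[OF assms(1)] assms(2) by (blast, simp)
  then show ?thesis by (simp add: subsets_of_size_def)
qed

lemma sum_koszul_coeff_interior:
  assumes S: "S \<in> subsets_of_size q p"
  shows "(\<Sum>U\<in>subsets_of_size q (p + 1). y U * koszul_coeff q a U S) = interior_product q a y S"
proof -
  have "(\<Sum>U\<in>subsets_of_size q (p + 1). y U * koszul_coeff q a U S) =
      (\<Sum>i<q. \<Sum>U\<in>subsets_of_size q (p + 1).
        if U = insert i S then (if i \<notin> S then koszul_sign U i * a i * y U else 0) else 0)"
    unfolding koszul_coeff_def sum_distrib_left
    by (subst sum.swap, intro sum.cong refl) auto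
  also have "\<dots> = (\<Sum>i<q. if i \<notin> S then koszul_sign (insert i S) i * a i * y (insert i S) else 0)"
    using insert_in_subsets_of_size[OF S] by (intro sum.cong refl) (auto simp: sum.delta)
  also have "\<dots> = interior_product q a y S"
    unfolding interior_product_def by (rule sum.mono_neutral_cong_right) auto
  finally show ?thesis .
qed

lemma sum_koszul_coeff_exterior:
  assumes U: "U \<in> subsets_of_size q (p + 1)"
  shows "(\<Sum>S\<in>subsets_of_size q p. z S * koszul_coeff q a U S) = exterior_product a z U"
proof -
  have "(\<Sum>S\<in>subsets_of_size q p. z S * koszul_coeff q a U S) =
      (\<Sum>i<q. \<Sum>S\<in>subsets_of_size q p.
        if S = U - {i} then (if i \<in> U then koszul_sign U i * a i * z S else 0) else 0)"
    unfolding koszul_coeff_def sum_distrib_left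
    by (subst sum.swap, intro sum.cong refl) auto
  also have "\<dots> = (\<Sum>i<q. if i \<in> U then koszul_sign U i * a i * z (U - {i}) else 0)"
    using remove_in_subsets_of_size[OF U] by (intro sum.cong refl) (auto simp: sum.delta)
  also have "\<dots> = exterior_product a z U"
    unfolding exterior_product_def using subsets_of_sizeD[OF U]
    by (intro sum.mono_neutral_cong_right) auto
  finally show ?thesis .
qed

lemma koszul_sign_insert:
  assumes "finite U" and "k \<notin> U"
  shows "koszul_sign (insert k U) i = (if k < i then - koszul_sign U i else koszul_sign U i)"
proof -
  have "{j \<in> insert k U. j < i} = (if k < i then insert k {j \<in> U. j < i} else {j \<in> U. j < i})" by auto
  then show ?thesis using assms by (simp add: koszul_sign_def)
qed

lemma koszul_sign_zero [simp]: "koszul_sign U 0 = 1"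
  by (simp add: koszul_sign_def)

lemma sum_antisymmetric:
  fixes h :: "'a \<Rightarrow> 'a \<Rightarrow> real"
  assumes "finite D" and "\<And>i k. i \<in> D \<Longrightarrow> k \<in> D \<Longrightarrow> i \<noteq> k \<Longrightarrow> h i k = - h k i"
  shows "(\<Sum>i\<in>D. \<Sum>k\<in>D - {i}. h i k) = 0"
proof -
  let ?h = "\<lambda>i k. if i = k then 0 else h i k"
  have "(\<Sum>i\<in>D. \<Sum>k\<in>D - {i}. h i k) = (\<Sum>i\<in>D. \<Sum>k\<in>D. ?h i k)"
    by (rule sum.cong[OF refl], rule sum.mono_neutral_cong_left) (use assms(1) in auto)
  moreover have "(\<Sum>i\<in>D. \<Sum>k\<in>D. ?h i k) = (\<Sum>i\<in>D. \<Sum>k\<in>D. - ?h k i)"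
  proof (intro sum.cong refl)
    fix i k assume ik: "i \<in> D" "k \<in> D"
    show "?h i k = - ?h k i" using assms(2)[OF ik] by (cases "i = k") simp_all
  qed
  moreover have "\<dots> = - (\<Sum>i\<in>D. \<Sum>k\<in>D. ?h i k)"
    by (subst sum.swap) (simp add: sum_negf)
  ultimately show ?thesis by linarith
qed

text \<open>Adding \<open>i\<close> and \<open>k\<close> in either order leads to the same set with
  opposite signs, so the terms cancel in pairs.\<close>

lemma interior_product_twice:
  assumes "finite S"
  shows "interior_product q a (interior_product q a y) S = 0"
proof -
  let ?D = "{..<q} - S"
  define h where "h i k = koszul_sign (insert i S) i * a i *
    (koszul_sign (insert k (insert i S)) k * a k * y (insert k (insert i S)))" for i k
  have D: "{..<q} - insert i S = ?D - {i}" for i by auto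
  have "interior_product q a (interior_product q a y) S = (\<Sum>i\<in>?D. \<Sum>k\<in>?D - {i}. h i k)"
    unfolding interior_product_def h_def sum_distrib_left D ..
  also have "\<dots> = 0"
  proof (rule sum_antisymmetric)
    fix i k assume ik: "i \<in> ?D" "k \<in> ?D" "i \<noteq> k"
    have "insert k (insert i S) = insert i (insert k S)" by auto
    then show "h i k = - h k i"
      unfolding h_def using ik assms
      by (cases i k rule: linorder_cases) (simp_all add: koszul_sign_insert)
  qed simp
  finally show ?thesis .
qed

lemma exterior_product_twice:
  assumes "finite U"
  shows "exterior_product a (exterior_product a z) U = 0"
proof -
  define h where "h i k = koszul_sign U i * a i *
    (koszul_sign (U - {i}) k * a k * z (U - {i} - {k}))" for i k
  have "exterior_product a (exterior_product a z) U = (\<Sum>i\<in>U. \<Sum>k\<in>U - {i}. h i k)"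
    unfolding exterior_product_def h_def sum_distrib_left ..
  also have "\<dots> = 0"
  proof (rule sum_antisymmetric[OF assms])
    fix i k assume ik: "i \<in> U" "k \<in> U" "i \<noteq> k"
    have remove: "koszul_sign (U - {i}) j = (if i < j then - koszul_sign U j else koszul_sign U j)"
      if "i \<in> U" for i j
    proof -
      have "insert i (U - {i}) = U" using that by blast
      then show ?thesis using koszul_sign_insert[of "U - {i}" i j] assms by (cases "i < j") simp_all
    qed
    have "U - {i} - {k} = U - {k} - {i}" by auto
    then have "h i k = koszul_sign U i * koszul_sign (U - {i}) k * (a i * a k * z (U - {k} - {i}))"
      by (simp only: h_def mult_ac)
    moreover have "h k i = koszul_sign U k * koszul_sign (U - {k}) i * (a i * a k * z (U - {k} - {i}))"
      by (simp only: h_def mult_ac)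
    ultimately show "h i k = - h k i"
      using ik remove[OF ik(1), of k] remove[OF ik(2), of i]
      by (cases "i < k") auto
  qed
  finally show ?thesis .
qed

text \<open>If \<open>a 0 \<noteq> 0\<close> then every interior product with \<open>a\<close> is the interior product with a form supported
  on the sets containing \<open>0\<close>, because interior multiplication by \<open>a\<close> squares to zero; dually for
  exterior products.\<close>

lemma interior_product_reduce:
  assumes fin: "finite S" and q: "0 < q" and a: "a 0 \<noteq> 0"
    and y': "y' = (\<lambda>U. if 0 \<in> U then interior_product q a y (U - {0}) / a 0 else 0)"
  shows "interior_product q a y' S = interior_product q a y S"
proof (cases "0 \<in> S")
  case False
  \<comment> \<open>Only \<open>i = 0\<close> contributes, because the other sets
    \<open>insert i S\<close> lack \<open>0\<close>.\<close>
  have "interior_product q a y' S =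
      (\<Sum>i\<in>{0}. koszul_sign (insert i S) i * a i * y' (insert i S))"
    unfolding interior_product_def[of q a y' S] using False q
    by (intro sum.mono_neutral_right) (auto simp: y')
  also have "\<dots> = interior_product q a y S" using a False by (simp add: y')
  finally show ?thesis .
next
  case True
  define S' where "S' = S - {0}"
  let ?X = "interior_product q a y"
  have S: "S = insert 0 S'" "0 \<notin> S'" "finite S'" using True fin by (auto simp: S'_def)
  have D: "{..<q} - S' = insert 0 ({..<q} - S)" using S q by auto
  \<comment> \<open>Expanding the vanishing double contraction at \<open>S'\<close> and isolating
    \<open>i = 0\<close> expresses \<open>?X S\<close> by values of \<open>?X\<close> at sets
    without \<open>0\<close>, which are exactly the values recorded in \<open>y'\<close>.\<close>
  have "0 = interior_product q a ?X S'" using interior_product_twice[OF S(3)] by simp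
  also have "\<dots> = a 0 * ?X S + (\<Sum>i\<in>{..<q} - S. koszul_sign (insert i S') i * a i * ?X (insert i S'))"
    unfolding interior_product_def[of q a ?X S'] D using S by (subst sum.insert) auto
  finally have X: "a 0 * ?X S = - (\<Sum>i\<in>{..<q} - S. koszul_sign (insert i S') i * a i * ?X (insert i S'))"
    by simp
  have "a 0 * interior_product q a y' S =
      (\<Sum>i\<in>{..<q} - S. - (koszul_sign (insert i S') i * a i * ?X (insert i S')))"
    unfolding interior_product_def[of q a y' S] sum_distrib_left
  proof (rule sum.cong[OF refl])
    fix i assume i: "i \<in> {..<q} - S"
    have ins: "insert i S = insert 0 (insert i S')" using S by auto
    have "koszul_sign (insert i S) i = - koszul_sign (insert i S') i"
      unfolding ins using i S by (subst koszul_sign_insert) auto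
    moreover have "y' (insert i S) = ?X (insert i S') / a 0"
    proof -
      have "insert i S - {0} = insert i S'" using i S by auto
      then show ?thesis using True by (simp add: y')
    qed
    ultimately show "a 0 * (koszul_sign (insert i S) i * a i * y' (insert i S)) =
        - (koszul_sign (insert i S') i * a i * ?X (insert i S'))" using a by simp
  qed
  also have "\<dots> = a 0 * ?X S" by (simp add: X sum_negf)
  finally show ?thesis using a by simp
qed

lemma exterior_product_reduce:
  assumes fin: "finite U" and a: "a 0 \<noteq> 0"
    and z': "z' = (\<lambda>S. if 0 \<in> S then 0 else exterior_product a z (insert 0 S) / a 0)"
  shows "exterior_product a z' U = exterior_product a z U"
proof (cases "0 \<in> U")
  case True
  have "exterior_product a z' U = (\<Sum>i\<in>{0}. koszul_sign U i * a i * z' (U - {i}))"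
    unfolding exterior_product_def[of a z' U] using True fin
    by (intro sum.mono_neutral_right) (auto simp: z')
  also have "\<dots> = exterior_product a z U" using a True by (simp add: z' insert_absorb)
  finally show ?thesis .
next
  case False
  let ?Y = "exterior_product a z"
  \<comment> \<open>Dually, the expansion at \<open>insert 0 U\<close> expresses \<open>?Y U\<close>
    by values at sets containing \<open>0\<close>.\<close>
  have "0 = exterior_product a ?Y (insert 0 U)"
    using exterior_product_twice[of "insert 0 U"] fin by simp
  also have "\<dots> = a 0 * ?Y U +
      (\<Sum>i\<in>U. koszul_sign (insert 0 U) i * a i * ?Y (insert 0 U - {i}))"
    unfolding exterior_product_def[of a ?Y] using False fin by (subst sum.insert) auto
  finally have Y: "a 0 * ?Y U = - (\<Sum>i\<in>U. koszul_sign (insert 0 U) i * a i * ?Y (insert 0 U - {i}))"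
    by simp
  have "a 0 * exterior_product a z' U =
      (\<Sum>i\<in>U. - (koszul_sign (insert 0 U) i * a i * ?Y (insert 0 U - {i})))"
    unfolding exterior_product_def[of a z'] sum_distrib_left
  proof (rule sum.cong[OF refl])
    fix i assume i: "i \<in> U"
    then have "0 < i" using False by (metis gr0I)
    then have "insert 0 U - {i} = insert 0 (U - {i})" "koszul_sign (insert 0 U) i = - koszul_sign U i"
      using False fin by (auto simp: koszul_sign_insert)
    then show "a 0 * (koszul_sign U i * a i * z' (U - {i})) =
        - (koszul_sign (insert 0 U) i * a i * ?Y (insert 0 U - {i}))"
      using a False by (simp add: z')
  qed
  also have "\<dots> = a 0 * ?Y U" by (simp add: Y sum_negf)
  finally show ?thesis using a by simp
qed

subsection \<open>The Koszul space of a generic tensor\<close>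

text \<open>Sets avoiding \<open>0\<close> index a basis of the multiples of \<open>a l\<close> when
  \<open>a l 0 \<noteq> 0\<close>; all \<open>S\<close> together would bring in the relations from
  \<open>a l \<and> a l = 0\<close>.\<close>

definition exterior_independent ::
  "nat \<Rightarrow> nat \<Rightarrow> nat \<Rightarrow> nat \<Rightarrow> (nat \<Rightarrow> nat \<Rightarrow> real) \<Rightarrow> (nat \<Rightarrow> nat \<Rightarrow> real) \<Rightarrow> bool" where
  "exterior_independent p q n r a c \<longleftrightarrow>
     indep_family ({..<r} \<times> {S \<in> subsets_of_size q p. 0 \<notin> S})
       (subsets_of_size q (p + 1) \<times> {..<n}) (\<lambda>(l, S) (U, k). koszul_coeff q (a l) U S * c l k)"

text \<open>Rows inside \<open>{..<p + 1}\<close> are dropped in order to work modulo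
  \<open>Z_space\<close>. The set \<open>{..<p + 1}\<close> is dropped from the generators because
  its contraction is the vector that is meant to survive.\<close>

definition interior_independent ::
  "nat \<Rightarrow> nat \<Rightarrow> nat \<Rightarrow> nat \<Rightarrow> (nat \<Rightarrow> nat \<Rightarrow> real) \<Rightarrow> (nat \<Rightarrow> nat \<Rightarrow> real) \<Rightarrow> bool" where
  "interior_independent p q n r a b \<longleftrightarrow>
     indep_family ({..<r} \<times> {U \<in> subsets_of_size q (p + 1). 0 \<in> U \<and> U \<noteq> {..<p + 1}})
       ({S \<in> subsets_of_size q p. \<not> S \<subseteq> {..<p + 1}} \<times> {..<n})
       (\<lambda>(l, U) (S, j). koszul_coeff q (a l) U S * b l j)"

text \<open>Only the products \<open>a l \<and> z l\<close> are determined, not the forms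
  \<open>z l\<close>: each form is replaced by a reduced one with the same product, and the reduced
  forms vanish by independence.\<close>

lemma exterior_independentD:
  assumes ind: "exterior_independent p q n r a c" and a: "\<And>l. l < r \<Longrightarrow> a l 0 \<noteq> 0"
    and zero: "\<And>U k. U \<in> subsets_of_size q (p + 1) \<Longrightarrow> k < n \<Longrightarrow>
      (\<Sum>l<r. c l k * exterior_product (a l) (z l) U) = 0"
    and l: "l < r" and U: "U \<in> subsets_of_size q (p + 1)"
  shows "exterior_product (a l) (z l) U = 0"
proof -
  define z' where
    "z' l = (\<lambda>S. if 0 \<in> S then 0 else exterior_product (a l) (z l) (insert 0 S) / a l 0)" for l
  have red: "exterior_product (a l) (z' l) U = exterior_product (a l) (z l) U"
    if "l < r" "U \<in> subsets_of_size q (p + 1)" for l U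
    using subsets_of_sizeD[OF that(2)] a[OF that(1)]
    by (intro exterior_product_reduce) (auto simp: z'_def)
  let ?I = "{..<r} \<times> {S \<in> subsets_of_size q p. 0 \<notin> S}"
  have "(\<lambda>(l, S). z' l S) (l, S) = 0" if "(l, S) \<in> ?I" for l S
  proof (rule indep_familyD[OF ind[unfolded exterior_independent_def] _ that])
    fix y assume "y \<in> subsets_of_size q (p + 1) \<times> {..<n}"
    then obtain U k where y: "y = (U, k)" "U \<in> subsets_of_size q (p + 1)" "k < n" by blast
    have "(\<Sum>x\<in>?I. (\<lambda>(l, S). z' l S) x *
          (\<lambda>(l, S) (U, k). koszul_coeff q (a l) U S * c l k) x y) =
        (\<Sum>l<r. \<Sum>S\<in>{S \<in> subsets_of_size q p. 0 \<notin> S}. c l k * (z' l S * koszul_coeff q (a l) U S))"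
      unfolding sum.cartesian_product y by (intro sum.cong) auto
    also have "\<dots> = (\<Sum>l<r. c l k * exterior_product (a l) (z' l) U)"
    proof (rule sum.cong[OF refl])
      fix l
      have "(\<Sum>S\<in>{S \<in> subsets_of_size q p. 0 \<notin> S}. z' l S * koszul_coeff q (a l) U S) =
          (\<Sum>S\<in>subsets_of_size q p. z' l S * koszul_coeff q (a l) U S)"
        by (rule sum.mono_neutral_left) (auto simp: z'_def)
      then show "(\<Sum>S\<in>{S \<in> subsets_of_size q p. 0 \<notin> S}. c l k * (z' l S * koszul_coeff q (a l) U S)) =
          c l k * exterior_product (a l) (z' l) U"
        by (simp only: sum_distrib_left[symmetric] sum_koszul_coeff_exterior[OF y(2)])
    qed
    also have "\<dots> = (\<Sum>l<r. c l k * exterior_product (a l) (z l) U)"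
      using red[OF _ y(2)] by simp
    also have "\<dots> = 0" by (rule zero[OF y(2,3)])
    finally show "(\<Sum>x\<in>?I. (\<lambda>(l, S). z' l S) x *
          (\<lambda>(l, S) (U, k). koszul_coeff q (a l) U S * c l k) x y) = 0" .
  qed
  then have "z' l (U - {i}) = 0" if "i \<in> U" for i
    using remove_in_subsets_of_size[OF U that] l by (cases "0 \<in> U - {i}") (auto simp: z'_def)
  then have "exterior_product (a l) (z' l) U = 0"
    unfolding exterior_product_def by (intro sum.neutral) simp
  then show ?thesis using red[OF l U] by simp
qed

text \<open>The sign \<open>(-1) ^ i\<close> cancels the one in \<open>phi_map\<close>, so that
  contracting the basis form of \<open>{..<p + 1}\<close> by \<open>a\<close> is mapped to the
  truncation of \<open>a\<close>.\<close>

lemma koszul_coeff_initial: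
  assumes "i < p + 1" and "p + 1 \<le> q"
  shows "koszul_coeff q a {..<p + 1} ({..<p + 1} - {i}) = (-1) ^ i * a i"
proof -
  have "koszul_coeff q a {..<p + 1} ({..<p + 1} - {i}) =
      (\<Sum>k<q. if k = i then koszul_sign {..<p + 1} i * a i else 0)"
    unfolding koszul_coeff_def
  proof (intro sum.cong refl if_cong)
    fix k
    show "(k \<notin> {..<p + 1} - {i} \<and> {..<p + 1} = insert k ({..<p + 1} - {i})) = (k = i)"
      using assms(1) by auto
  qed auto
  moreover have "{j \<in> {..<p + 1}. j < i} = {..<i}" using assms by auto
  ultimately show ?thesis using assms by (simp add: koszul_sign_def)
qed

lemma koszul_coeff_initial_zero:
  assumes "\<not> S \<subseteq> {..<p + 1}"
  shows "koszul_coeff q a {..<p + 1} S = 0"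
  unfolding koszul_coeff_def using assms by (intro sum.neutral) auto

lemma interior_independentD:
  assumes ind: "interior_independent p q n r a b" and q: "p + 1 \<le> q"
    and supp: "\<And>l U. l < r \<Longrightarrow> 0 \<notin> U \<Longrightarrow> y l U = 0"
    and zero: "\<And>S j. S \<in> subsets_of_size q p \<Longrightarrow> \<not> S \<subseteq> {..<p + 1} \<Longrightarrow> j < n \<Longrightarrow>
      (\<Sum>l<r. b l j * interior_product q (a l) (y l) S) = 0"
    and l: "l < r" and S: "S \<in> subsets_of_size q p"
  shows "interior_product q (a l) (y l) S = y l {..<p + 1} * koszul_coeff q (a l) {..<p + 1} S"
proof -
  let ?V = "{U \<in> subsets_of_size q (p + 1). 0 \<in> U \<and> U \<noteq> {..<p + 1}}"
  let ?I = "{..<r} \<times> ?V"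
  have "(\<lambda>(l, U). y l U) (l, U) = 0" if "(l, U) \<in> ?I" for l U
  proof (rule indep_familyD[OF ind[unfolded interior_independent_def] _ that])
    fix x assume "x \<in> {S \<in> subsets_of_size q p. \<not> S \<subseteq> {..<p + 1}} \<times> {..<n}"
    then obtain S j where x: "x = (S, j)" "S \<in> subsets_of_size q p" "\<not> S \<subseteq> {..<p + 1}" "j < n" by blast
    have "(\<Sum>i\<in>?I. (\<lambda>(l, U). y l U) i *
          (\<lambda>(l, U) (S, j). koszul_coeff q (a l) U S * b l j) i x) =
        (\<Sum>l<r. \<Sum>U\<in>?V. b l j * (y l U * koszul_coeff q (a l) U S))"
      unfolding sum.cartesian_product x by (intro sum.cong) auto
    also have "\<dots> = (\<Sum>l<r. b l j * interior_product q (a l) (y l) S)"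
    proof (rule sum.cong[OF refl])
      fix l assume "l \<in> {..<r}"
      then have "(\<Sum>U\<in>?V. y l U * koszul_coeff q (a l) U S) =
          (\<Sum>U\<in>subsets_of_size q (p + 1). y l U * koszul_coeff q (a l) U S)"
        using koszul_coeff_initial_zero[OF x(3)] supp by (intro sum.mono_neutral_left) auto
      then show "(\<Sum>U\<in>?V. b l j * (y l U * koszul_coeff q (a l) U S)) =
          b l j * interior_product q (a l) (y l) S"
        by (simp only: sum_distrib_left[symmetric] sum_koszul_coeff_interior[OF x(2)])
    qed
    also have "\<dots> = 0" by (rule zero[OF x(2-4)])
    finally show "(\<Sum>i\<in>?I. (\<lambda>(l, U). y l U) i *
          (\<lambda>(l, U) (S, j). koszul_coeff q (a l) U S * b l j) i x) = 0" .
  qed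
  then have y0: "y l U = 0" if "U \<in> subsets_of_size q (p + 1)" "U \<noteq> {..<p + 1}" for U
    using that l supp by (cases "0 \<in> U") auto
  have init: "{..<p + 1} \<in> subsets_of_size q (p + 1)" using q by (auto simp: subsets_of_size_def)
  have "interior_product q (a l) (y l) S =
      (\<Sum>U\<in>subsets_of_size q (p + 1). y l U * koszul_coeff q (a l) U S)"
    by (rule sum_koszul_coeff_interior[OF S, symmetric])
  also have "\<dots> = (\<Sum>U\<in>{{..<p + 1}}. y l U * koszul_coeff q (a l) U S)"
    using init y0 by (intro sum.mono_neutral_right) auto
  finally show ?thesis by simp
qed

lemma koszul_entry_decomposition:
  assumes "\<And>i. i < q \<Longrightarrow> T i j k = (\<Sum>l<r. a l i * b l j * c l k)"
  shows "koszul_entry q T (S, j) (U, k) = (\<Sum>l<r. koszul_coeff q (a l) U S * b l j * c l k)"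
proof -
  have "koszul_entry q T (S, j) (U, k) = (\<Sum>i<q. \<Sum>l<r.
      (if i \<notin> S \<and> U = insert i S then koszul_sign U i * a l i else 0) * b l j * c l k)"
    unfolding koszul_entry_def prod.case
  proof (rule sum.cong[OF refl])
    fix i assume "i \<in> {..<q}"
    then have "T i j k = (\<Sum>l<r. a l i * b l j * c l k)" using assms by simp
    then show "(if i \<notin> S \<and> U = insert i S then koszul_sign U i * T i j k else 0) = (\<Sum>l<r.
        (if i \<notin> S \<and> U = insert i S then koszul_sign U i * a l i else 0) * b l j * c l k)"
      by (cases "i \<notin> S \<and> U = insert i S") (simp_all only: if_True if_False sum_distrib_left mult.assoc
        mult_zero_left sum.neutral_const simp_thms)
  qed
  also have "\<dots> = (\<Sum>l<r. koszul_coeff q (a l) U S * b l j * c l k)"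
    unfolding koszul_coeff_def sum_distrib_right by (rule sum.swap)
  finally show ?thesis .
qed

text \<open>For one inclusion, a vector annihilating all columns satisfies
  \<open>a l \<and> \<zeta> l = 0\<close> for each \<open>l\<close>, hence annihilates each
  \<open>w l\<close>; by duality \<open>w l\<close> is in the column space. For the other, an
  element of the column space is a sum of contractions by \<open>a l\<close> tensored with
  \<open>b l\<close>, and lying in \<open>Z_space\<close> leaves only multiples of the
  \<open>w l\<close>.\<close>

lemma koszul_space_eq_span:
  assumes q: "p + 1 \<le> q" and a: "\<And>l. l < r \<Longrightarrow> a l 0 \<noteq> 0"
    and ext_ind: "exterior_independent p q n3 r a c" and int_ind: "interior_independent p q n2 r a b"
    and T: "\<And>i j k. i < q \<Longrightarrow> j < n2 \<Longrightarrow> k < n3 \<Longrightarrow> T i j k = (\<Sum>l<r. a l i * b l j * c l k)"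
    and b: "\<And>l j. l < r \<Longrightarrow> n2 \<le> j \<Longrightarrow> b l j = 0"
    and d: "\<And>l i. l < r \<Longrightarrow> d l i = (if i < p + 1 then a l i else 0)"
  shows "koszul_space n2 n3 T p q = fvs.span ((\<lambda>l. tensor (d l) (b l)) ` {..<r})"
proof -
  let ?I = "subsets_of_size q p \<times> {..<n2}" and ?J = "subsets_of_size q (p + 1) \<times> {..<n3}"
  let ?K = "{S \<in> subsets_of_size q p. S \<subseteq> {..<p + 1}} \<times> {..<n2}"
  define column where "column y = (\<lambda>x. if x \<in> ?I then koszul_entry q T x y else 0)" for y
  have colspan: "koszul_colspan n2 n3 T p q = fvs.span (column ` ?J)"
    by (simp add: koszul_colspan_def colspan_def column_def[abs_def])
  have Z: "Z_space p q n2 = {f. \<forall>x. x \<notin> ?K \<longrightarrow> f x = 0}"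
    unfolding Z_space_def by (rule span_basis_vec) simp
  have entry: "koszul_entry q T (S, j) (U, k) = (\<Sum>l<r. koszul_coeff q (a l) U S * b l j * c l k)"
    if "j < n2" "k < n3" for S j U k
    using T that by (intro koszul_entry_decomposition) auto
  have init_remove: "{..<p + 1} - {i} \<in> subsets_of_size q p" if "i < p + 1" for i
    using q that by (intro remove_in_subsets_of_size) (auto simp: subsets_of_size_def)
  \<comment> \<open>The basis form of \<open>{..<p + 1}\<close> contracted by \<open>a l\<close> and
    tensored with \<open>b l\<close>: the preimage of \<open>tensor (d l) (b l)\<close> under
    \<open>phi_map\<close>.\<close>
  define w where "w l = (\<lambda>(S, j). if (S, j) \<in> ?I
    then koszul_coeff q (a l) {..<p + 1} S * b l j else 0)" for l
  have w_col: "w l \<in> koszul_colspan n2 n3 T p q" if l: "l < r" for l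
    unfolding colspan
  proof (rule in_span_if_annihilated[of ?I])
    fix z :: "nat set \<times> nat \<Rightarrow> real"
    assume z: "\<And>f. f \<in> column ` ?J \<Longrightarrow> (\<Sum>x\<in>?I. z x * f x) = 0"
    \<comment> \<open>Contracting \<open>z\<close> with \<open>b l\<close> in the second slot turns
      its pairing with the columns into exterior products.\<close>
    define \<zeta> where "\<zeta> l S = (\<Sum>j<n2. z (S, j) * b l j)" for l S
    have pair: "(\<Sum>S\<in>subsets_of_size q p. \<Sum>j<n2. z (S, j) * (koszul_coeff q (a l) U S * b l j)) =
        exterior_product (a l) (\<zeta> l) U" if "U \<in> subsets_of_size q (p + 1)" for l U
      unfolding sum_koszul_coeff_exterior[OF that, symmetric] \<zeta>_def sum_distrib_right
      by (intro sum.cong refl) simp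
    have "(\<Sum>l<r. c l k * exterior_product (a l) (\<zeta> l) U) = 0"
      if U: "U \<in> subsets_of_size q (p + 1)" and k: "k < n3" for U k
    proof -
      have "(\<Sum>l<r. c l k * exterior_product (a l) (\<zeta> l) U) =
          (\<Sum>l<r. \<Sum>x\<in>?I. z x * (koszul_coeff q (a l) U (fst x) * b l (snd x) * c l k))"
        unfolding pair[OF U, symmetric] sum.cartesian_product sum_distrib_left
        by (intro sum.cong refl) auto
      also have "\<dots> = (\<Sum>x\<in>?I. z x * column (U, k) x)"
        unfolding sum.swap[of _ ?I] column_def
        by (intro sum.cong refl) (use k in \<open>auto simp: entry sum_distrib_left\<close>)
      also have "\<dots> = 0" using U k by (intro z) auto
      finally show ?thesis .
    qed
    then have "exterior_product (a l) (\<zeta> l) {..<p + 1} = 0"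
      using q by (intro exterior_independentD[OF ext_ind a _ l]) (auto simp: subsets_of_size_def)
    moreover have "(\<Sum>x\<in>?I. z x * w l x) =
        (\<Sum>S\<in>subsets_of_size q p. \<Sum>j<n2. z (S, j) * (koszul_coeff q (a l) {..<p + 1} S * b l j))"
      unfolding sum.cartesian_product w_def by (intro sum.cong refl) auto
    ultimately show "(\<Sum>x\<in>?I. z x * w l x) = 0"
      using q by (subst (asm) pair) (auto simp: subsets_of_size_def)
  qed (auto simp: column_def w_def split: if_splits)
  have w_Z: "w l (S, j) = 0" if "(S, j) \<notin> ?K" for l S j
    using that koszul_coeff_initial_zero[of S p q "a l"] by (auto simp: w_def)
  have phi_w: "(-1) ^ i * w l ({..<p + 1} - {i}, j) = a l i * b l j" if "i < p + 1" "l < r" for l i j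
  proof (cases "j < n2")
    case True
    then have "w l ({..<p + 1} - {i}, j) = (-1) ^ i * a l i * b l j"
      using init_remove[OF that(1)] koszul_coeff_initial[OF that(1) q, of "a l"] by (simp add: w_def)
    moreover have "(-1 :: real) ^ i * (-1) ^ i = 1" by (simp add: power_mult_distrib[symmetric])
    ultimately show ?thesis by (simp add: mult.assoc[symmetric])
  next
    case False
    then show ?thesis using b that by (simp add: w_def)
  qed
  show ?thesis
  proof
    show "fvs.span ((\<lambda>l. tensor (d l) (b l)) ` {..<r}) \<subseteq> koszul_space n2 n3 T p q"
    proof
      fix x assume "x \<in> fvs.span ((\<lambda>l. tensor (d l) (b l)) ` {..<r})"
      then obtain s where x: "x = (\<lambda>z. \<Sum>l<r. s l * tensor (d l) (b l) z)"
        by (auto simp: span_family)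
      define v where "v = (\<lambda>z. \<Sum>l<r. s l * w l z)"
      have "v = (\<Sum>l<r. (\<lambda>z. s l * w l z))" by (simp add: v_def sum_fun_eq)
      then have "v \<in> koszul_colspan n2 n3 T p q"
        using w_col unfolding colspan by (auto intro!: fvs.span_sum fvs.span_scale)
      moreover have "v \<in> Z_space p q n2" unfolding Z v_def using w_Z by auto
      moreover have "phi_map p v = x"
      proof (rule ext)
        fix z :: "nat \<times> nat" obtain i j where z: "z = (i, j)" by (cases z)
        show "phi_map p v z = x z"
        proof (cases "i < p + 1")
          case True
          have "phi_map p v z = (-1) ^ i * v ({..<p + 1} - {i}, j)"
            using True by (simp only: z phi_map_def prod.case if_True)
          also have "\<dots> = (\<Sum>l<r. s l * ((-1) ^ i * w l ({..<p + 1} - {i}, j)))"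
            unfolding v_def sum_distrib_left by (intro sum.cong refl mult.left_commute)
          also have "\<dots> = x z"
            unfolding x z tensor_def prod.case using True
            by (intro sum.cong refl) (simp only: phi_w d lessThan_iff if_True)
          finally show ?thesis .
        next
          case False
          then show ?thesis by (simp add: z x phi_map_def tensor_def d)
        qed
      qed
      ultimately show "x \<in> koszul_space n2 n3 T p q" unfolding koszul_space_def by blast
    qed
    show "koszul_space n2 n3 T p q \<subseteq> fvs.span ((\<lambda>l. tensor (d l) (b l)) ` {..<r})"
    proof
      fix x assume "x \<in> koszul_space n2 n3 T p q"
      then obtain v where v: "v \<in> koszul_colspan n2 n3 T p q" "v \<in> Z_space p q n2" "x = phi_map p v"
        unfolding koszul_space_def by blast
      have "finite ?J" by simp
      then obtain \<beta> where \<beta>: "v = (\<lambda>z. \<Sum>y\<in>?J. \<beta> y * column y z)"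
        using v(1) unfolding colspan by (auto simp: span_family)
      define y where "y l U = (\<Sum>k<n3. \<beta> (U, k) * c l k)" for l U
      \<comment> \<open>Passing to forms supported on sets containing \<open>0\<close> keeps all
        contractions and makes \<open>interior_independentD\<close> applicable.\<close>
      define y' where
        "y' l = (\<lambda>U. if 0 \<in> U then interior_product q (a l) (y l) (U - {0}) / a l 0 else 0)" for l
      have v_eq: "v (S, j) = (\<Sum>l<r. b l j * interior_product q (a l) (y' l) S)"
        if S: "S \<in> subsets_of_size q p" and j: "j < n2" for S j
      proof -
        have "v (S, j) = (\<Sum>U\<in>subsets_of_size q (p + 1). \<Sum>k<n3. \<Sum>l<r.
            \<beta> (U, k) * (koszul_coeff q (a l) U S * b l j * c l k))"
        proof -
          have "v (S, j) = (\<Sum>(U, k)\<in>?J. \<beta> (U, k) * column (U, k) (S, j))"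
            unfolding \<beta> by (simp add: case_prod_beta)
          also have "\<dots> = (\<Sum>U\<in>subsets_of_size q (p + 1). \<Sum>k<n3. \<beta> (U, k) * column (U, k) (S, j))"
            by (rule sum.cartesian_product[symmetric])
          also have "\<dots> = (\<Sum>U\<in>subsets_of_size q (p + 1). \<Sum>k<n3. \<Sum>l<r.
              \<beta> (U, k) * (koszul_coeff q (a l) U S * b l j * c l k))"
            unfolding column_def
            by (intro sum.cong refl) (use S j in \<open>auto simp: entry sum_distrib_left\<close>)
          finally show ?thesis .
        qed
        also have "\<dots> = (\<Sum>U\<in>subsets_of_size q (p + 1). \<Sum>l<r. \<Sum>k<n3.
            \<beta> (U, k) * (koszul_coeff q (a l) U S * b l j * c l k))"
          by (intro sum.cong refl sum.swap)
        also have "\<dots> = (\<Sum>l<r. \<Sum>U\<in>subsets_of_size q (p + 1). \<Sum>k<n3.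
            \<beta> (U, k) * (koszul_coeff q (a l) U S * b l j * c l k))"
          by (rule sum.swap)
        also have "\<dots> = (\<Sum>l<r. b l j * interior_product q (a l) (y l) S)"
        proof (rule sum.cong[OF refl])
          fix l
          show "(\<Sum>U\<in>subsets_of_size q (p + 1). \<Sum>k<n3.
              \<beta> (U, k) * (koszul_coeff q (a l) U S * b l j * c l k)) =
              b l j * interior_product q (a l) (y l) S"
            unfolding sum_koszul_coeff_interior[OF S, symmetric] y_def sum_distrib_left sum_distrib_right
            by (intro sum.cong refl) (simp only: mult_ac)
        qed
        also have "\<dots> = (\<Sum>l<r. b l j * interior_product q (a l) (y' l) S)"
        proof (rule sum.cong[OF refl])
          fix l assume "l \<in> {..<r}"
          then have "interior_product q (a l) (y' l) S = interior_product q (a l) (y l) S"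
            using a subsets_of_sizeD[OF S] q by (intro interior_product_reduce) (auto simp: y'_def)
          then show "b l j * interior_product q (a l) (y l) S =
            b l j * interior_product q (a l) (y' l) S" by simp
        qed
        finally show ?thesis .
      qed
      have y': "interior_product q (a l) (y' l) S =
          y' l {..<p + 1} * koszul_coeff q (a l) {..<p + 1} S"
        if "l < r" "S \<in> subsets_of_size q p" for l S
      proof (rule interior_independentD[OF int_ind q _ _ that])
        fix S j assume S: "S \<in> subsets_of_size q p" "\<not> S \<subseteq> {..<p + 1}" "j < n2"
        then have "v (S, j) = 0" using v(2) unfolding Z by auto
        then show "(\<Sum>l<r. b l j * interior_product q (a l) (y' l) S) = 0"
          using v_eq[OF S(1,3)] by simp
      qed (simp add: y'_def)
      have "x z = (\<Sum>l<r. y' l {..<p + 1} * tensor (d l) (b l) z)" for z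
      proof -
        obtain i j where z: "z = (i, j)" by (cases z)
        show ?thesis
        proof (cases "i < p + 1")
          case i: True
          let ?S = "{..<p + 1} - {i}"
          have "v (?S, j) = (\<Sum>l<r. y' l {..<p + 1} * w l (?S, j))"
          proof (cases "j < n2")
            case True
            show ?thesis unfolding v_eq[OF init_remove[OF i] True]
            proof (rule sum.cong[OF refl])
              fix l assume "l \<in> {..<r}"
              then have "interior_product q (a l) (y' l) ?S =
                  y' l {..<p + 1} * koszul_coeff q (a l) {..<p + 1} ?S"
                using y' init_remove[OF i] by blast
              moreover have "w l (?S, j) = koszul_coeff q (a l) {..<p + 1} ?S * b l j"
                using init_remove[OF i] True by (simp add: w_def)
              ultimately show "b l j * interior_product q (a l) (y' l) ?S =
                  y' l {..<p + 1} * w l (?S, j)" by simp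
            qed
          next
            case False
            then have "v (?S, j) = 0" using v(2) unfolding Z by auto
            then show ?thesis using False by (simp add: w_def)
          qed
          then have "x z = (-1) ^ i * (\<Sum>l<r. y' l {..<p + 1} * w l (?S, j))"
            using i by (simp only: v(3) z phi_map_def prod.case if_True)
          also have "\<dots> = (\<Sum>l<r. y' l {..<p + 1} * ((-1) ^ i * w l (?S, j)))"
            unfolding sum_distrib_left by (intro sum.cong refl mult.left_commute)
          also have "\<dots> = (\<Sum>l<r. y' l {..<p + 1} * tensor (d l) (b l) z)"
            unfolding z tensor_def prod.case using i
            by (intro sum.cong refl) (simp only: phi_w d lessThan_iff if_True)
          finally show ?thesis .
        next
          case False
          then show ?thesis by (simp add: z v(3) phi_map_def tensor_def d)
        qed
      qed
      then have "x = (\<lambda>z. \<Sum>l<r. y' l {..<p + 1} * tensor (d l) (b l) z)" by (rule ext)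
      then show "x \<in> fvs.span ((\<lambda>l. tensor (d l) (b l)) ` {..<r})"
        unfolding span_family[OF finite_lessThan]
        by (rule range_eqI[of _ _ "\<lambda>l. y' l {..<p + 1}"])
    qed
  qed
qed

subsection \<open>Explicit independent configurations\<close>

text \<open>Combining the relations with the coefficients of the polynomial that vanishes on
  \<open>L - {l}\<close> isolates \<open>x l\<close>. Its degree is below \<open>card L\<close>, so
  the number of powers needed depends on the supported nodes and not on \<open>r\<close>.\<close>

lemma vandermonde_independent:
  fixes x :: "nat \<Rightarrow> real"
  assumes L: "L \<subseteq> {..<r}" "card L \<le> k" and supp: "\<And>l. l < r \<Longrightarrow> l \<notin> L \<Longrightarrow> x l = 0"
    and zero: "\<And>j. j < k \<Longrightarrow> (\<Sum>l<r. x l * real l ^ j) = 0" and l: "l < r"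
  shows "x l = 0"
proof (cases "l \<in> L")
  case True
  have fin: "finite L" using L(1) finite_subset by blast
  define P where "P = (\<Prod>m\<in>L - {l}. [:- real m, 1:])"
  have "degree P \<le> (\<Sum>m\<in>L - {l}. degree [:- real m, 1:])"
    unfolding P_def using fin by (intro degree_prod_sum_le[unfolded comp_def]) simp
  also have "\<dots> = card (L - {l})" by simp
  also have "\<dots> < card L" using fin True by (rule card_Diff1_less)
  finally have deg: "degree P < k" using L(2) by simp
  have "(\<Sum>m<r. x m * poly P (real m)) = (\<Sum>j\<le>degree P. coeff P j * (\<Sum>m<r. x m * real m ^ j))"
  proof -
    have "(\<Sum>m<r. x m * poly P (real m)) = (\<Sum>m<r. \<Sum>j\<le>degree P. x m * (coeff P j * real m ^ j))"
      by (simp only: poly_altdef sum_distrib_left)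
    also have "\<dots> = (\<Sum>j\<le>degree P. \<Sum>m<r. x m * (coeff P j * real m ^ j))" by (rule sum.swap)
    also have "\<dots> = (\<Sum>j\<le>degree P. coeff P j * (\<Sum>m<r. x m * real m ^ j))"
      unfolding sum_distrib_left by (intro sum.cong refl mult.left_commute)
    finally show ?thesis .
  qed
  also have "\<dots> = 0" using zero deg by simp
  finally have "(\<Sum>m<r. x m * poly P (real m)) = 0" .
  moreover have "(\<Sum>m<r. x m * poly P (real m)) = (\<Sum>m\<in>{l}. x m * poly P (real m))"
  proof (rule sum.mono_neutral_right)
    show "\<forall>m\<in>{..<r} - {l}. x m * poly P (real m) = 0"
    proof
      fix m assume m: "m \<in> {..<r} - {l}"
      show "x m * poly P (real m) = 0"
      proof (cases "m \<in> L")
        case True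
        then have "poly P (real m) = 0" unfolding P_def poly_prod using fin m by auto
        then show ?thesis by simp
      qed (use m supp in auto)
    qed
  qed (use l in auto)
  moreover have "poly P (real l) \<noteq> 0" unfolding P_def poly_prod using fin by auto
  ultimately show ?thesis by simp
qed (use supp l in auto)

lemma card_residue_classes:
  assumes "finite A" and "r \<le> q * g"
  shows "card {l \<in> {..<r}. l mod q \<in> A} \<le> card A * g"
proof -
  let ?f = "\<lambda>l. (l mod q, l div q)"
  have "inj_on ?f {l \<in> {..<r}. l mod q \<in> A}"
    by (rule inj_onI) (metis div_mod_decomp prod.inject)
  moreover have "?f ` {l \<in> {..<r}. l mod q \<in> A} \<subseteq> A \<times> {..<g}"
    using assms(2) by (auto simp: less_mult_imp_div_less mult.commute)
  ultimately have "card {l \<in> {..<r}. l mod q \<in> A} \<le> card (A \<times> {..<g})"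
    using assms(1) by (intro card_inj_on_le) auto
  then show ?thesis by (simp add: card_cartesian_product)
qed

lemma koszul_sign_nonzero [simp]: "koszul_sign U i \<noteq> 0"
  by (simp add: koszul_sign_def)

text \<open>With first factors \<open>e\<^sub>0 + e\<^bsub>l mod q\<^esub>\<close>, at each coordinate \<open>U\<close> only few of the second factors
  interfere, and these are independent by Vandermonde. The coordinates not containing \<open>0\<close> have to be
  cleared before those containing \<open>0\<close>; for interior products it is the other way round.\<close>

lemma exterior_independent_witness:
  assumes a: "\<And>l i. l < r \<Longrightarrow> i < q \<Longrightarrow> a l i = (if i = 0 \<or> i = l mod q then 1 else 0)"
    and c: "\<And>l k. l < r \<Longrightarrow> k < n \<Longrightarrow> c l k = real l ^ k"
    and r: "r \<le> q * g" and g: "(p + 1) * g \<le> n" and q: "0 < q"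
  shows "exterior_independent p q n r a c"
  unfolding exterior_independent_def
proof (rule indep_familyI)
  let ?V = "{S \<in> subsets_of_size q p. 0 \<notin> S}" and ?W = "subsets_of_size q (p + 1)"
  fix z x
  assume zero: "\<And>y. y \<in> ?W \<times> {..<n} \<Longrightarrow> (\<Sum>x\<in>{..<r} \<times> ?V.
      z x * (\<lambda>(l, S) (U, k). koszul_coeff q (a l) U S * c l k) x y) = 0"
    and "x \<in> {..<r} \<times> ?V"
  then obtain l0 S0 where x: "x = (l0, S0)" "l0 < r" "S0 \<in> subsets_of_size q p" "0 \<notin> S0" by blast
  define z' where "z' l S = (if S \<in> ?V then z (l, S) else 0)" for l S
  \<comment> \<open>If only residues in \<open>U\<close> contribute at this coordinate, there are at
    most \<open>(p + 1) * g \<le> n\<close> nodes, few enough for Vandermonde.\<close>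
  have vanish: "exterior_product (a l) (z' l) U = 0"
    if U: "U \<in> ?W" and l: "l < r"
      and supp: "\<And>l. l < r \<Longrightarrow> l mod q \<notin> U \<Longrightarrow> exterior_product (a l) (z' l) U = 0" for U l
  proof (rule vandermonde_independent[OF _ _ _ _ l])
    let ?L = "{l \<in> {..<r}. l mod q \<in> U}"
    show "?L \<subseteq> {..<r}" by auto
    have "card ?L \<le> card U * g" using subsets_of_sizeD[OF U] r by (intro card_residue_classes) auto
    then show "card ?L \<le> n" using subsets_of_sizeD[OF U] g by simp
    show "exterior_product (a l) (z' l) U = 0" if "l < r" "l \<notin> ?L" for l using that supp by auto
    fix k assume k: "k < n"
    have "(\<Sum>l<r. exterior_product (a l) (z' l) U * real l ^ k) =
        (\<Sum>l<r. \<Sum>S\<in>?V. z (l, S) * (koszul_coeff q (a l) U S * c l k))"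
    proof (rule sum.cong[OF refl])
      fix l assume "l \<in> {..<r}"
      then have cl: "c l k = real l ^ k" using c k by simp
      have "exterior_product (a l) (z' l) U = (\<Sum>S\<in>?V. z (l, S) * koszul_coeff q (a l) U S)"
        unfolding sum_koszul_coeff_exterior[OF U, symmetric]
        by (rule sum.mono_neutral_cong_right) (auto simp: z'_def)
      then show "exterior_product (a l) (z' l) U * real l ^ k =
          (\<Sum>S\<in>?V. z (l, S) * (koszul_coeff q (a l) U S * c l k))"
        by (simp only: cl sum_distrib_right mult.assoc)
    qed
    also have "\<dots> = (\<Sum>x\<in>{..<r} \<times> ?V.
        z x * (\<lambda>(l, S) (U, k). koszul_coeff q (a l) U S * c l k) x (U, k))"
      unfolding sum.cartesian_product by (intro sum.cong) auto
    also have "\<dots> = 0" using U k by (intro zero) auto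
    finally show "(\<Sum>l<r. exterior_product (a l) (z' l) U * real l ^ k) = 0" .
  qed
  \<comment> \<open>When \<open>0 \<notin> U\<close>, the factor \<open>a l\<close> can only remove
    \<open>l mod q\<close>, so indices with other residues contribute nothing.\<close>
  have phase1: "z' l (U - {l mod q}) = 0"
    if l: "l < r" and U: "U \<in> ?W" "0 \<notin> U" "l mod q \<in> U" for l U
  proof -
    have eq: "exterior_product (a l) (z' l) U =
        (if l mod q \<in> U then koszul_sign U (l mod q) * z' l (U - {l mod q}) else 0)" if "l < r" for l
    proof -
      have "exterior_product (a l) (z' l) U =
          (\<Sum>i\<in>U. if i = l mod q then koszul_sign U i * z' l (U - {i}) else 0)"
        unfolding exterior_product_def
      proof (rule sum.cong[OF refl])
        fix i assume "i \<in> U"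
        moreover from this have "i < q" "i \<noteq> 0"
          using subsets_of_sizeD[OF U(1)] U(2) by (blast, metis)
        ultimately show "koszul_sign U i * a l i * z' l (U - {i}) =
            (if i = l mod q then koszul_sign U i * z' l (U - {i}) else 0)"
          using a[OF that] by simp
      qed
      then show ?thesis using subsets_of_sizeD[OF U(1)] by (simp add: sum.delta)
    qed
    have "exterior_product (a l) (z' l) U = 0"
      using eq by (intro vanish[OF U(1) l]) auto
    then show ?thesis using eq[OF l] U(3) by simp
  qed
  let ?U = "insert 0 S0"
  have U: "?U \<in> ?W" using insert_in_subsets_of_size[OF x(3) q x(4)] .
  \<comment> \<open>Removing anything but \<open>0\<close> leaves a set containing \<open>0\<close>,
    where \<open>z'\<close> vanishes. So every \<open>l\<close> may contribute here; those with
    \<open>l mod q \<notin> ?U\<close> are discarded by the first phase at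
    \<open>insert (l mod q) S0\<close>.\<close>
  have eq: "exterior_product (a l) (z' l) ?U = z' l S0" if "l < r" for l
  proof -
    have "exterior_product (a l) (z' l) ?U =
        (\<Sum>i\<in>{0}. koszul_sign ?U i * a l i * z' l (?U - {i}))"
      unfolding exterior_product_def using subsets_of_sizeD[OF x(3)]
      by (intro sum.mono_neutral_right) (auto simp: z'_def)
    then show ?thesis using a[OF that q] x(4) by simp
  qed
  have "exterior_product (a l0) (z' l0) ?U = 0"
  proof (rule vanish[OF U x(2)])
    fix l assume l: "l < r" "l mod q \<notin> ?U"
    have "z' l (insert (l mod q) S0 - {l mod q}) = 0"
      using l x q by (intro phase1 insert_in_subsets_of_size) auto
    then show "exterior_product (a l) (z' l) ?U = 0" using l by (simp add: eq)
  qed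
  then show "z x = 0" using x eq[OF x(2)] by (simp add: z'_def)
qed

lemma interior_independent_witness:
  assumes a: "\<And>l i. l < r \<Longrightarrow> i < q \<Longrightarrow> a l i = (if i = 0 \<or> i = l mod q then 1 else 0)"
    and b: "\<And>l j. l < r \<Longrightarrow> j < n \<Longrightarrow> b l j = real l ^ j"
    and r: "r \<le> q * g" and g: "(q - p + 1) * g \<le> n" and q: "0 < q"
  shows "interior_independent p q n r a b"
  unfolding interior_independent_def
proof (rule indep_familyI)
  let ?V = "{U \<in> subsets_of_size q (p + 1). 0 \<in> U \<and> U \<noteq> {..<p + 1}}"
  let ?W = "{S \<in> subsets_of_size q p. \<not> S \<subseteq> {..<p + 1}}"
  fix y x
  assume zero: "\<And>s. s \<in> ?W \<times> {..<n} \<Longrightarrow> (\<Sum>x\<in>{..<r} \<times> ?V.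
      y x * (\<lambda>(l, U) (S, j). koszul_coeff q (a l) U S * b l j) x s) = 0"
    and "x \<in> {..<r} \<times> ?V"
  then obtain l0 U0 where x: "x = (l0, U0)" "l0 < r" "U0 \<in> subsets_of_size q (p + 1)" "0 \<in> U0"
    "U0 \<noteq> {..<p + 1}" by blast
  define y' where "y' l U = (if U \<in> ?V then y (l, U) else 0)" for l U
  have vanish: "interior_product q (a l) (y' l) S = 0"
    if S: "S \<in> ?W" and l: "l < r" and A: "finite A" "card A \<le> q - p + 1"
      and supp: "\<And>l. l < r \<Longrightarrow> l mod q \<notin> A \<Longrightarrow> interior_product q (a l) (y' l) S = 0" for S l A
  proof (rule vandermonde_independent[OF _ _ _ _ l])
    let ?L = "{l \<in> {..<r}. l mod q \<in> A}"
    show "?L \<subseteq> {..<r}" by auto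
    have "card ?L \<le> card A * g" using A r by (intro card_residue_classes) auto
    also have "\<dots> \<le> (q - p + 1) * g" using A(2) by (rule mult_le_mono1)
    finally show "card ?L \<le> n" using g by simp
    show "interior_product q (a l) (y' l) S = 0" if "l < r" "l \<notin> ?L" for l using that supp by auto
    fix j assume j: "j < n"
    have "(\<Sum>l<r. interior_product q (a l) (y' l) S * real l ^ j) =
        (\<Sum>l<r. \<Sum>U\<in>?V. y (l, U) * (koszul_coeff q (a l) U S * b l j))"
    proof (rule sum.cong[OF refl])
      fix l assume "l \<in> {..<r}"
      then have bl: "b l j = real l ^ j" using b j by simp
      have S': "S \<in> subsets_of_size q p" using S by simp
      have "interior_product q (a l) (y' l) S = (\<Sum>U\<in>?V. y (l, U) * koszul_coeff q (a l) U S)"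
        unfolding sum_koszul_coeff_interior[OF S', symmetric]
        by (rule sum.mono_neutral_cong_right) (auto simp: y'_def)
      then show "interior_product q (a l) (y' l) S * real l ^ j =
          (\<Sum>U\<in>?V. y (l, U) * (koszul_coeff q (a l) U S * b l j))"
        by (simp only: bl sum_distrib_right mult.assoc)
    qed
    also have "\<dots> = (\<Sum>x\<in>{..<r} \<times> ?V.
        y x * (\<lambda>(l, U) (S, j). koszul_coeff q (a l) U S * b l j) x (S, j))"
      unfolding sum.cartesian_product by (intro sum.cong) auto
    also have "\<dots> = 0" using S j by (intro zero) auto
    finally show "(\<Sum>l<r. interior_product q (a l) (y' l) S * real l ^ j) = 0" .
  qed
  have card_compl: "card ({..<q} - S) = q - p" if "S \<in> subsets_of_size q p" for S
    using subsets_of_sizeD[OF that] by (simp add: card_Diff_subset)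
  \<comment> \<open>When \<open>0 \<in> S\<close>, contraction can only add \<open>l mod q\<close>,
    so the interfering residues are the \<open>q - p\<close> elements outside
    \<open>S\<close>.\<close>
  have phase1: "y' l (insert (l mod q) S) = 0"
    if l: "l < r" and S: "S \<in> ?W" "0 \<in> S" "l mod q \<notin> S" for l S
  proof -
    have eq: "interior_product q (a l) (y' l) S = (if l mod q \<in> {..<q} - S
        then koszul_sign (insert (l mod q) S) (l mod q) * y' l (insert (l mod q) S) else 0)"
      if "l < r" for l
    proof -
      have "interior_product q (a l) (y' l) S = (\<Sum>i\<in>{..<q} - S. if i = l mod q
          then koszul_sign (insert i S) i * y' l (insert i S) else 0)"
        unfolding interior_product_def
      proof (rule sum.cong[OF refl])
        fix i assume "i \<in> {..<q} - S"
        moreover from this have "i < q" "i \<noteq> 0" using S(2) by (blast, metis Diff_iff)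
        ultimately show "koszul_sign (insert i S) i * a l i * y' l (insert i S) =
            (if i = l mod q then koszul_sign (insert i S) i * y' l (insert i S) else 0)"
          using a[OF that] by simp
      qed
      then show ?thesis by (simp add: sum.delta)
    qed
    have "interior_product q (a l) (y' l) S = 0"
    proof (rule vanish[OF S(1) l, of "{..<q} - S"])
      show "card ({..<q} - S) \<le> q - p + 1" using card_compl S(1) by simp
    qed (use eq in auto)
    then show ?thesis using eq[OF l] S(3) q by simp
  qed
  let ?S = "U0 - {0}"
  have S: "?S \<in> subsets_of_size q p" using remove_in_subsets_of_size[OF x(3,4)] .
  have "\<not> ?S \<subseteq> {..<p + 1}"
  proof
    assume "?S \<subseteq> {..<p + 1}"
    then have "U0 \<subseteq> {..<p + 1}" by auto
    then have "U0 = {..<p + 1}"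
      using subsets_of_sizeD[OF x(3)] by (intro card_subset_eq) auto
    then show False using x(5) by simp
  qed
  \<comment> \<open>Residues in \<open>?S\<close> are discarded by the first phase at
    \<open>U0 - {l mod q}\<close>, but this set must not lie inside \<open>{..<p + 1}\<close>. The
    element \<open>e\<close> ensures that for every such residue except \<open>e\<close> itself,
    which accounts for the extra class in \<open>q - p + 1\<close>.\<close>
  then obtain e where e: "e \<in> ?S" "\<not> e < p + 1" by auto
  have ins: "insert 0 ?S = U0" using x(4) by auto
  have eq: "interior_product q (a l) (y' l) ?S = y' l U0" if "l < r" for l
  proof -
    have "interior_product q (a l) (y' l) ?S =
        (\<Sum>i\<in>{0}. koszul_sign (insert i ?S) i * a l i * y' l (insert i ?S))"
      unfolding interior_product_def using q
      by (intro sum.mono_neutral_right) (auto simp: y'_def)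
    then show ?thesis using a[OF that q] ins by simp
  qed
  have "interior_product q (a l0) (y' l0) ?S = 0"
  proof (rule vanish[OF _ x(2), of _ "insert e ({..<q} - ?S)"])
    show "?S \<in> ?W" using S e by auto
    have "card (insert e ({..<q} - ?S)) \<le> Suc (card ({..<q} - ?S))" by (rule card_insert_le_m1) auto
    then show "card (insert e ({..<q} - ?S)) \<le> q - p + 1" using card_compl[OF S] by simp
    fix l assume l: "l < r" "l mod q \<notin> insert e ({..<q} - ?S)"
    let ?i = "l mod q" and ?S1 = "U0 - {l mod q}"
    have i: "?i \<in> U0" "?i \<noteq> 0" "?i \<noteq> e" using l q by auto
    have "?S1 \<in> subsets_of_size q p" using remove_in_subsets_of_size[OF x(3) i(1)] .
    moreover have "\<not> ?S1 \<subseteq> {..<p + 1}" using e i by auto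
    ultimately have "y' l (insert ?i ?S1) = 0"
      using i x(4) by (intro phase1[OF l(1)]) auto
    moreover have "insert ?i ?S1 = U0" using i(1) by auto
    ultimately show "interior_product q (a l) (y' l) ?S = 0" by (simp add: eq[OF l(1)])
  qed simp
  then show "y x = 0" using x eq[OF x(2)] by (simp add: y'_def)
qed

section \<open>Independent wedge products\<close>

lemma antisymmetric_vandermonde:
  fixes r k :: nat and \<beta> :: "nat \<Rightarrow> nat \<Rightarrow> real"
  assumes L: "L \<subseteq> {..<r}" "card L \<le> k"
    and supp: "\<And>l l'. l < r \<Longrightarrow> l' < r \<Longrightarrow> l \<notin> L \<or> l' \<notin> L \<Longrightarrow> \<beta> l l' = 0"
    and zero: "\<And>i i'. i < k \<Longrightarrow> i' < k \<Longrightarrow>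
      (\<Sum>l<r. \<Sum>l'<r. \<beta> l l' * (real l ^ i * real l' ^ i')) = 0"
    and l: "l < r" "l' < r"
  shows "\<beta> l l' = 0"
\<comment> \<open>Vandermonde in the second index; the moments it needs vanish by Vandermonde in the
  first.\<close>
proof (rule vandermonde_independent[OF L _ _ l(2), of "\<beta> l"])
  show "\<beta> l m = 0" if "m < r" "m \<notin> L" for m using supp l(1) that by blast
  fix i' assume i': "i' < k"
  show "(\<Sum>m<r. \<beta> l m * real m ^ i') = 0"
  proof (rule vandermonde_independent[OF L _ _ l(1), of "\<lambda>l. \<Sum>m<r. \<beta> l m * real m ^ i'"])
    show "(\<Sum>m<r. \<beta> l m * real m ^ i') = 0" if "l < r" "l \<notin> L" for l
      using supp that by (intro sum.neutral) auto
    show "(\<Sum>l<r. (\<Sum>m<r. \<beta> l m * real m ^ i') * real l ^ i) = 0" if "i < k" for i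
    proof -
      have "(\<Sum>l<r. (\<Sum>m<r. \<beta> l m * real m ^ i') * real l ^ i) =
          (\<Sum>l<r. \<Sum>m<r. \<beta> l m * (real l ^ i * real m ^ i'))"
        unfolding sum_distrib_right by (intro sum.cong refl) (simp only: mult_ac)
      then show ?thesis using zero[OF that i'] by simp
    qed
  qed
qed

text \<open>The second factors are \<open>e\<^sub>0, e\<^sub>0 + e\<^sub>1, e\<^sub>1, e\<^sub>1 + e\<^sub>2, \<dots>\<close>. The wedge of two of them has a leading
  coordinate \<open>e\<^sub>i \<and> e\<^sub>j\<close> with \<open>i + j\<close> minimal, and at most five pairs share it; these involve only four
  first factors, whose pairwise wedges are independent.\<close>

lemma wedge_product_witness:
  assumes d: "\<And>l i. l < r \<Longrightarrow> i < 4 \<Longrightarrow> d l i = real l ^ i"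
    and b: "\<And>l j. l < r \<Longrightarrow> j < n \<Longrightarrow>
      b l j = (if j = l div 2 \<or> odd l \<and> j = l div 2 + 1 then 1 else 0)"
    and r: "r \<le> 2 * (n - 1)"
  shows "indep_family (strict_pairs r) UNIV (wedge_product d b)"
proof (rule indep_familyI)
  fix c x
  assume zero: "\<And>z. z \<in> UNIV \<Longrightarrow> (\<Sum>x\<in>strict_pairs r. c x * wedge_product d b x z) = 0"
    and x: "x \<in> strict_pairs r"
  \<comment> \<open>The least \<open>i + j\<close> over the coordinates
    \<open>e_i \<and> e_j\<close> of \<open>b l \<and> b l'\<close>. If both vectors start at the
    same position, one index must move to the next one, hence the added \<open>1\<close>.\<close>
  define key :: "nat \<times> nat \<Rightarrow> nat" where
    "key = (\<lambda>(l, l'). l div 2 + l' div 2 + (if l div 2 = l' div 2 then 1 else 0))"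
  have "c (l1, l2) = 0" if "(l1, l2) \<in> strict_pairs r" "key (l1, l2) = s" for l1 l2 s
    using that
  proof (induction s arbitrary: l1 l2 rule: less_induct)
    case (less s)
    have l12: "l2 < l1" "l1 < r" using less.prems by auto
    define i0 where "i0 = l2 div 2"
    define j0 where "j0 = (if l1 div 2 = l2 div 2 then l1 div 2 + 1 else l1 div 2)"
    have "l2 div 2 \<le> l1 div 2" using l12 by (simp add: div_le_mono)
    then have ij: "i0 < j0" "i0 + j0 = s"
      using less.prems(2) by (auto simp: key_def i0_def j0_def)
    \<comment> \<open>Here \<open>r \<le> 2 * (n - 1)\<close> enters: even the successor of the
      starting position is a coordinate below \<open>n\<close>.\<close>
    have jn: "j0 < n" using l12 r by (auto simp: j0_def)
    define B where "B l l' = b l j0 * b l' i0 - b l' j0 * b l i0" for l l'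
    \<comment> \<open>The indices whose second factor starts at \<open>i0\<close> or
      \<open>j0\<close>. Four nodes call for the powers \<open>0\<close> to \<open>3\<close> in the
      first factors, which is why \<open>3 \<le> p\<close> is required later.\<close>
    define L where "L = {2 * i0, 2 * i0 + 1, 2 * j0, 2 * j0 + 1} \<inter> {..<r}"
    have L: "L \<subseteq> {..<r}" "card L \<le> 4"
    proof -
      have "card L \<le> card {2 * i0, 2 * i0 + 1, 2 * j0, 2 * j0 + 1}"
        unfolding L_def by (intro card_mono) auto
      also have "\<dots> \<le> 4" by (simp add: card_insert_if)
      finally show "card L \<le> 4" .
    qed (simp add: L_def)
    \<comment> \<open>With antisymmetric coefficients the sum over pairs of antisymmetrized products
      becomes a full double sum of plain products, the form needed for Vandermonde in both
      indices.\<close>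
    define \<beta> where "\<beta> l l' = (if l' < l then c (l, l') * B l l'
      else if l < l' then - (c (l', l) * B l' l) else 0)" for l l'
    have anti: "\<beta> l l' = - \<beta> l' l" for l l' by (auto simp: \<beta>_def)
    have bD: "j = l div 2 \<or> j = l div 2 + 1" if "l < r" "j < n" "b l j \<noteq> 0" for l j
      using b[OF that(1,2)] that(3) by (auto split: if_splits)
    have inL: "l \<in> L" if "l < r" "l div 2 = i0 \<or> l div 2 = j0" for l
    proof -
      have "l = 2 * (l div 2) \<or> l = 2 * (l div 2) + 1" by presburger
      then show ?thesis using that unfolding L_def by auto
    qed
    \<comment> \<open>A pair that is nonzero at this coordinate has key at most \<open>s\<close>;
      smaller keys are excluded by induction, and key \<open>s\<close> forces both indices into
      \<open>L\<close>.\<close>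
    have supp_pair: "c (l, l') * B l l' = 0" if l: "l' < l" "l < r" and nL: "l \<notin> L \<or> l' \<notin> L" for l l'
    proof (rule ccontr)
      assume nz: "c (l, l') * B l l' \<noteq> 0"
      then have "\<not> key (l, l') < s" using less.IH[of "key (l, l')" l l'] l by auto
      moreover have le: "l' div 2 \<le> l div 2" using l by (simp add: div_le_mono)
      moreover have "b l j0 \<noteq> 0 \<and> b l' i0 \<noteq> 0 \<or> b l' j0 \<noteq> 0 \<and> b l i0 \<noteq> 0"
        using nz by (auto simp: B_def)
      then have "(j0 = l div 2 \<or> j0 = l div 2 + 1) \<and> (i0 = l' div 2 \<or> i0 = l' div 2 + 1) \<or>
          (j0 = l' div 2 \<or> j0 = l' div 2 + 1) \<and> (i0 = l div 2 \<or> i0 = l div 2 + 1)"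
        using bD[of l j0] bD[of l' i0] bD[of l' j0] bD[of l i0] l jn ij by auto
      ultimately have "(l div 2 = i0 \<or> l div 2 = j0) \<and> (l' div 2 = i0 \<or> l' div 2 = j0)"
        using ij unfolding key_def by (auto split: if_splits)
      then show False using inL[of l] inL[of l'] l nL by auto
    qed
    have "\<beta> l1 l2 = 0"
    proof (rule antisymmetric_vandermonde[OF L])
      show "\<beta> l l' = 0" if "l < r" "l' < r" "l \<notin> L \<or> l' \<notin> L" for l l'
        using supp_pair[of l' l] supp_pair[of l l'] that by (auto simp: \<beta>_def)
      fix i i' :: nat assume i: "i < 4" "i' < 4"
      define E where "E l l' = d l i * d l' i'" for l l'
      have "(\<Sum>l<r. \<Sum>l'<r. \<beta> l l' * (E l l' - E l' l)) =
          2 * (\<Sum>(l, l')\<in>strict_pairs r. \<beta> l l' * (E l l' - E l' l))"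
      proof (rule sum_symmetric)
        show "\<beta> l l' * (E l l' - E l' l) = \<beta> l' l * (E l' l - E l l')" for l l'
          unfolding anti[of l l'] by (simp add: right_diff_distrib)
      qed simp
      also have "(\<Sum>(l, l')\<in>strict_pairs r. \<beta> l l' * (E l l' - E l' l)) =
          (\<Sum>x\<in>strict_pairs r. c x * wedge_product d b x ((i, i'), (j0, i0)))"
        by (rule sum.cong) (auto simp: \<beta>_def B_def E_def wedge_product_def)
      also have "\<dots> = 0" by (rule zero) simp
      finally have "(\<Sum>l<r. \<Sum>l'<r. \<beta> l l' * E l l') - (\<Sum>l<r. \<Sum>l'<r. \<beta> l l' * E l' l) = 0"
        by (simp add: right_diff_distrib sum_subtractf)
      moreover have "(\<Sum>l<r. \<Sum>l'<r. \<beta> l l' * E l' l) = - (\<Sum>l<r. \<Sum>l'<r. \<beta> l l' * E l l')"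
      proof -
        have "(\<Sum>l<r. \<Sum>l'<r. \<beta> l l' * E l' l) = (\<Sum>l'<r. \<Sum>l<r. \<beta> l l' * E l' l)" by (rule sum.swap)
        also have "\<dots> = (\<Sum>l'<r. \<Sum>l<r. - (\<beta> l' l * E l' l))"
        proof (intro sum.cong refl)
          show "\<beta> l l' * E l' l = - (\<beta> l' l * E l' l)" for l l' unfolding anti[of l l'] by simp
        qed
        finally show ?thesis by (simp add: sum_negf)
      qed
      ultimately have "(\<Sum>l<r. \<Sum>l'<r. \<beta> l l' * E l l') = 0" by simp
      moreover have "E l l' = real l ^ i * real l' ^ i'" if "l < r" "l' < r" for l l'
        using d i that by (simp add: E_def)
      ultimately show "(\<Sum>l<r. \<Sum>l'<r. \<beta> l l' * (real l ^ i * real l' ^ i')) = 0" by simp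
    qed (use l12 in auto)
    moreover have "B l1 l2 \<noteq> 0"
    proof -
      have i0n: "i0 < n" and l2: "l2 < r" using ij jn l12 by auto
      have "b l2 i0 = 1" using b[OF l2 i0n] by (simp add: i0_def)
      moreover have "b l1 j0 = 1 \<and> b l2 j0 * b l1 i0 = 0"
      proof (cases "l1 div 2 = l2 div 2")
        case True
        then have "odd l1" "even l2" using l12(1) by presburger+
        then show ?thesis using True b[OF l12(2) jn] b[OF l2 jn] by (auto simp: j0_def)
      next
        case False
        then have "i0 < l1 div 2" using ij by (auto simp: j0_def)
        then show ?thesis using False b[OF l12(2) jn] b[OF l12(2) i0n] by (auto simp: j0_def)
      qed
      ultimately show ?thesis by (auto simp: B_def)
    qed
    ultimately show ?case using l12 by (simp add: \<beta>_def)
  qed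
  then show "c x = 0" using x by (cases x) auto
qed

text \<open>The index \<open>l\<close> is read as two digits in base \<open>n\<close>, so the
  products are distinct matrix units.\<close>

lemma indep_family_basis_products:
  fixes r n :: nat
  assumes b: "\<And>l j. l < r \<Longrightarrow> j < n \<Longrightarrow> b l j = (if j = l mod n then 1 else 0)"
    and c: "\<And>l k. l < r \<Longrightarrow> k < n \<Longrightarrow> c l k = (if k = l div n then 1 else 0)"
    and r: "r \<le> n * n" and n: "0 < n"
  shows "indep_family {..<r} ({..<n} \<times> {..<n}) (\<lambda>l (j, k). b l j * c l k)"
proof (rule indep_familyI)
  fix x l
  assume zero: "\<And>z. z \<in> {..<n} \<times> {..<n} \<Longrightarrow> (\<Sum>l<r. x l * (\<lambda>(j, k). b l j * c l k) z) = 0"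
    and l: "l \<in> {..<r}"
  have jk: "l mod n < n" "l div n < n" using l r n by (auto simp: less_mult_imp_div_less)
  have "0 = (\<Sum>m<r. x m * (b m (l mod n) * c m (l div n)))"
    using zero[of "(l mod n, l div n)"] jk by simp
  also have "\<dots> = (\<Sum>m<r. if m = l then x m else 0)"
  proof (rule sum.cong[OF refl])
    fix m assume "m \<in> {..<r}"
    moreover have "m = l" if "l mod n = m mod n" "l div n = m div n"
      using that by (metis div_mod_decomp)
    ultimately show "x m * (b m (l mod n) * c m (l div n)) = (if m = l then x m else 0)"
      using b[OF _ jk(1), of m] c[OF _ jk(2), of m] by auto
  qed
  finally show "x l = 0" using l by simp
qed

subsection \<open>The tensor decomposition algorithm\<close>

text \<open>The two calls return factors in unrelated orders \<open>\<pi>\<close> and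
  \<open>\<rho>\<close>. The shared truncations \<open>d\<close> are pairwise non-proportional, so
  every admissible matching satisfies \<open>\<rho> (\<tau> l) = \<pi> l\<close>. Of
  \<open>w\<close> only its defining equation is recorded, which is all that the later steps
  use.\<close>

lemma succeeds_with_tensor_decomposition:
  assumes q: "q = 2 * p + 1" "q \<le> n1" and r: "2 \<le> r"
    and a: "\<And>l. l < r \<Longrightarrow> a l 0 \<noteq> 0"
    and ext: "exterior_independent p q n2 r a b" "exterior_independent p q n3 r a c"
    and int: "interior_independent p q n2 r a b" "interior_independent p q n3 r a c"
    and wedge: "indep_family (strict_pairs r) UNIV (wedge_product d b)"
      "indep_family (strict_pairs r) UNIV (wedge_product d c)"
    and T: "\<And>i j k. i < n1 \<Longrightarrow> j < n2 \<Longrightarrow> k < n3 \<Longrightarrow> T i j k = (\<Sum>l<r. a l i * b l j * c l k)"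
    and b: "\<And>l j. n2 \<le> j \<Longrightarrow> b l j = 0" and c: "\<And>l k. n3 \<le> k \<Longrightarrow> c l k = 0"
    and d: "\<And>l i. d l i = (if i < p + 1 then a l i else 0)"
  shows "succeeds_with (tensor_decomposition n1 n2 n3 T p q r) (\<lambda>(w, b', c').
    \<exists>\<pi>. \<pi> permutes {..<r} \<and> rescaled r \<pi> b' b \<and> rescaled r \<pi> c' c \<and>
      (\<forall>i<n1. \<forall>j<n2. \<forall>k<n3. (\<Sum>l<r. w l i * b' l j * c' l k) = T i j k))"
    (is "succeeds_with _ ?post")
proof -
  have q': "q - p - 1 = p" "min (p + 1) (q - p) = p + 1" "p + 1 \<le> q" using q by auto
  have U1: "koszul_space n2 n3 T p q = fvs.span ((\<lambda>l. tensor (d l) (b l)) ` {..<r})"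
    using T b d q by (intro koszul_space_eq_span[OF q'(3) a ext(2) int(1)]) auto
  have U2: "koszul_space n3 n2 (\<lambda>i k j. T i j k) p q = fvs.span ((\<lambda>l. tensor (d l) (c l)) ` {..<r})"
  proof (rule koszul_space_eq_span[OF q'(3) a ext(1) int(2)])
    fix i k j assume "i < q" "k < n3" "j < n2"
    then have "T i j k = (\<Sum>l<r. a l i * b l j * c l k)" using T q by auto
    then show "T i j k = (\<Sum>l<r. a l i * c l k * b l j)" by (simp only: mult_ac)
  qed (use c d in auto)
  note f1 = succeeds_with_rank_one_factors[OF wedge(1) r U1]
  note f2 = succeeds_with_rank_one_factors[OF wedge(2) r U2]
  have main: "succeeds_with (find_any (\<lambda>\<tau>. \<tau> permutes {..<r} \<and>
       (\<forall>l<r. proportional (p + 1) (f (\<tau> l)) (d' l))) \<rhd> (\<lambda>\<tau>.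
     find_any (\<lambda>w. \<forall>i<n1. \<forall>j<n2. \<forall>k<n3.
       (\<Sum>l<r. w l i * b' l j * c' (\<tau> l) k) = T i j k) \<rhd> (\<lambda>w.
     return (w, b', \<lambda>l. c' (\<tau> l))))) ?post"
    if \<pi>: "\<pi> permutes {..<r}" "rescaled r \<pi> d' d" "rescaled r \<pi> b' b"
      and \<rho>: "\<rho> permutes {..<r}" "rescaled r \<rho> f d" "rescaled r \<rho> c' c" for d' b' f c' \<pi> \<rho>
  proof -
    obtain sd where sd: "\<And>l. l < r \<Longrightarrow> sd l \<noteq> 0 \<and> d' l = (\<lambda>i. sd l * d (\<pi> l) i)"
      using \<pi>(2) unfolding rescaled_def by blast
    obtain sb where sb: "\<And>l. l < r \<Longrightarrow> sb l \<noteq> 0 \<and> b' l = (\<lambda>i. sb l * b (\<pi> l) i)"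
      using \<pi>(3) unfolding rescaled_def by blast
    obtain sf where sf: "\<And>l. l < r \<Longrightarrow> sf l \<noteq> 0 \<and> f l = (\<lambda>i. sf l * d (\<rho> l) i)"
      using \<rho>(2) unfolding rescaled_def by blast
    obtain sc where sc: "\<And>l. l < r \<Longrightarrow> sc l \<noteq> 0 \<and> c' l = (\<lambda>i. sc l * c (\<rho> l) i)"
      using \<rho>(3) unfolding rescaled_def by blast
    have \<pi>r: "\<pi> l < r" if "l < r" for l using permutes_in_image[OF \<pi>(1), of l] that by simp
    have \<rho>r: "\<rho> l < r" if "l < r" for l using permutes_in_image[OF \<rho>(1), of l] that by simp
    let ?match = "\<lambda>\<tau>. \<tau> permutes {..<r} \<and> (\<forall>l<r. \<rho> (\<tau> l) = \<pi> l)"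
    show ?thesis
    proof (rule succeeds_with_and_then[of _ ?match])
      show "succeeds_with (find_any (\<lambda>\<tau>. \<tau> permutes {..<r} \<and>
          (\<forall>l<r. proportional (p + 1) (f (\<tau> l)) (d' l)))) ?match"
      proof (rule succeeds_with_find_any)
        let ?\<tau> = "inv_into UNIV \<rho> \<circ> \<pi>"
        have \<tau>: "?\<tau> permutes {..<r}"
          by (rule permutes_compose[OF \<pi>(1) permutes_inv[OF \<rho>(1)]])
        have "proportional (p + 1) (f (?\<tau> l)) (d' l)" if l: "l < r" for l
        proof -
          have tl: "?\<tau> l < r" using permutes_in_image[OF \<tau>, of l] l by simp
          have "\<rho> (?\<tau> l) = \<pi> l" using permutes_inverses(1)[OF \<rho>(1)] by simp
          then have "f (?\<tau> l) i = (sf (?\<tau> l) / sd l) * d' l i" for i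
            using sf[OF tl] sd[OF l] by simp
          then show ?thesis unfolding proportional_def
            using sf[OF tl] sd[OF l] by (intro exI[of _ "sf (?\<tau> l) / sd l"]) simp
        qed
        with \<tau> show "\<exists>\<tau>. \<tau> permutes {..<r} \<and> (\<forall>l<r. proportional (p + 1) (f (\<tau> l)) (d' l))" by blast
        fix \<tau> assume \<tau>: "\<tau> permutes {..<r} \<and> (\<forall>l<r. proportional (p + 1) (f (\<tau> l)) (d' l))"
        have "\<rho> (\<tau> l) = \<pi> l" if l: "l < r" for l
        proof (rule ccontr)
          assume ne: "\<rho> (\<tau> l) \<noteq> \<pi> l"
          have tl: "\<tau> l < r" using permutes_in_image[of \<tau> "{..<r}" l] \<tau> l by simp
          obtain s where s: "\<And>i. i < p + 1 \<Longrightarrow> f (\<tau> l) i = s * d' l i"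
            using \<tau> l unfolding proportional_def by blast
          \<comment> \<open>Since \<open>d\<close> is zero from \<open>p + 1\<close> on,
            proportional initial entries mean proportional vectors.\<close>
          have "d (\<rho> (\<tau> l)) i = (s * sd l / sf (\<tau> l)) * d (\<pi> l) i" for i
          proof (cases "i < p + 1")
            case True
            have "sf (\<tau> l) * d (\<rho> (\<tau> l)) i = s * (sd l * d (\<pi> l) i)"
              using s[OF True] fun_cong[OF conjunct2[OF sf[OF tl]], of i]
                fun_cong[OF conjunct2[OF sd[OF l]], of i] by simp
            then have "sf (\<tau> l) * d (\<rho> (\<tau> l)) i / sf (\<tau> l) = s * (sd l * d (\<pi> l) i) / sf (\<tau> l)"
              by (rule arg_cong)
            then show ?thesis
              unfolding nonzero_mult_div_cancel_left[OF conjunct1[OF sf[OF tl]]] by simp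
          qed (simp add: d)
          then show False
            using wedge_product_not_proportional[OF wedge(1) \<rho>r[OF tl] \<pi>r[OF l] ne] by blast
        qed
        with \<tau> show "?match \<tau>" by blast
      qed
      fix \<tau> assume \<tau>: "?match \<tau>"
      have tr: "\<tau> l < r" if "l < r" for l using permutes_in_image[of \<tau> "{..<r}" l] \<tau> that by simp
      have c'\<tau>: "c' (\<tau> l) = (\<lambda>k. sc (\<tau> l) * c (\<pi> l) k)" "sc (\<tau> l) \<noteq> 0" if "l < r" for l
        using sc[OF tr[OF that]] \<tau> that by auto
      have resc: "rescaled r \<pi> (\<lambda>l. c' (\<tau> l)) c"
        unfolding rescaled_def using c'\<tau> by (intro exI[of _ "\<lambda>l. sc (\<tau> l)"]) auto
      let ?sol = "\<lambda>w. \<forall>i<n1. \<forall>j<n2. \<forall>k<n3. (\<Sum>l<r. w l i * b' l j * c' (\<tau> l) k) = T i j k"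
      show "succeeds_with (find_any ?sol \<rhd> (\<lambda>w. return (w, b', \<lambda>l. c' (\<tau> l)))) ?post"
      proof (rule succeeds_with_and_then[of _ ?sol])
        show "succeeds_with (find_any ?sol) ?sol"
        proof (rule succeeds_with_find_any)
          \<comment> \<open>The true first factors, with the scalings of \<open>b'\<close> and
            \<open>c'\<close> divided out, solve the linear system.\<close>
          define w where "w l i = a (\<pi> l) i / (sb l * sc (\<tau> l))" for l i
          have "(\<Sum>l<r. w l i * b' l j * c' (\<tau> l) k) = T i j k" if "i < n1" "j < n2" "k < n3" for i j k
          proof -
            have "(\<Sum>l<r. w l i * b' l j * c' (\<tau> l) k) = (\<Sum>l<r. a (\<pi> l) i * b (\<pi> l) j * c (\<pi> l) k)"
              using sb c'\<tau> by (intro sum.cong refl) (simp add: w_def)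
            also have "\<dots> = (\<Sum>l<r. a l i * b l j * c l k)"
              using sum.permute[OF \<pi>(1), of "\<lambda>l. a l i * b l j * c l k"] by (simp add: comp_def)
            finally show ?thesis using T that by simp
          qed
          then show "\<exists>w. ?sol w" by blast
        qed
        fix w assume "?sol w"
        with \<pi> resc show "succeeds_with (return (w, b', \<lambda>l. c' (\<tau> l))) ?post"
          by (intro succeeds_with_return) auto
      qed
    qed
  qed
  show ?thesis
    unfolding tensor_decomposition_def q'
  proof (rule succeeds_with_and_then[OF f1], clarify)
    fix d' b' \<pi>
    assume \<pi>: "\<pi> permutes {..<r}" "rescaled r \<pi> d' d" "rescaled r \<pi> b' b"
    show "succeeds_with (rank_one_factors (koszul_space n3 n2 (\<lambda>i k j. T i j k) p q) r \<rhd>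
        (\<lambda>(f, c'). find_any (\<lambda>\<tau>. \<tau> permutes {..<r} \<and>
           (\<forall>l<r. proportional (p + 1) (f (\<tau> l)) (d' l))) \<rhd> (\<lambda>\<tau>.
         find_any (\<lambda>w. \<forall>i<n1. \<forall>j<n2. \<forall>k<n3.
           (\<Sum>l<r. w l i * b' l j * c' (\<tau> l) k) = T i j k) \<rhd> (\<lambda>w.
         return (w, b', \<lambda>l. c' (\<tau> l)))))) ?post"
      by (rule succeeds_with_and_then[OF f2]) (use main[OF \<pi>] in auto)
  qed
qed

subsection \<open>The commuting extension algorithm\<close>

lemma index_mult_mat_sum:
  assumes "A \<in> carrier_mat nr n" "B \<in> carrier_mat n nc" "i < nr" "j < nc"
  shows "(A * B) $$ (i, j) = (\<Sum>k<n. A $$ (i, k) * B $$ (k, j))"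
  using assms by (auto simp: scalar_prod_def atLeast0LessThan intro!: sum.cong)

lemma index_mult_mat_diag_sum:
  assumes "A \<in> carrier_mat nr n" "B \<in> carrier_mat n nc" "i < nr" "j < nc"
  shows "(A * mat_diag n f * B) $$ (i, j) = (\<Sum>k<n. A $$ (i, k) * f k * B $$ (k, j))"
proof -
  have "A * mat_diag n f \<in> carrier_mat nr n" using assms(1) by (intro mult_carrier_mat) auto
  from index_mult_mat_sum[OF this assms(2-4)] show ?thesis
    using assms by (auto simp: mat_diag_mult_right[OF assms(1)] intro!: sum.cong)
qed

lemma mat_inv_eqI:
  assumes A: "A \<in> carrier_mat n n" and B: "B \<in> carrier_mat n n" and AB: "A * B = 1\<^sub>m n"
  shows "mat_inv A = B"
proof -
  have BA: "B * A = 1\<^sub>m n" by (rule mat_mult_left_right_inverse[OF A B AB])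
  obtain B' where B': "mat_inverse A = Some B'"
  proof (cases "mat_inverse A")
    case None
    then have "A \<notin> Units (ring_mat TYPE(real) n ())" by (rule mat_inverse(1)[OF A])
    moreover have "A \<in> Units (ring_mat TYPE(real) n ())"
      using A B AB BA by (auto simp: Units_def ring_mat_simps)
    ultimately show ?thesis by blast
  qed auto
  then have inv: "B' * A = 1\<^sub>m n" "B' \<in> carrier_mat n n" using mat_inverse(2)[OF A] by auto
  have "B' = B' * (A * B)" using inv by (simp add: AB)
  also have "\<dots> = B' * A * B" by (rule assoc_mult_mat[OF inv(2) A B, symmetric])
  also have "\<dots> = B" using inv B by simp
  finally show ?thesis by (simp add: mat_inv_def B')
qed

lemma invertible_mat_if_right_inverse:
  fixes A B :: "real mat"
  assumes A: "A \<in> carrier_mat n n" and B: "B \<in> carrier_mat n n" and AB: "A * B = 1\<^sub>m n"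
  shows "invertible_mat A"
  using A B AB mat_mult_left_right_inverse[OF A B AB]
  by (auto simp: invertible_mat_def inverts_mat_def square_mat.simps)

lemma mult_mat_unit_vec:
  fixes A :: "real mat"
  assumes "A \<in> carrier_mat nr nc" and "j < nc"
  shows "A *\<^sub>v unit_vec nc j = col A j"
  using assms by (intro eq_vecI) auto

lemma zero_mult_mat_vec:
  fixes x :: "real vec"
  assumes "x \<in> carrier_vec nc"
  shows "0\<^sub>m nr nc *\<^sub>v x = 0\<^sub>v nr"
  using assms by (intro eq_vecI) (auto simp: scalar_prod_def)

section \<open>Completing rectangular blocks to mutually inverse matrices\<close>

context
  fixes U0 C R2 L2 :: "real mat" and n s r :: nat
  assumes carriers: "U0 \<in> carrier_mat n r" "C \<in> carrier_mat r n" "R2 \<in> carrier_mat r s"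
      "L2 \<in> carrier_mat s r"
    and blocks: "U0 * C = 1\<^sub>m n" "U0 * R2 = 0\<^sub>m n s" "L2 * C = 0\<^sub>m s n" "L2 * R2 = 1\<^sub>m s"
      "C * U0 + R2 * L2 = 1\<^sub>m r"
begin

text \<open>The block identities say that \<open>(C | R2)\<close> and \<open>U0\<close> stacked over
  \<open>L2\<close> are inverse to each other, so a kernel vector \<open>v\<close> of
  \<open>U0\<close> equals \<open>R2 L2 v\<close>.\<close>

lemma kernel_image_block: "(\<lambda>x. R2 *\<^sub>v x) ` carrier_vec s = mat_kernel U0"
proof
  show "(\<lambda>x. R2 *\<^sub>v x) ` carrier_vec s \<subseteq> mat_kernel U0"
  proof clarify
    fix x :: "real vec" assume x: "x \<in> carrier_vec s"
    have "U0 *\<^sub>v (R2 *\<^sub>v x) = (U0 * R2) *\<^sub>v x"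
      using carriers x by (simp add: assoc_mult_mat_vec[of U0 n r R2 s x])
    also have "\<dots> = 0\<^sub>v n" using x by (simp add: blocks zero_mult_mat_vec)
    finally show "R2 *\<^sub>v x \<in> mat_kernel U0"
      using carriers x by (intro mat_kernelI[OF carriers(1)]) auto
  qed
  show "mat_kernel U0 \<subseteq> (\<lambda>x. R2 *\<^sub>v x) ` carrier_vec s"
  proof
    fix v assume "v \<in> mat_kernel U0"
    then have v: "v \<in> carrier_vec r" "U0 *\<^sub>v v = 0\<^sub>v n" using mat_kernelD[OF carriers(1)] by auto
    have "v = (C * U0 + R2 * L2) *\<^sub>v v" using v by (simp add: blocks)
    also have "\<dots> = (C * U0) *\<^sub>v v + (R2 * L2) *\<^sub>v v"
      using carriers v by (intro add_mult_distrib_mat_vec) auto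
    also have "(C * U0) *\<^sub>v v = C *\<^sub>v (U0 *\<^sub>v v)"
      by (rule assoc_mult_mat_vec[OF carriers(2,1) v(1)])
    also have "(R2 * L2) *\<^sub>v v = R2 *\<^sub>v (L2 *\<^sub>v v)"
      using carriers v(1) by (simp add: assoc_mult_mat_vec[of R2 r s L2 r v])
    also have "C *\<^sub>v (U0 *\<^sub>v v) = 0\<^sub>v r"
      unfolding v(2) using carriers(2) by (intro eq_vecI) (auto simp: scalar_prod_def)
    also have "0\<^sub>v r + R2 *\<^sub>v (L2 *\<^sub>v v) = R2 *\<^sub>v (L2 *\<^sub>v v)"
      using carriers v(1) by (intro left_zero_vec) auto
    finally show "v \<in> (\<lambda>x. R2 *\<^sub>v x) ` carrier_vec s"
      using carriers v(1) by (intro image_eqI[of _ _ "L2 *\<^sub>v v"]) auto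
  qed
qed

context
  fixes B' :: "real mat"
  assumes B': "B' \<in> carrier_mat r s" "(\<lambda>x. B' *\<^sub>v x) ` carrier_vec s = mat_kernel U0"
begin

lemma kernel_block_zero: "U0 * B' = 0\<^sub>m n s"
proof (rule eq_matI)
  fix i j assume ij: "i < dim_row (0\<^sub>m n s :: real mat)" "j < dim_col (0\<^sub>m n s :: real mat)"
  have "B' *\<^sub>v unit_vec s j \<in> mat_kernel U0" using B'(2) by auto
  then have "U0 *\<^sub>v (B' *\<^sub>v unit_vec s j) = 0\<^sub>v n" using mat_kernelD[OF carriers(1)] by auto
  moreover have "B' *\<^sub>v unit_vec s j = col B' j" using B'(1) ij by (intro mult_mat_unit_vec[of _ r]) auto
  ultimately have "(U0 *\<^sub>v col B' j) $ i = 0" using ij by simp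
  then show "(U0 * B') $$ (i, j) = 0\<^sub>m n s $$ (i, j)" using ij carriers B'(1) by simp
qed (use carriers B' in auto)

text \<open>The image of \<open>B'\<close> contains the columns of \<open>R2\<close>, so
  \<open>R2 = B' Y\<close> for a square \<open>Y\<close>. From \<open>L2 R2 = 1\<close> this
  \<open>Y\<close> is inverse to \<open>L2 B'\<close>, and the transpose of \<open>Y L2\<close> is
  the required matrix.\<close>

lemma complement_exists:
  "\<exists>A'. A' \<in> carrier_mat r s \<and> A'\<^sup>T * B' = 1\<^sub>m s \<and> A'\<^sup>T * C = 0\<^sub>m s n"
proof -
  have "\<exists>y. y \<in> carrier_vec s \<and> B' *\<^sub>v y = col R2 j" if "j < s" for j
  proof -
    have "R2 *\<^sub>v unit_vec s j \<in> mat_kernel U0" unfolding kernel_image_block[symmetric] by auto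
    moreover have "R2 *\<^sub>v unit_vec s j = col R2 j"
      using carriers(3) that by (intro mult_mat_unit_vec[of _ r]) auto
    ultimately have "col R2 j \<in> (\<lambda>x. B' *\<^sub>v x) ` carrier_vec s" using B'(2) by simp
    then show ?thesis by auto
  qed
  then obtain y where y: "\<And>j. j < s \<Longrightarrow> y j \<in> carrier_vec s \<and> B' *\<^sub>v y j = col R2 j" by metis
  define Y where "Y = mat s s (\<lambda>(i, j). y j $ i)"
  have Y: "Y \<in> carrier_mat s s" by (simp add: Y_def)
  have BY: "B' * Y = R2"
  proof (rule eq_matI)
    fix i j assume ij: "i < dim_row R2" "j < dim_col R2"
    then have j: "j < s" and i: "i < r" using carriers by auto
    have "col Y j = y j" using y[OF j] j by (intro eq_vecI) (auto simp: Y_def)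
    then have "(B' * Y) $$ (i, j) = (B' *\<^sub>v y j) $ i" using i j B'(1) Y by simp
    also have "\<dots> = R2 $$ (i, j)" using y[OF j] ij by simp
    finally show "(B' * Y) $$ (i, j) = R2 $$ (i, j)" .
  qed (use carriers B' Y in auto)
  have "(L2 * B') * Y = 1\<^sub>m s"
    using carriers B'(1) Y by (simp add: assoc_mult_mat[of L2 s r B' s Y s] BY blocks)
  then have YX: "Y * (L2 * B') = 1\<^sub>m s"
    using carriers B'(1) Y by (intro mat_mult_left_right_inverse[of "L2 * B'" s Y]) auto
  have "Y * L2 * B' = 1\<^sub>m s"
    using YX carriers B'(1) Y by (simp add: assoc_mult_mat[of Y s s L2 r B' s])
  moreover have "Y * L2 * C = 0\<^sub>m s n"
    using carriers Y by (simp add: assoc_mult_mat[of Y s s L2 r C n] blocks)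
  moreover have "Y * L2 \<in> carrier_mat s r" using Y carriers by auto
  ultimately show ?thesis by (intro exI[of _ "(Y * L2)\<^sup>T"]) auto
qed

end

end

lemma append_cols_carrier:
  "A \<in> carrier_mat nr nc1 \<Longrightarrow> B \<in> carrier_mat nr nc2 \<Longrightarrow> append_cols A B \<in> carrier_mat nr (nc1 + nc2)"
  by (auto simp: append_cols_def four_block_mat_def Let_def)

lemma index_append_cols:
  assumes "A \<in> carrier_mat nr nc1" and "B \<in> carrier_mat nr nc2" and "i < nr" "j < nc1 + nc2"
  shows "append_cols A B $$ (i, j) = (if j < nc1 then A $$ (i, j) else B $$ (i, j - nc1))"
  using assms by (auto simp: append_cols_def)

lemma append_cols_mult:
  assumes A: "A1 \<in> carrier_mat r n" "A2 \<in> carrier_mat r s"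
    and B: "B1 \<in> carrier_mat r n" "B2 \<in> carrier_mat r s"
    and one: "A1\<^sup>T * B1 = 1\<^sub>m n" "A1\<^sup>T * B2 = 0\<^sub>m n s" "A2\<^sup>T * B1 = 0\<^sub>m s n" "A2\<^sup>T * B2 = 1\<^sub>m s"
  shows "(append_cols A1 A2)\<^sup>T * append_cols B1 B2 = 1\<^sub>m (n + s)"
proof (rule eq_matI)
  let ?A = "append_cols A1 A2" and ?B = "append_cols B1 B2"
  have car: "?A \<in> carrier_mat r (n + s)" "?B \<in> carrier_mat r (n + s)"
    using A B by (auto intro: append_cols_carrier)
  show "dim_row (?A\<^sup>T * ?B) = dim_row (1\<^sub>m (n + s) :: real mat)"
    "dim_col (?A\<^sup>T * ?B) = dim_col (1\<^sub>m (n + s) :: real mat)" using car by auto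
  fix i j assume "i < dim_row (1\<^sub>m (n + s) :: real mat)" "j < dim_col (1\<^sub>m (n + s) :: real mat)"
  then have ij: "i < n + s" "j < n + s" by auto
  have entry: "(?A\<^sup>T * ?B) $$ (i, j) = (\<Sum>k<r. ?A $$ (k, i) * ?B $$ (k, j))"
    using car ij by (subst index_mult_mat_sum[of _ "n + s" r _ "n + s"]) auto
  have prod: "(X\<^sup>T * Y) $$ (i, j) = (\<Sum>k<r. X $$ (k, i) * Y $$ (k, j))"
    if "X \<in> carrier_mat r nx" "Y \<in> carrier_mat r ny" "i < nx" "j < ny" for X Y :: "real mat" and nx ny i j
    using that by (subst index_mult_mat_sum[of _ nx r _ ny]) auto
  note ix = index_append_cols[OF A _ ij(1)] index_append_cols[OF B _ ij(2)]
  show "(?A\<^sup>T * ?B) $$ (i, j) = 1\<^sub>m (n + s) $$ (i, j)"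
  proof (cases "i < n"; cases "j < n")
    assume "i < n" "j < n"
    then show ?thesis using prod[OF A(1) B(1), of i j] ij by (simp add: entry ix one)
  next
    assume "i < n" "\<not> j < n"
    then show ?thesis using prod[OF A(1) B(2), of i "j - n"] ij by (simp add: entry ix one)
  next
    assume "\<not> i < n" "j < n"
    then show ?thesis using prod[OF A(2) B(1), of "i - n" j] ij by (simp add: entry ix one)
  next
    assume "\<not> i < n" "\<not> j < n"
    moreover from this have "(i - n = j - n) = (i = j)" by auto
    ultimately show ?thesis using prod[OF A(2) B(2), of "i - n" "j - n"] ij
      by (simp add: entry ix one)
  qed
qed

text \<open>Every output is a conjugate of diagonal matrices by the same pair \<open>Ut\<close>,
  \<open>Vt\<close>, which gives commutation. In the upper left block only \<open>U0\<close> and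
  \<open>C\<close> enter.\<close>

lemma succeeds_with_commuting_extension_steps:
  fixes Mi B C :: "real mat"
  assumes n: "n \<le> r" and car: "Mi \<in> carrier_mat n n" "B \<in> carrier_mat n r" "C \<in> carrier_mat r n"
      "R2 \<in> carrier_mat r (r - n)" "L2 \<in> carrier_mat (r - n) r"
    and \<delta>: "\<And>l. l < r \<Longrightarrow> \<delta> l \<noteq> 0"
    and U0: "U0 = Mi * B * mat_diag r \<delta>"
    and blocks: "U0 * C = 1\<^sub>m n" "U0 * R2 = 0\<^sub>m n (r - n)" "L2 * C = 0\<^sub>m (r - n) n"
      "L2 * R2 = 1\<^sub>m (r - n)" "C * U0 + R2 * L2 = 1\<^sub>m r"
    and unique: "\<And>Dh. Dh \<in> carrier_mat r r \<Longrightarrow> diagonal_mat Dh \<Longrightarrow> Mi * B * Dh * C = 1\<^sub>m n \<Longrightarrow>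
      Dh = mat_diag r \<delta>"
    and A: "\<And>i. i < m \<Longrightarrow> Mi * B * mat_diag r (f i) * C = A i"
  shows "succeeds_with (
     find_any (\<lambda>Dh. Dh \<in> carrier_mat r r \<and> diagonal_mat Dh \<and> Mi * B * Dh * C = 1\<^sub>m n) \<rhd> (\<lambda>Dh.
     find_any (\<lambda>B'. B' \<in> carrier_mat r (r - n) \<and>
       (\<lambda>x. B' *\<^sub>v x) ` carrier_vec (r - n) = mat_kernel (Mi * B * Dh)) \<rhd> (\<lambda>B'.
     find_any (\<lambda>A'. A' \<in> carrier_mat r (r - n) \<and>
       A'\<^sup>T * B' = 1\<^sub>m (r - n) \<and> A'\<^sup>T * C = 0\<^sub>m (r - n) n) \<rhd> (\<lambda>A'.
     fail_unless (invertible_mat Dh) \<rhd> (\<lambda>_.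
     return (\<lambda>i. (append_cols ((Mi * B * Dh)\<^sup>T) A')\<^sup>T * mat_inv Dh * mat_diag r (f i) * append_cols C B'))))))
     (\<lambda>Zt. (\<forall>i<m. Zt i \<in> carrier_mat r r) \<and> (\<forall>i<m. \<forall>j<m. Zt i * Zt j = Zt j * Zt i) \<and>
        (\<forall>i<m. upper_left n (Zt i) = A i))" (is "succeeds_with _ ?post")
proof (rule succeeds_with_and_then)
  let ?D = "mat_diag r \<delta>"
  have U0c: "U0 \<in> carrier_mat n r" 
    unfolding U0 by (rule mult_carrier_mat[OF mult_carrier_mat[OF car(1,2)] mat_diag_dim])
  note blk = U0c car(3-5) blocks
  have diag: "diagonal_mat ?D" by (auto simp: diagonal_mat_def mat_diag_def)
  have inv: "?D * mat_diag r (\<lambda>l. 1 / \<delta> l) = 1\<^sub>m r"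
  proof -
    have "?D * mat_diag r (\<lambda>l. 1 / \<delta> l) = mat_diag r (\<lambda>l. \<delta> l * (1 / \<delta> l))" by simp
    also have "\<dots> = 1\<^sub>m r" using \<delta> by (intro eq_matI) (auto simp: mat_diag_def)
    finally show ?thesis .
  qed
  have mat_inv_D: "mat_inv ?D = mat_diag r (\<lambda>l. 1 / \<delta> l)" by (rule mat_inv_eqI[OF _ _ inv]) auto
  show "succeeds_with (find_any (\<lambda>Dh. Dh \<in> carrier_mat r r \<and> diagonal_mat Dh \<and>
      Mi * B * Dh * C = 1\<^sub>m n)) (\<lambda>Dh. Dh = ?D)"
    using diag blocks(1) unique unfolding U0
    by (intro succeeds_with_find_any exI[of _ ?D]) auto
  fix Dh assume Dh: "Dh = ?D"
  show "succeeds_with (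
     find_any (\<lambda>B'. B' \<in> carrier_mat r (r - n) \<and>
       (\<lambda>x. B' *\<^sub>v x) ` carrier_vec (r - n) = mat_kernel (Mi * B * Dh)) \<rhd> (\<lambda>B'.
     find_any (\<lambda>A'. A' \<in> carrier_mat r (r - n) \<and>
       A'\<^sup>T * B' = 1\<^sub>m (r - n) \<and> A'\<^sup>T * C = 0\<^sub>m (r - n) n) \<rhd> (\<lambda>A'.
     fail_unless (invertible_mat Dh) \<rhd> (\<lambda>_.
     return (\<lambda>i. (append_cols ((Mi * B * Dh)\<^sup>T) A')\<^sup>T * mat_inv Dh * mat_diag r (f i) * append_cols C B')))))
     ?post"
    unfolding Dh U0[symmetric] mat_inv_D
  proof (rule succeeds_with_and_then)
    let ?B' = "\<lambda>B'. B' \<in> carrier_mat r (r - n) \<and>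
      (\<lambda>x. B' *\<^sub>v x) ` carrier_vec (r - n) = mat_kernel U0"
    show "succeeds_with (find_any ?B') ?B'"
      using kernel_image_block[OF blk] car(4) by (intro succeeds_with_find_any exI[of _ R2]) auto
    fix B' assume "?B' B'"
    then have B': "B' \<in> carrier_mat r (r - n)"
      "(\<lambda>x. B' *\<^sub>v x) ` carrier_vec (r - n) = mat_kernel U0" by auto
    let ?A' = "\<lambda>A'. A' \<in> carrier_mat r (r - n) \<and>
      A'\<^sup>T * B' = 1\<^sub>m (r - n) \<and> A'\<^sup>T * C = 0\<^sub>m (r - n) n"
    show "succeeds_with (find_any ?A' \<rhd> (\<lambda>A'. fail_unless (invertible_mat ?D) \<rhd> (\<lambda>_.
        return (\<lambda>i. (append_cols (U0\<^sup>T) A')\<^sup>T * mat_diag r (\<lambda>l. 1 / \<delta> l) * mat_diag r (f i) *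
          append_cols C B')))) ?post"
    proof (rule succeeds_with_and_then)
      show "succeeds_with (find_any ?A') ?A'"
        by (rule succeeds_with_find_any[OF complement_exists[OF blk B']])
      fix A' assume A': "?A' A'"
      define Ut where "Ut = (append_cols (U0\<^sup>T) A')\<^sup>T"
      define Vt where "Vt = append_cols C B'"
      define E where "E i = mat_diag r (\<lambda>l. 1 / \<delta> l * f i l)" for i
      have nr: "n + (r - n) = r" using n by simp
      have Uc: "Ut \<in> carrier_mat r r"
        unfolding Ut_def using append_cols_carrier[of "U0\<^sup>T" r n A' "r - n"] U0c A' nr by auto
      have Vc: "Vt \<in> carrier_mat r r"
        unfolding Vt_def using append_cols_carrier[OF car(3) B'(1)] nr by simp
      have Ec: "E i \<in> carrier_mat r r" for i by (simp add: E_def)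
      have "Ut * Vt = 1\<^sub>m (n + (r - n))"
        unfolding Ut_def Vt_def
        using U0c car B' A' blocks kernel_block_zero[OF blk B']
        by (intro append_cols_mult) auto
      then have UV: "Ut * Vt = 1\<^sub>m r" using nr by simp
      have VU: "Vt * Ut = 1\<^sub>m r" by (rule mat_mult_left_right_inverse[OF Uc Vc UV])
      define Zt where "Zt i = Ut * E i * Vt" for i
      have Z_eq: "(\<lambda>i. Ut * mat_diag r (\<lambda>l. 1 / \<delta> l) * mat_diag r (f i) * Vt) = Zt"
        unfolding Zt_def E_def mat_diag_diag[symmetric]
        using Uc by (intro ext) (simp add: assoc_mult_mat[of Ut r r _ r _ r])
      have Zc: "Zt i \<in> carrier_mat r r" for i
        unfolding Zt_def using Uc Vc Ec[of i] by auto
      have ZZ: "Zt i * Zt j = Ut * (E i * E j) * Vt" for i j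
      proof -
        have "Zt i * Zt j = Ut * E i * (Vt * (Ut * E j * Vt))"
          unfolding Zt_def using Uc Vc Ec[of i] Ec[of j] by (intro assoc_mult_mat) auto
        also have "Vt * (Ut * E j * Vt) = Vt * (Ut * (E j * Vt))"
          using Uc Vc Ec[of j] by (simp add: assoc_mult_mat[of Ut r r "E j" r Vt r])
        also have "\<dots> = Vt * Ut * (E j * Vt)"
          using Uc Vc Ec[of j] by (intro assoc_mult_mat[symmetric]) auto
        also have "\<dots> = E j * Vt" unfolding VU using Vc Ec[of j] by (intro left_mult_one_mat) auto
        also have "Ut * E i * (E j * Vt) = Ut * E i * E j * Vt"
          using Uc Vc Ec[of i] Ec[of j] by (intro assoc_mult_mat[symmetric]) auto
        also have "Ut * E i * E j = Ut * (E i * E j)"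
          using Uc Ec[of i] Ec[of j] by (intro assoc_mult_mat) auto
        finally show ?thesis .
      qed
      have "E i * E j = E j * E i" for i j by (simp add: E_def mult_ac)
      then have comm: "Zt i * Zt j = Zt j * Zt i" for i j unfolding ZZ by simp
      have up: "upper_left n (Zt i) = A i" if i: "i < m" for i
      proof -
        have MB: "Mi * B \<in> carrier_mat n r" using car by auto
        have "A i \<in> carrier_mat n n"
          unfolding A[OF i, symmetric]
          by (rule mult_carrier_mat[OF mult_carrier_mat[OF MB mat_diag_dim] car(3)])
        then show ?thesis
        proof (intro eq_matI)
          fix j k assume "j < dim_row (A i)" "k < dim_col (A i)" and Ai: "A i \<in> carrier_mat n n"
          then have jk: "j < n" "k < n" by auto
          \<comment> \<open>The factor \<open>\<delta> l\<close> contained in \<open>U0\<close>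
            cancels the inverse of the diagonal matrix in the output.\<close>
          have U: "Ut $$ (j, l) = (Mi * B) $$ (j, l) * \<delta> l" if "l < r" for l
          proof -
            have "Ut $$ (j, l) = append_cols (U0\<^sup>T) A' $$ (l, j)"
              unfolding Ut_def using that jk Uc n unfolding Ut_def by simp
            also have "\<dots> = U0 $$ (j, l)"
              using index_append_cols[of "U0\<^sup>T" r n A' "r - n" l j] U0c A' that jk by simp
            finally show ?thesis
              unfolding U0 mat_diag_mult_right[OF MB] using that jk by simp
          qed
          have V: "Vt $$ (l, k) = C $$ (l, k)" if "l < r" for l
            unfolding Vt_def using index_append_cols[OF car(3) B'(1), of l k] that jk by simp
          have "upper_left n (Zt i) $$ (j, k) = (Ut * E i * Vt) $$ (j, k)"
            using jk by (simp add: upper_left_def Zt_def)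
          also have "\<dots> = (\<Sum>l<r. Ut $$ (j, l) * (1 / \<delta> l * f i l) * Vt $$ (l, k))"
            unfolding E_def using jk n by (intro index_mult_mat_diag_sum[OF Uc Vc]) auto
          also have "\<dots> = (\<Sum>l<r. (Mi * B) $$ (j, l) * f i l * C $$ (l, k))"
            by (intro sum.cong refl) (use \<delta> in \<open>simp add: U V\<close>)
          also have "\<dots> = (Mi * B * mat_diag r (f i) * C) $$ (j, k)"
            using jk by (intro index_mult_mat_diag_sum[OF MB car(3), symmetric]) auto
          finally show "upper_left n (Zt i) $$ (j, k) = A i $$ (j, k)" by (simp add: A[OF i])
        qed (auto simp: upper_left_def)
      qed
      show "succeeds_with (fail_unless (invertible_mat ?D) \<rhd> (\<lambda>_.
        return (\<lambda>i. (append_cols (U0\<^sup>T) A')\<^sup>T * mat_diag r (\<lambda>l. 1 / \<delta> l) * mat_diag r (f i) *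
          append_cols C B'))) ?post"
      proof (rule succeeds_with_and_then[of _ "\<lambda>_. True"])
        show "succeeds_with (fail_unless (invertible_mat ?D)) (\<lambda>_. True)"
          by (intro succeeds_with_fail_unless invertible_mat_if_right_inverse[OF _ _ inv]) auto
        show "succeeds_with (return (\<lambda>i. (append_cols (U0\<^sup>T) A')\<^sup>T * mat_diag r (\<lambda>l. 1 / \<delta> l) *
          mat_diag r (f i) * append_cols C B')) ?post"
          unfolding Ut_def[symmetric] Vt_def[symmetric] Z_eq
          using Zc comm up by (intro succeeds_with_return) blast
      qed
    qed
  qed
qed

lemma sum_lessThan_add:
  fixes f :: "nat \<Rightarrow> real"
  shows "(\<Sum>k<n + s. f k) = (\<Sum>k<n. f k) + (\<Sum>k<s. f (n + k))"
  by (induction s) simp_all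

text \<open>The decomposition returns the true factors permuted and rescaled by
  \<open>\<beta>\<close> and \<open>\<gamma>\<close>. As the true ones satisfy
  \<open>B C = M\<close>, the diagonal matrix must undo both scalings, and independence of the
  products leaves no other solution.\<close>

lemma succeeds_with_commuting_extension:
  fixes R Ri M Mi :: "real mat"
  assumes n: "n \<le> r"
    and car: "R \<in> carrier_mat r r" "Ri \<in> carrier_mat r r" "M \<in> carrier_mat n n" "Mi \<in> carrier_mat n n"
    and inverse: "R * Ri = 1\<^sub>m r" "M * Mi = 1\<^sub>m n"
    and A: "\<And>i. i < m \<Longrightarrow> A i \<in> carrier_mat n n"
    and b: "\<And>l j. l < r \<Longrightarrow> j < n \<Longrightarrow> b l j = (\<Sum>t<n. M $$ (j, t) * Ri $$ (t, l))"
    and c: "\<And>l k. l < r \<Longrightarrow> k < n \<Longrightarrow> c l k = R $$ (l, k)"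
    and bc: "indep_family {..<r} ({..<n} \<times> {..<n}) (\<lambda>l (j, k). b l j * c l k)"
    and q: "q = Max {q. odd q \<and> q \<le> m}" and p: "p = (q - 1) div 2"
    and decomposition:
      "succeeds_with (tensor_decomposition m n n (\<lambda>i j k. (M * A i) $$ (j, k)) p q r) (\<lambda>(w, b', c').
        \<exists>\<pi>. \<pi> permutes {..<r} \<and> rescaled r \<pi> b' b \<and> rescaled r \<pi> c' c \<and>
          (\<forall>i<m. \<forall>j<n. \<forall>k<n. (\<Sum>l<r. w l i * b' l j * c' l k) = (M * A i) $$ (j, k)))"
  shows "succeeds_with (commuting_extension m n A r M)
     (\<lambda>Zt. (\<forall>i<m. Zt i \<in> carrier_mat r r) \<and> (\<forall>i<m. \<forall>j<m. Zt i * Zt j = Zt j * Zt i) \<and>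
        (\<forall>i<m. upper_left n (Zt i) = A i))" (is "succeeds_with _ ?post")
proof -
  have RiR: "Ri * R = 1\<^sub>m r" by (rule mat_mult_left_right_inverse[OF car(1,2) inverse(1)])
  have MiM: "Mi * M = 1\<^sub>m n" by (rule mat_mult_left_right_inverse[OF car(3,4) inverse(2)])
  have mat_inv_M: "mat_inv M = Mi" by (rule mat_inv_eqI[OF car(3,4) inverse(2)])
  have M_cancel: "Mi * (M * X) = X" if "X \<in> carrier_mat n nc" for X nc
    using that car MiM by (simp add: assoc_mult_mat[of Mi n n M n X nc, symmetric])
  have sum_RiR: "(\<Sum>l<r. Ri $$ (k, l) * R $$ (l, k')) = (if k = k' then 1 else 0)"
    if "k < r" "k' < r" for k k'
    using index_mult_mat_sum[OF car(2,1) that] that by (simp add: RiR)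
  have sum_RRi: "(\<Sum>k<r. R $$ (l, k) * Ri $$ (k, l')) = (if l = l' then 1 else 0)"
    if "l < r" "l' < r" for l l'
    using index_mult_mat_sum[OF car(1,2) that] that by (simp add: inverse(1))
  \<comment> \<open>The identity \<open>B C = M\<close>: the first \<open>n\<close> rows of
    \<open>Ri\<close> times the first \<open>n\<close> columns of \<open>R\<close> give the identity
    matrix.\<close>
  have sum_bc: "(\<Sum>l<r. b l j * c l k) = M $$ (j, k)" if jk: "j < n" "k < n" for j k
  proof -
    have "(\<Sum>l<r. b l j * c l k) = (\<Sum>l<r. \<Sum>t<n. M $$ (j, t) * (Ri $$ (t, l) * R $$ (l, k)))"
    proof (rule sum.cong[OF refl])
      fix l assume "l \<in> {..<r}"
      then have "b l j = (\<Sum>t<n. M $$ (j, t) * Ri $$ (t, l))" "c l k = R $$ (l, k)"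
        using b c jk by auto
      then show "b l j * c l k = (\<Sum>t<n. M $$ (j, t) * (Ri $$ (t, l) * R $$ (l, k)))"
        by (simp only: sum_distrib_right mult.assoc)
    qed
    also have "\<dots> = (\<Sum>t<n. \<Sum>l<r. M $$ (j, t) * (Ri $$ (t, l) * R $$ (l, k)))" by (rule sum.swap)
    also have "\<dots> = (\<Sum>t<n. if t = k then M $$ (j, t) else 0)"
    proof (rule sum.cong[OF refl])
      fix t assume "t \<in> {..<n}"
      then show "(\<Sum>l<r. M $$ (j, t) * (Ri $$ (t, l) * R $$ (l, k))) = (if t = k then M $$ (j, t) else 0)"
        unfolding sum_distrib_left[symmetric] using sum_RiR[of t k] jk n by simp
    qed
    finally show ?thesis using jk by simp
  qed
  show ?thesis
    unfolding commuting_extension_def Let_def q[symmetric] p[symmetric] mat_inv_M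
  proof (rule succeeds_with_and_then[OF decomposition], clarify)
    fix w b' c' \<pi>
    assume \<pi>: "\<pi> permutes {..<r}" and resc: "rescaled r \<pi> b' b" "rescaled r \<pi> c' c"
      and w: "\<forall>i<m. \<forall>j<n. \<forall>k<n. (\<Sum>l<r. w l i * b' l j * c' l k) = (M * A i) $$ (j, k)"
    obtain \<beta> where \<beta>: "\<And>l. l < r \<Longrightarrow> \<beta> l \<noteq> 0 \<and> b' l = (\<lambda>i. \<beta> l * b (\<pi> l) i)"
      using resc(1) unfolding rescaled_def by blast
    obtain \<gamma> where \<gamma>: "\<And>l. l < r \<Longrightarrow> \<gamma> l \<noteq> 0 \<and> c' l = (\<lambda>i. \<gamma> l * c (\<pi> l) i)"
      using resc(2) unfolding rescaled_def by blast
    have \<pi>r: "\<pi> l < r" if "l < r" for l using permutes_in_image[OF \<pi>, of l] that by simp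
    \<comment> \<open>\<open>R\<close> with rows permuted and rescaled like the recovered
      \<open>c'\<close>; its first \<open>n\<close> columns form \<open>?C\<close>, the others
      supply \<open>?R2\<close>. Likewise \<open>hi\<close>, its inverse, supplies \<open>U0\<close>
      and \<open>?L2\<close>.\<close>
    define h where "h l k = \<gamma> l * R $$ (\<pi> l, k)" for l k
    define hi where "hi k l = Ri $$ (k, \<pi> l) / \<gamma> l" for k l
    have hi_h: "(\<Sum>l<r. hi k l * h l k') = (if k = k' then 1 else 0)" if "k < r" "k' < r" for k k'
    proof -
      have "(\<Sum>l<r. hi k l * h l k') = (\<Sum>l<r. Ri $$ (k, \<pi> l) * R $$ (\<pi> l, k'))"
        using \<gamma> by (intro sum.cong refl) (simp add: h_def hi_def)
      also have "\<dots> = (\<Sum>l<r. Ri $$ (k, l) * R $$ (l, k'))"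
        using sum.permute[OF \<pi>, of "\<lambda>l. Ri $$ (k, l) * R $$ (l, k')"] by (simp add: comp_def)
      finally show ?thesis using sum_RiR that by simp
    qed
    have h_hi: "(\<Sum>k<r. h l k * hi k l') = (if l = l' then 1 else 0)" if "l < r" "l' < r" for l l'
    proof -
      have "(\<Sum>k<r. h l k * hi k l') = \<gamma> l / \<gamma> l' * (\<Sum>k<r. R $$ (\<pi> l, k) * Ri $$ (k, \<pi> l'))"
        unfolding sum_distrib_left h_def hi_def by (intro sum.cong refl) simp
      moreover have "\<pi> l = \<pi> l' \<longleftrightarrow> l = l'" using permutes_inj[OF \<pi>] by (simp add: inj_eq)
      ultimately show ?thesis using sum_RRi[OF \<pi>r[OF that(1)] \<pi>r[OF that(2)]] \<gamma>[OF that(1)] by auto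
    qed
    define \<delta> where "\<delta> l = 1 / (\<beta> l * \<gamma> l)" for l
    let ?B = "mat n r (\<lambda>(j, l). b' l j)" and ?C = "mat r n (\<lambda>(l, k). c' l k)"
    let ?R2 = "mat r (r - n) (\<lambda>(l, k). h l (n + k))" and ?L2 = "mat (r - n) r (\<lambda>(k, l). hi (n + k) l)"
    let ?X = "mat n r (\<lambda>(t, l). \<beta> l * Ri $$ (t, \<pi> l))"
    have C_entry: "?C $$ (l, k) = h l k" if "l < r" "k < n" for l k
      using that \<gamma>[OF that(1)] c[OF \<pi>r[OF that(1)] that(2)] by (simp add: h_def)
    have "?B = M * ?X"
    proof (rule eq_matI)
      fix j l assume "j < dim_row (M * ?X)" "l < dim_col (M * ?X)"
      then have jl: "j < n" "l < r" using car by auto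
      have "(M * ?X) $$ (j, l) = (\<Sum>t<n. M $$ (j, t) * ?X $$ (t, l))"
        using jl car by (intro index_mult_mat_sum) auto
      also have "\<dots> = \<beta> l * b (\<pi> l) j"
        unfolding b[OF \<pi>r[OF jl(2)] jl(1)] sum_distrib_left using jl by (intro sum.cong refl) simp
      finally show "?B $$ (j, l) = (M * ?X) $$ (j, l)" using jl \<beta>[OF jl(2)] by simp
    qed (use car in auto)
    then have MiB: "Mi * ?B = ?X" using M_cancel[of ?X r] by simp
    define U0 where "U0 = Mi * ?B * mat_diag r \<delta>"
    have U0_eq: "U0 = mat n r (\<lambda>(k, l). hi k l)"
      unfolding U0_def MiB mat_diag_mult_right[of ?X n r, OF mat_carrier]
      using \<beta> \<gamma> by (intro eq_matI) (auto simp: \<delta>_def hi_def)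
    have assoc: "Mi * ?B * D * ?C = Mi * (?B * D * ?C)" if "D \<in> carrier_mat r r" for D
    proof -
      have "Mi * ?B * D = Mi * (?B * D)" by (rule assoc_mult_mat[OF car(4) mat_carrier that])
      moreover have "Mi * (?B * D) * ?C = Mi * (?B * D * ?C)"
        by (rule assoc_mult_mat[OF car(4) mult_carrier_mat[OF mat_carrier that] mat_carrier])
      ultimately show ?thesis by simp
    qed
    have BDC: "(?B * mat_diag r f * ?C) $$ (j, k) = (\<Sum>l<r. b' l j * f l * c' l k)"
      if "j < n" "k < n" for f j k
      using index_mult_mat_diag_sum[of ?B n r ?C n j k f] that by simp
    show "succeeds_with (
     find_any (\<lambda>Dh. Dh \<in> carrier_mat r r \<and> diagonal_mat Dh \<and> Mi * ?B * Dh * ?C = 1\<^sub>m n) \<rhd> (\<lambda>Dh.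
     find_any (\<lambda>B'. B' \<in> carrier_mat r (r - n) \<and>
       (\<lambda>x. B' *\<^sub>v x) ` carrier_vec (r - n) = mat_kernel (Mi * ?B * Dh)) \<rhd> (\<lambda>B'.
     find_any (\<lambda>A'. A' \<in> carrier_mat r (r - n) \<and>
       A'\<^sup>T * B' = 1\<^sub>m (r - n) \<and> A'\<^sup>T * ?C = 0\<^sub>m (r - n) n) \<rhd> (\<lambda>A'.
     fail_unless (invertible_mat Dh) \<rhd> (\<lambda>_.
     return (\<lambda>i. (append_cols ((Mi * ?B * Dh)\<^sup>T) A')\<^sup>T * mat_inv Dh * mat_diag r (\<lambda>l. w l i) *
       append_cols ?C B')))))) ?post"
    proof (rule succeeds_with_commuting_extension_steps[where f = "\<lambda>i l. w l i",
          OF n car(4) mat_carrier mat_carrier mat_carrier[of r "r - n"] mat_carrier[of "r - n" r] _ U0_def])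
      show "\<delta> l \<noteq> 0" if "l < r" for l using \<beta>[OF that] \<gamma>[OF that] by (simp add: \<delta>_def)
      show "U0 * ?C = 1\<^sub>m n"
      proof (rule eq_matI)
        fix k k' assume "k < dim_row (1\<^sub>m n :: real mat)" "k' < dim_col (1\<^sub>m n :: real mat)"
        then have k: "k < n" "k' < n" by auto
        have "(U0 * ?C) $$ (k, k') = (\<Sum>l<r. U0 $$ (k, l) * ?C $$ (l, k'))"
          using k by (intro index_mult_mat_sum) (auto simp: U0_eq)
        also have "\<dots> = (\<Sum>l<r. hi k l * h l k')"
          by (intro sum.cong refl) (use k in \<open>simp only: C_entry lessThan_iff, simp add: U0_eq\<close>)
        finally show "(U0 * ?C) $$ (k, k') = 1\<^sub>m n $$ (k, k')" using hi_h k n by simp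
      qed (simp_all add: U0_eq)
      show "U0 * ?R2 = 0\<^sub>m n (r - n)"
      proof (rule eq_matI)
        fix k k' assume "k < dim_row (0\<^sub>m n (r - n) :: real mat)" "k' < dim_col (0\<^sub>m n (r - n) :: real mat)"
        then have k: "k < n" "k' < r - n" by auto
        have "(U0 * ?R2) $$ (k, k') = (\<Sum>l<r. hi k l * h l (n + k'))"
          unfolding U0_eq using k by (subst index_mult_mat_sum[of _ n r _ "r - n"]) auto
        then show "(U0 * ?R2) $$ (k, k') = 0\<^sub>m n (r - n) $$ (k, k')" using hi_h[of k "n + k'"] k n by simp
      qed (simp_all add: U0_eq)
      show "?L2 * ?C = 0\<^sub>m (r - n) n"
      proof (rule eq_matI)
        fix k k' assume "k < dim_row (0\<^sub>m (r - n) n :: real mat)" "k' < dim_col (0\<^sub>m (r - n) n :: real mat)"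
        then have k: "k < r - n" "k' < n" by auto
        have "(?L2 * ?C) $$ (k, k') = (\<Sum>l<r. ?L2 $$ (k, l) * ?C $$ (l, k'))"
          using k by (intro index_mult_mat_sum) auto
        also have "\<dots> = (\<Sum>l<r. hi (n + k) l * h l k')"
          by (intro sum.cong refl) (use k in \<open>simp only: C_entry lessThan_iff, simp\<close>)
        finally show "(?L2 * ?C) $$ (k, k') = 0\<^sub>m (r - n) n $$ (k, k')" using hi_h[of "n + k" k'] k n by simp
      qed simp_all
      show "?L2 * ?R2 = 1\<^sub>m (r - n)"
      proof (rule eq_matI)
        fix k k' assume "k < dim_row (1\<^sub>m (r - n) :: real mat)" "k' < dim_col (1\<^sub>m (r - n) :: real mat)"
        then have k: "k < r - n" "k' < r - n" by auto
        have "(?L2 * ?R2) $$ (k, k') = (\<Sum>l<r. hi (n + k) l * h l (n + k'))"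
          using k by (subst index_mult_mat_sum[of _ "r - n" r _ "r - n"]) auto
        then show "(?L2 * ?R2) $$ (k, k') = 1\<^sub>m (r - n) $$ (k, k')"
          using hi_h[of "n + k" "n + k'"] k n by simp
      qed simp_all
      show "?C * U0 + ?R2 * ?L2 = 1\<^sub>m r"
      proof (rule eq_matI)
        fix l l' assume "l < dim_row (1\<^sub>m r :: real mat)" "l' < dim_col (1\<^sub>m r :: real mat)"
        then have l: "l < r" "l' < r" by auto
        have "(?C * U0) $$ (l, l') = (\<Sum>k<n. ?C $$ (l, k) * U0 $$ (k, l'))"
          using l by (intro index_mult_mat_sum) (auto simp: U0_eq)
        also have "\<dots> = (\<Sum>k<n. h l k * hi k l')"
          by (intro sum.cong refl) (use l in \<open>simp only: C_entry lessThan_iff, simp add: U0_eq\<close>)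
        finally have 1: "(?C * U0) $$ (l, l') = (\<Sum>k<n. h l k * hi k l')" .
        have 2: "(?R2 * ?L2) $$ (l, l') = (\<Sum>k<r - n. h l (n + k) * hi (n + k) l')"
          using l by (subst index_mult_mat_sum[of _ r "r - n" _ r]) auto
        have "(?C * U0 + ?R2 * ?L2) $$ (l, l') = (?C * U0) $$ (l, l') + (?R2 * ?L2) $$ (l, l')"
          using l by (intro index_add_mat) auto
        also have "\<dots> = (\<Sum>k<r. h l k * hi k l')"
          unfolding 1 2 using sum_lessThan_add[of "\<lambda>k. h l k * hi k l'" n "r - n"] n by simp
        finally show "(?C * U0 + ?R2 * ?L2) $$ (l, l') = 1\<^sub>m r $$ (l, l')" using h_hi l by simp
      qed (simp_all add: U0_eq)
      show "Dh = mat_diag r \<delta>"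
        if Dh: "Dh \<in> carrier_mat r r" "diagonal_mat Dh" and one: "Mi * ?B * Dh * ?C = 1\<^sub>m n" for Dh
      proof -
        define e where "e l = Dh $$ (l, l)" for l
        have De: "Dh = mat_diag r e"
          using Dh by (intro eq_matI) (auto simp: mat_diag_def e_def diagonal_mat_def)
        have BC: "?B * Dh * ?C \<in> carrier_mat n n" 
          by (rule mult_carrier_mat[OF mult_carrier_mat[OF mat_carrier Dh(1)] mat_carrier])
        have "M = M * (Mi * (?B * Dh * ?C))" using one assoc[OF Dh(1)] car(3) by simp
        also have "\<dots> = M * Mi * (?B * Dh * ?C)" by (rule assoc_mult_mat[OF car(3,4) BC, symmetric])
        also have "\<dots> = ?B * Dh * ?C" unfolding inverse(2) by (rule left_mult_one_mat[OF BC])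
        finally have M_eq: "M = ?B * Dh * ?C" .
        \<comment> \<open>The deviation of a solution from \<open>\<delta>\<close>, indexed in the
          original order so that it becomes the coefficients of a relation among the products
          \<open>b l j * c l k\<close>.\<close>
        define x where "x l = e (inv_into UNIV \<pi> l) * \<beta> (inv_into UNIV \<pi> l) * \<gamma> (inv_into UNIV \<pi> l) - 1" for l
        have x\<pi>: "x (\<pi> l) = e l * \<beta> l * \<gamma> l - 1" for l
          using permutes_inverses(2)[OF \<pi>] by (simp add: x_def)
        have "x l = 0" if "l < r" for l
        proof (rule indep_familyD[OF bc])
          fix z assume "z \<in> {..<n} \<times> {..<n}"
          then obtain j k where z: "z = (j, k)" "j < n" "k < n" by blast
          have "(\<Sum>l<r. x l * (b l j * c l k)) = (\<Sum>l<r. x (\<pi> l) * (b (\<pi> l) j * c (\<pi> l) k))"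
            using sum.permute[OF \<pi>, of "\<lambda>l. x l * (b l j * c l k)"] by (simp add: comp_def)
          also have "\<dots> = (\<Sum>l<r. b' l j * e l * c' l k) - (\<Sum>l<r. b (\<pi> l) j * c (\<pi> l) k)"
            unfolding sum_subtractf[symmetric]
          proof (rule sum.cong[OF refl])
            fix l assume "l \<in> {..<r}"
            then have "b' l j = \<beta> l * b (\<pi> l) j" "c' l k = \<gamma> l * c (\<pi> l) k" using \<beta> \<gamma> by auto
            then show "x (\<pi> l) * (b (\<pi> l) j * c (\<pi> l) k) =
                b' l j * e l * c' l k - b (\<pi> l) j * c (\<pi> l) k"
              by (simp add: x\<pi> left_diff_distrib)
          qed
          also have "(\<Sum>l<r. b (\<pi> l) j * c (\<pi> l) k) = (\<Sum>l<r. b l j * c l k)"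
            using sum.permute[OF \<pi>, of "\<lambda>l. b l j * c l k"] by (simp add: comp_def)
          also have "(\<Sum>l<r. b' l j * e l * c' l k) = M $$ (j, k)"
            using BDC[OF z(2,3), of e] M_eq De by simp
          finally show "(\<Sum>l<r. x l * (\<lambda>(j, k). b l j * c l k) z) = 0" using sum_bc z by simp
        qed (use that in simp)
        then have x0: "x (\<pi> l) = 0" if "l < r" for l using \<pi>r[OF that] by blast
        have "e l = \<delta> l" if "l < r" for l
        proof -
          have "e l * (\<beta> l * \<gamma> l) = 1" using x0[OF that] unfolding x\<pi> by simp
          moreover have "\<beta> l * \<gamma> l \<noteq> 0" using \<beta>[OF that] \<gamma>[OF that] by simp
          ultimately show ?thesis unfolding \<delta>_def by (metis nonzero_eq_divide_eq)
        qed
        then show ?thesis unfolding De by (intro eq_matI) (auto simp: mat_diag_def)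
      qed
      show "Mi * ?B * mat_diag r (\<lambda>l. w l i) * ?C = A i" if i: "i < m" for i
      proof -
        have "?B * mat_diag r (\<lambda>l. w l i) * ?C = M * A i"
        proof (rule eq_matI)
          fix j k assume "j < dim_row (M * A i)" "k < dim_col (M * A i)"
          then have jk: "j < n" "k < n" using car(3) A[OF i] by auto
          have "(\<Sum>l<r. b' l j * w l i * c' l k) = (M * A i) $$ (j, k)"
            using w i jk by (simp only: mult.commute[of "b' _ j"])
          then show "(?B * mat_diag r (\<lambda>l. w l i) * ?C) $$ (j, k) = (M * A i) $$ (j, k)"
            using BDC[OF jk] by simp
        qed (use car(3) A[OF i] in auto)
        then show ?thesis using assoc[OF mat_diag_dim] M_cancel[OF A[OF i]] by simp
      qed
    qed
  qed
qed

subsection \<open>Numerical bounds\<close>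

lemma Max_odd_atMost:
  fixes m q p :: nat
  assumes "19 \<le> m" and q: "q = Max {q. odd q \<and> q \<le> m}" and p: "p = (q - 1) div 2"
  shows "q = 2 * p + 1" "q \<le> m" "m \<le> q + 1" "9 \<le> p"
proof -
  have "Max {q. odd q \<and> q \<le> m} = (if odd m then m else m - 1)"
  proof (rule Max_eqI)
    show "finite {q. odd q \<and> q \<le> m}" by (rule finite_subset[of _ "{..m}"]) auto
    show "y \<le> (if odd m then m else m - 1)" if "y \<in> {q. odd q \<and> q \<le> m}" for y
      using that by (cases "y = m") auto
    show "(if odd m then m else m - 1) \<in> {q. odd q \<and> q \<le> m}" using assms(1) by auto
  qed
  then have "odd q" "q \<le> m" "m \<le> q + 1" using q assms(1) by (auto split: if_splits)
  moreover from this have "q = 2 * p + 1" unfolding p by presburger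
  ultimately show "q = 2 * p + 1" "q \<le> m" "m \<le> q + 1" "9 \<le> p" using assms(1) by auto
qed

text \<open>With \<open>Q = 2 * p + 1\<close> one has \<open>q / (p + 2) = 2 * Q / (Q + 3)\<close>,
  and rounding \<open>n\<close> down to a multiple of \<open>p + 2\<close> costs at most
  \<open>p + 1 = (Q + 1) / 2\<close>. So the first claim follows from
  \<open>r * (Q + 3) \<le> Q * (2 * n - Q - 1)\<close>, which holds as
  \<open>(Q - 4) * (Q + 3) < Q * Q\<close> and the cubic term outweighs the rounding loss.\<close>

lemma rank_bounds:
  fixes n r m q p :: nat
  assumes m: "19 \<le> m" and q: "q = 2 * p + 1" "q \<le> m" "m \<le> q + 1" and p: "9 \<le> p"
    and bound: "real r \<le> 2 * real n * (1 - 4 / (real m - 1)) - real m ^ 3 / 4"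
  shows "r \<le> q * (n div (p + 2))" and "r \<le> 2 * (n - 1)"
proof -
  define Q where "Q = real q"
  have Q: "19 \<le> Q" "real m - 1 \<le> Q" "Q \<le> real m" "real p = (Q - 1) / 2" using q p by (auto simp: Q_def)
  have "4 / Q \<le> 4 / (real m - 1)" using Q m by (intro divide_left_mono) auto
  then have "2 * real n * (1 - 4 / (real m - 1)) \<le> 2 * real n * (1 - 4 / Q)"
    by (intro mult_left_mono) auto
  moreover have cube: "Q ^ 3 \<le> real m ^ 3" using Q by (intro power_mono) auto
  ultimately have r: "real r \<le> 2 * real n * (1 - 4 / Q) - Q ^ 3 / 4" using bound by linarith
  have r2: "real r * Q \<le> 2 * real n * (Q - 4) - Q ^ 4 / 4"
  proof -
    have "real r * Q \<le> (2 * real n * (1 - 4 / Q) - Q ^ 3 / 4) * Q"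
      using r Q by (intro mult_right_mono) auto
    also have "\<dots> = 2 * real n * (Q - 4) - Q ^ 4 / 4" 
    proof -
      have "4 / Q * Q = 4" using Q by simp
      moreover have "Q ^ 3 * Q = Q ^ 4" by (simp add: power4_eq_xxxx power3_eq_cube)
      moreover have "(2 * real n * (1 - 4 / Q) - Q ^ 3 / 4) * Q =
          2 * real n * (Q - 4 / Q * Q) - (Q ^ 3 * Q) / 4"
        by (simp only: left_diff_distrib right_diff_distrib mult_1_right mult_1_left times_divide_eq_left
          mult.assoc mult.commute[of Q])
      ultimately show ?thesis by simp
    qed
    finally show ?thesis .
  qed
  have k1: "real r * (Q + 3) \<le> Q * (2 * real n - Q - 1)"
  proof -
    have "Q * (real r * (Q + 3)) = (real r * Q) * (Q + 3)" by simp
    also have "\<dots> \<le> (2 * real n * (Q - 4) - Q ^ 4 / 4) * (Q + 3)"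
      using r2 Q by (intro mult_right_mono) auto
    also have "\<dots> = 2 * real n * (Q * Q - (Q + 12)) - Q ^ 4 * (Q + 3) / 4"
    proof -
      have "(Q - 4) * (Q + 3) = Q * Q - (Q + 12)" by (simp add: algebra_simps)
      moreover have "(2 * real n * (Q - 4) - Q ^ 4 / 4) * (Q + 3) =
          2 * real n * ((Q - 4) * (Q + 3)) - Q ^ 4 * (Q + 3) / 4"
        by (simp only: left_diff_distrib mult.assoc times_divide_eq_left)
      ultimately show ?thesis by simp
    qed
    also have "\<dots> \<le> 2 * real n * (Q * Q) - (Q ^ 3 + Q ^ 2)"
    proof -
      have "2 * real n * (Q * Q - (Q + 12)) \<le> 2 * real n * (Q * Q)"
        using Q by (intro mult_left_mono) auto
      moreover have "Q ^ 3 + Q ^ 2 \<le> Q ^ 4 * (Q + 3) / 4"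
      proof -
        have "Q ^ 3 \<le> Q ^ 4" "Q ^ 2 \<le> Q ^ 4" using Q by (auto intro: power_increasing)
        moreover have "Q ^ 4 * 8 \<le> Q ^ 4 * (Q + 3)" using Q by (intro mult_left_mono) auto
        ultimately show ?thesis by linarith
      qed
      ultimately show ?thesis by linarith
    qed
    also have "\<dots> = Q * (Q * (2 * real n - Q - 1))"
      by (simp add: right_diff_distrib power2_eq_square power3_eq_cube)
    finally show ?thesis using Q by simp
  qed
  have k2: "2 * real n - Q - 1 \<le> (Q + 3) * real (n div (p + 2))"
  proof -
    have "n = (p + 2) * (n div (p + 2)) + n mod (p + 2)"
      by (rule mult_div_mod_eq[symmetric])
    moreover have "n mod (p + 2) \<le> p + 1" using mod_less_divisor[of "p + 2" n] by linarith
    ultimately have "n \<le> (p + 2) * (n div (p + 2)) + (p + 1)" by linarith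
    then have "real n \<le> real ((p + 2) * (n div (p + 2)) + (p + 1))" by (rule of_nat_mono)
    then have "real n \<le> (real p + 2) * real (n div (p + 2)) + (real p + 1)"
      by (simp only: of_nat_add of_nat_mult of_nat_1 of_nat_numeral)
    moreover have "2 * ((real p + 2) * real (n div (p + 2))) = (Q + 3) * real (n div (p + 2))"
      unfolding mult.assoc[symmetric] using Q(4) by simp
    moreover have "2 * real p = Q - 1" using Q(4) by simp
    moreover have "2 * x - Q - 1 \<le> v" if "x \<le> u + (t + 1)" "2 * u = v" "2 * t = Q - 1" for x u v t :: real
      using that by linarith
    ultimately show ?thesis by blast
  qed
  have "Q * (2 * real n - Q - 1) \<le> Q * ((Q + 3) * real (n div (p + 2)))"
    by (rule mult_left_mono[OF k2]) (use Q in linarith)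
  with k1 have "(Q + 3) * real r \<le> (Q + 3) * (Q * real (n div (p + 2)))"
    by (simp only: mult.left_commute[of Q] mult.commute[of "real r"] order_trans)
  moreover have "0 < Q + 3" using Q(1) by linarith
  ultimately have "real r \<le> Q * real (n div (p + 2))" by (simp only: mult_le_cancel_left_pos)
  then have "real r \<le> real (q * (n div (p + 2)))" by (simp add: Q_def)
  then show "r \<le> q * (n div (p + 2))" by (simp only: of_nat_le_iff)
  \<comment> \<open>The factor \<open>1 - 4 / Q\<close> is at most \<open>1\<close>, and the cubic
    term, at least \<open>19 ^ 3 / 4\<close>, covers the required \<open>2\<close>.\<close>
  have "2 * real n * (1 - 4 / Q) \<le> 2 * real n * 1" using Q by (intro mult_left_mono) auto
  moreover have "19 ^ 3 \<le> Q ^ 3" using Q by (intro power_mono) auto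
  ultimately have "real r \<le> 2 * real n - 2" using r by simp
  then have "real (r + 2) \<le> real (2 * n)" by simp
  then have "r + 2 \<le> 2 * n" by (simp only: of_nat_le_iff)
  then show "r \<le> 2 * (n - 1)" by simp
qed

subsection \<open>Generic factors\<close>

datatype factor_entry = A_entry nat nat | B_entry nat nat | C_entry nat nat

definition factor_entries :: "nat \<Rightarrow> nat \<Rightarrow> nat \<Rightarrow> factor_entry set" where
  "factor_entries m n r = {A_entry l i | l i. l < r \<and> i < m} \<union>
     {B_entry l j | l j. l < r \<and> j < n} \<union> {C_entry l k | l k. l < r \<and> k < n}"

definition first_factor :: "(factor_entry \<Rightarrow> real) \<Rightarrow> nat \<Rightarrow> nat \<Rightarrow> real" where
  "first_factor y l i = y (A_entry l i)"

definition truncated_first_factor :: "nat \<Rightarrow> (factor_entry \<Rightarrow> real) \<Rightarrow> nat \<Rightarrow> nat \<Rightarrow> real" where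
  "truncated_first_factor p y l i = (if i < p + 1 then y (A_entry l i) else 0)"

text \<open>Padded by zeros from \<open>n\<close> on, to match the vectors of
  \<open>koszul_space\<close>, which vanish there.\<close>

definition second_factor :: "nat \<Rightarrow> (factor_entry \<Rightarrow> real) \<Rightarrow> nat \<Rightarrow> nat \<Rightarrow> real" where
  "second_factor n y l j = (if j < n then y (B_entry l j) else 0)"

definition third_factor :: "nat \<Rightarrow> (factor_entry \<Rightarrow> real) \<Rightarrow> nat \<Rightarrow> nat \<Rightarrow> real" where
  "third_factor n y l k = (if k < n then y (C_entry l k) else 0)"

lemma polynomial_in_factors:
  assumes "l < r"
  shows "i < m \<Longrightarrow> polynomial_in (factor_entries m n r) (\<lambda>y. first_factor y l i)"
    and "p + 1 \<le> m \<Longrightarrow> polynomial_in (factor_entries m n r) (\<lambda>y. truncated_first_factor p y l i)"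
    and "polynomial_in (factor_entries m n r) (\<lambda>y. second_factor n y l i)"
    and "polynomial_in (factor_entries m n r) (\<lambda>y. third_factor n y l i)"
  using assms
  unfolding first_factor_def truncated_first_factor_def second_factor_def third_factor_def
  by (auto intro!: polynomial_in_if polynomial_in.var polynomial_in.const simp: factor_entries_def)

lemma polynomial_in_koszul_coeff:
  assumes "l < r" and "q \<le> m"
  shows "polynomial_in (factor_entries m n r) (\<lambda>y. koszul_coeff q (first_factor y l) U S)"
  unfolding koszul_coeff_def
  using assms by (intro polynomial_in_intros polynomial_in_factors) auto

definition generic_pair ::
  "nat \<Rightarrow> nat \<Rightarrow> nat \<Rightarrow> nat \<Rightarrow> (factor_entry \<Rightarrow> real) \<Rightarrow> (nat \<Rightarrow> nat \<Rightarrow> real) \<Rightarrow> bool" where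
  "generic_pair p q n r y e \<longleftrightarrow>
     exterior_independent p q n r (first_factor y) e \<and>
     interior_independent p q n r (first_factor y) e \<and>
     indep_family (strict_pairs r) UNIV (wedge_product (truncated_first_factor p y) e)"

definition generic_factors :: "nat \<Rightarrow> nat \<Rightarrow> nat \<Rightarrow> nat \<Rightarrow> (factor_entry \<Rightarrow> real) \<Rightarrow> bool" where
  "generic_factors p q n r y \<longleftrightarrow>
     (\<forall>l\<in>{..<r}. first_factor y l 0 \<noteq> 0) \<and>
     generic_pair p q n r y (second_factor n y) \<and> generic_pair p q n r y (third_factor n y) \<and>
     indep_family {..<r} ({..<n} \<times> {..<n}) (\<lambda>l (j, k). second_factor n y l j * third_factor n y l k)"

text \<open>\<open>e\<close> stands for the second or the third factor; \<open>surj\<close> lets its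
  values be prescribed independently of the first factors, as the witnesses demand.\<close>

lemma generically_generic_pair:
  fixes e :: "(factor_entry \<Rightarrow> real) \<Rightarrow> nat \<Rightarrow> nat \<Rightarrow> real"
  assumes q: "q = 2 * p + 1" "q \<le> m" "3 \<le> p"
    and r: "r \<le> q * (n div (p + 2))" "r \<le> 2 * (n - 1)"
    and poly: "\<And>l j. l < r \<Longrightarrow> polynomial_in (factor_entries m n r) (\<lambda>y. e y l j)"
    and surj: "\<And>u v. \<exists>y. (\<forall>l i. y (A_entry l i) = u l i) \<and> (\<forall>l j. j < n \<longrightarrow> e y l j = v l j)"
  shows "generically (factor_entries m n r) (\<lambda>y. generic_pair p q n r y (e y))"
  unfolding generic_pair_def
proof (intro generically_conj)
  let ?g = "n div (p + 2)" and ?V = "factor_entries m n r"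
  have g: "(p + 2) * ?g \<le> n" by (rule times_div_less_eq_dividend)
  obtain y where y: "\<And>l i. y (A_entry l i) = (if i = 0 \<or> i = l mod q then 1 else 0)"
    "\<And>l j. j < n \<Longrightarrow> e y l j = real l ^ j"
    using surj[of "\<lambda>l i. if i = 0 \<or> i = l mod q then 1 else 0" "\<lambda>l j. real l ^ j"] by blast
  have ext: "exterior_independent p q n r (first_factor y) (e y)"
    using y g q by (intro exterior_independent_witness[OF _ _ r(1)]) (auto simp: first_factor_def)
  have int: "interior_independent p q n r (first_factor y) (e y)"
    using y g q by (intro interior_independent_witness[OF _ _ r(1)]) (auto simp: first_factor_def)
  show "generically ?V (\<lambda>y. exterior_independent p q n r (first_factor y) (e y))"
    unfolding exterior_independent_def
  proof (rule generically_indep_family[where ?x0.0 = y])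
    show "indep_family ({..<r} \<times> {S \<in> subsets_of_size q p. 0 \<notin> S})
        (subsets_of_size q (p + 1) \<times> {..<n})
        (\<lambda>(l, S) (U, k). koszul_coeff q (first_factor y l) U S * e y l k)"
      using ext unfolding exterior_independent_def .
    fix i j assume "i \<in> {..<r} \<times> {S \<in> subsets_of_size q p. 0 \<notin> S}"
    then show "polynomial_in ?V (\<lambda>y. (\<lambda>(l, S) (U, k).
        koszul_coeff q (first_factor y l) U S * e y l k) i j)"
      using q by (cases i; cases j) (auto intro!: polynomial_in.mult polynomial_in_koszul_coeff poly)
  qed simp
  show "generically ?V (\<lambda>y. interior_independent p q n r (first_factor y) (e y))"
    unfolding interior_independent_def
  proof (rule generically_indep_family[where ?x0.0 = y])
    show "indep_family ({..<r} \<times> {U \<in> subsets_of_size q (p + 1). 0 \<in> U \<and> U \<noteq> {..<p + 1}})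
        ({S \<in> subsets_of_size q p. \<not> S \<subseteq> {..<p + 1}} \<times> {..<n})
        (\<lambda>(l, U) (S, k). koszul_coeff q (first_factor y l) U S * e y l k)"
      using int unfolding interior_independent_def .
    fix i j assume "i \<in> {..<r} \<times> {U \<in> subsets_of_size q (p + 1). 0 \<in> U \<and> U \<noteq> {..<p + 1}}"
    then show "polynomial_in ?V (\<lambda>y. (\<lambda>(l, U) (S, k).
        koszul_coeff q (first_factor y l) U S * e y l k) i j)"
      using q by (cases i; cases j) (auto intro!: polynomial_in.mult polynomial_in_koszul_coeff poly)
  qed simp
  \<comment> \<open>At the previous point first factors with equal residues coincide and their wedge
    vanishes, so the wedge condition is witnessed at a point of its own.\<close>
  obtain y' where y': "\<And>l i. y' (A_entry l i) = real l ^ i"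
    "\<And>l j. j < n \<Longrightarrow> e y' l j = (if j = l div 2 \<or> odd l \<and> j = l div 2 + 1 then 1 else 0)"
    using surj[of "\<lambda>l i. real l ^ i"
      "\<lambda>l j. if j = l div 2 \<or> odd l \<and> j = l div 2 + 1 then 1 else 0"] by blast
  have wedge: "indep_family (strict_pairs r) UNIV (wedge_product (truncated_first_factor p y') (e y'))"
    using y' q by (intro wedge_product_witness[OF _ _ r(2)]) (auto simp: truncated_first_factor_def)
  show "generically ?V (\<lambda>y. indep_family (strict_pairs r) UNIV
      (wedge_product (truncated_first_factor p y) (e y)))"
  proof (rule generically_indep_family[where ?x0.0 = y'])
    show "indep_family (strict_pairs r) UNIV (wedge_product (truncated_first_factor p y') (e y'))"
      by (rule wedge)
    fix x and z :: "(nat \<times> nat) \<times> nat \<times> nat" assume x: "x \<in> strict_pairs r"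
    obtain l l' where l: "x = (l, l')" by (cases x)
    obtain i i' j j' where z: "z = ((i, i'), (j, j'))" by (metis surj_pair)
    have "l < r" "l' < r" using x l by auto
    then show "polynomial_in ?V (\<lambda>y. wedge_product (truncated_first_factor p y) (e y) x z)"
      unfolding wedge_product_def l z prod.case using q
      by (intro polynomial_in.mult polynomial_in_diff poly polynomial_in_factors(2)) auto
  qed simp
qed

lemma generically_generic_factors:
  assumes q: "q = 2 * p + 1" "q \<le> m" "3 \<le> p" and n: "3 \<le> n"
    and r: "r \<le> q * (n div (p + 2))" "r \<le> 2 * (n - 1)"
  shows "generically (factor_entries m n r) (generic_factors p q n r)"
proof -
  let ?V = "factor_entries m n r"
  let ?point = "\<lambda>u v w x. case x of A_entry l i \<Rightarrow> u l i | B_entry l j \<Rightarrow> v l j | C_entry l k \<Rightarrow> w l k"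
  have "generically ?V (\<lambda>y. \<forall>l\<in>{..<r}. first_factor y l 0 \<noteq> 0)"
  proof (rule generically_ball)
    fix l assume "l \<in> {..<r}"
    then show "generically ?V (\<lambda>y. first_factor y l 0 \<noteq> 0)"
      using q by (intro generically_nonzero[where x = "\<lambda>_. 1"] polynomial_in_factors)
        (auto simp: first_factor_def)
  qed simp
  moreover have "generically ?V (\<lambda>y. generic_pair p q n r y (second_factor n y))"
  proof (rule generically_generic_pair[OF q r])
    show "\<exists>y. (\<forall>l i. y (A_entry l i) = u l i) \<and> (\<forall>l j. j < n \<longrightarrow> second_factor n y l j = v l j)" for u v
      by (intro exI[of _ "?point u v v"]) (simp add: second_factor_def)
  qed (rule polynomial_in_factors)
  moreover have "generically ?V (\<lambda>y. generic_pair p q n r y (third_factor n y))"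
  proof (rule generically_generic_pair[OF q r])
    show "\<exists>y. (\<forall>l i. y (A_entry l i) = u l i) \<and> (\<forall>l j. j < n \<longrightarrow> third_factor n y l j = v l j)" for u v
      by (intro exI[of _ "?point u v v"]) (simp add: third_factor_def)
  qed (rule polynomial_in_factors)
  moreover have "generically ?V (\<lambda>y. indep_family {..<r} ({..<n} \<times> {..<n})
      (\<lambda>l (j, k). second_factor n y l j * third_factor n y l k))"
  proof (rule generically_indep_family)
    let ?y = "?point (\<lambda>_ _. 0) (\<lambda>l j. if j = l mod n then 1 else 0) (\<lambda>l k. if k = l div n then 1 else 0)"
    \<comment> \<open>There are enough matrix units for \<open>r\<close> products.\<close>
    have "2 * (n - 1) \<le> n * n" using n by (intro mult_le_mono) auto
    then show "indep_family {..<r} ({..<n} \<times> {..<n})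
        (\<lambda>l (j, k). second_factor n ?y l j * third_factor n ?y l k)"
      using n r by (intro indep_family_basis_products) (auto simp: second_factor_def third_factor_def)
    fix l x assume "l \<in> {..<r}"
    then show "polynomial_in ?V (\<lambda>y. (\<lambda>(j, k). second_factor n y l j * third_factor n y l k) x)"
      by (cases x) (auto intro!: polynomial_in.mult polynomial_in_factors)
  qed simp
  ultimately show ?thesis
    unfolding generic_factors_def by (intro generically_conj)
qed

subsection \<open>From the parameters to the factors\<close>

definition R_mat :: "nat \<Rightarrow> (parameter \<Rightarrow> real) \<Rightarrow> real mat" where
  "R_mat r x = mat r r (\<lambda>(i, j). x (R_entry i j))"

definition M_mat :: "nat \<Rightarrow> (parameter \<Rightarrow> real) \<Rightarrow> real mat" where
  "M_mat n x = mat n n (\<lambda>(i, j). x (M_entry i j))"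

text \<open>The factors of the tensor with slices \<open>M A\<^sub>i\<close>, multiplied by \<open>det R\<close> to make them polynomial.\<close>

definition factor_num :: "nat \<Rightarrow> nat \<Rightarrow> (parameter \<Rightarrow> real) \<Rightarrow> factor_entry \<Rightarrow> real" where
  "factor_num n r x w = (case w of
     A_entry l i \<Rightarrow> det (R_mat r x) * x (D_entry i l)
   | B_entry l j \<Rightarrow> (\<Sum>t<n. x (M_entry j t) * adj_mat (R_mat r x) $$ (t, l))
   | C_entry l k \<Rightarrow> det (R_mat r x) * x (R_entry l k))"

lemma polynomial_in_det_R: "polynomial_in (parameters m n r) (\<lambda>x. det (R_mat r x))"
  by (rule polynomial_in_det[of r])
    (auto simp: R_mat_def parameters_def intro!: polynomial_in.var)

lemma polynomial_in_det_M: "polynomial_in (parameters m n r) (\<lambda>x. det (M_mat n x))"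
  by (rule polynomial_in_det[of n])
    (auto simp: M_mat_def parameters_def intro!: polynomial_in.var)

lemma polynomial_in_adj_R:
  assumes "i < r" "j < r"
  shows "polynomial_in (parameters m n r) (\<lambda>x. adj_mat (R_mat r x) $$ (i, j))"
proof -
  have "polynomial_in (parameters m n r) (\<lambda>x. (-1) ^ (j + i) * det (mat_delete (R_mat r x) j i))"
  proof (intro polynomial_in.mult polynomial_in.const polynomial_in_det[of "r - 1"])
    fix k l assume "k < r - 1" "l < r - 1"
    then show "polynomial_in (parameters m n r) (\<lambda>x. mat_delete (R_mat r x) j i $$ (k, l))"
      by (auto simp: mat_delete_def R_mat_def parameters_def intro!: polynomial_in.var)
  qed (simp add: mat_delete_def R_mat_def)
  moreover have "adj_mat (R_mat r x) $$ (i, j) = (-1) ^ (j + i) * det (mat_delete (R_mat r x) j i)" for x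
    using assms by (simp add: adj_mat_def cofactor_def R_mat_def)
  ultimately show ?thesis by simp
qed

lemma polynomial_in_factor_num:
  assumes "n \<le> r" and "w \<in> factor_entries m n r"
  shows "polynomial_in (parameters m n r) (\<lambda>x. factor_num n r x w)"
proof (cases w)
  case (A_entry l i)
  then show ?thesis using assms unfolding factor_num_def A_entry factor_entry.case
    by (intro polynomial_in.mult polynomial_in_det_R polynomial_in.var)
      (auto simp: factor_entries_def parameters_def)
next
  case (B_entry l j)
  then show ?thesis using assms unfolding factor_num_def B_entry factor_entry.case
    by (intro polynomial_in_sum polynomial_in.mult polynomial_in_adj_R polynomial_in.var)
      (auto simp: factor_entries_def parameters_def)
next
  case (C_entry l k)
  then show ?thesis using assms unfolding factor_num_def C_entry factor_entry.case
    by (intro polynomial_in.mult polynomial_in_det_R polynomial_in.var)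
      (auto simp: factor_entries_def parameters_def)
qed

lemma right_inverse_adj_mat:
  fixes A :: "real mat"
  assumes A: "A \<in> carrier_mat k k" and det: "det A \<noteq> 0"
  shows "A * (1 / det A \<cdot>\<^sub>m adj_mat A) = 1\<^sub>m k"
proof -
  have "A * (1 / det A \<cdot>\<^sub>m adj_mat A) = 1 / det A \<cdot>\<^sub>m (A * adj_mat A)"
    using adj_mat(1)[OF A] A by (intro mult_smult_distrib) auto
  also have "\<dots> = 1\<^sub>m k" using det unfolding adj_mat(2)[OF A] by (intro eq_matI) auto
  finally show ?thesis .
qed

text \<open>If \<open>B C\<close> is invertible, \<open>R\<close> is completed from \<open>C\<close> by a basis of the
  kernel of \<open>B\<close>, which is explicit as soon as the first \<open>n\<close> columns of \<open>B\<close> are independent.\<close>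

lemma factor_num_dominant:
  assumes n: "n \<le> r" and Q: "generically (factor_entries m n r) Q"
  shows "\<exists>x y. det (R_mat r x) \<noteq> 0 \<and> Q y \<and>
    (\<forall>w\<in>factor_entries m n r. factor_num n r x w / det (R_mat r x) = y w)"
proof -
  let ?V = "factor_entries m n r"
  define B1 where "B1 y = mat n n (\<lambda>(j, l). y (B_entry l j))" for y :: "factor_entry \<Rightarrow> real"
  define G where "G y = mat n n (\<lambda>(j, k). \<Sum>l<r. y (B_entry l j) * y (C_entry l k))"
    for y :: "factor_entry \<Rightarrow> real"
  let ?y0 = "\<lambda>w. case w of A_entry l i \<Rightarrow> 0 | B_entry l j \<Rightarrow> if l = j then 1 else 0
    | C_entry l k \<Rightarrow> if l = k then 1 else (0 :: real)"
  have "B1 ?y0 = 1\<^sub>m n" by (intro eq_matI) (auto simp: B1_def)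
  then have "generically ?V (\<lambda>y. det (B1 y) \<noteq> 0)"
    using n by (intro generically_nonzero[where x = ?y0] polynomial_in_det[of n])
      (auto simp: B1_def factor_entries_def intro!: polynomial_in.var)
  moreover have "G ?y0 = 1\<^sub>m n"
  proof (rule eq_matI)
    fix j k assume "j < dim_row (1\<^sub>m n :: real mat)" "k < dim_col (1\<^sub>m n :: real mat)"
    then have jk: "j < n" "k < n" by auto
    have "(\<Sum>l<r. ?y0 (B_entry l j) * ?y0 (C_entry l k)) =
        (\<Sum>l<r. if l = j then (if j = k then 1 else 0) else 0)"
      by (intro sum.cong) auto
    then show "G ?y0 $$ (j, k) = 1\<^sub>m n $$ (j, k)" using jk n by (simp add: G_def)
  qed (simp_all add: G_def)
  then have "generically ?V (\<lambda>y. det (G y) \<noteq> 0)"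
    by (intro generically_nonzero[where x = ?y0] polynomial_in_det[of n])
      (auto simp: G_def factor_entries_def intro!: polynomial_in_sum polynomial_in.mult polynomial_in.var)
  \<comment> \<open>Both determinants are nonzero at \<open>?y0\<close>, so their nonvanishing can
    be required together with \<open>Q\<close>.\<close>
  ultimately have "generically ?V (\<lambda>y. Q y \<and> det (B1 y) \<noteq> 0 \<and> det (G y) \<noteq> 0)"
    using Q by (intro generically_conj)
  then obtain y where y: "Q y" "det (B1 y) \<noteq> 0" "det (G y) \<noteq> 0" using generically_point by blast
  define s where "s = r - n"
  have r: "r = n + s" using n by (simp add: s_def)
  define B2 where "B2 = mat n s (\<lambda>(j, l). y (B_entry (n + l) j))"
  define C1 where "C1 = mat n n (\<lambda>(l, k). y (C_entry l k))"
  define C2 where "C2 = mat s n (\<lambda>(l, k). y (C_entry (n + l) k))"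
  define B1i where "B1i = 1 / det (B1 y) \<cdot>\<^sub>m adj_mat (B1 y)"
  have car: "B1 y \<in> carrier_mat n n" "B2 \<in> carrier_mat n s" "C1 \<in> carrier_mat n n" "C2 \<in> carrier_mat s n"
    "G y \<in> carrier_mat n n" by (auto simp: B1_def B2_def C1_def C2_def G_def)
  have B1i: "B1i \<in> carrier_mat n n" "B1 y * B1i = 1\<^sub>m n"
    using adj_mat(1)[OF car(1)] right_inverse_adj_mat[OF car(1) y(2)] by (auto simp: B1i_def)
  \<comment> \<open>The last \<open>s\<close> columns are a basis of the kernel of
    \<open>(B1 | B2)\<close>. Multiplying by \<open>H\<close>, which is \<open>(B1 | B2)\<close>
    over \<open>(0 | 1)\<close>, gives the block triangular \<open>K\<close> with diagonal blocks
    \<open>G y\<close> and the identity, whence \<open>det R \<noteq> 0\<close>.\<close>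
  define R where "R = four_block_mat C1 (- (B1i * B2)) C2 (1\<^sub>m s)"
  define H where "H = four_block_mat (B1 y) B2 (0\<^sub>m s n) (1\<^sub>m s)"
  define K where "K = four_block_mat (G y) (0\<^sub>m n s) C2 (1\<^sub>m s)"
  have Rc: "R \<in> carrier_mat r r" and Hc: "H \<in> carrier_mat r r" and Kc: "K \<in> carrier_mat r r"
    using car B1i unfolding R_def H_def K_def r by (auto intro!: four_block_carrier_mat)
  have "H * R = K"
  proof -
    have "H * R = four_block_mat (B1 y * C1 + B2 * C2) (B1 y * - (B1i * B2) + B2 * 1\<^sub>m s)
        (0\<^sub>m s n * C1 + 1\<^sub>m s * C2) (0\<^sub>m s n * - (B1i * B2) + 1\<^sub>m s * 1\<^sub>m s)"
      unfolding H_def R_def using car B1i by (intro mult_four_block_mat) auto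
    also have "B1 y * C1 + B2 * C2 = G y"
    proof (rule eq_matI)
      fix j k assume "j < dim_row (G y)" "k < dim_col (G y)"
      then have jk: "j < n" "k < n" using car by auto
      have "(B1 y * C1 + B2 * C2) $$ (j, k) = (B1 y * C1) $$ (j, k) + (B2 * C2) $$ (j, k)"
        using jk car by (intro index_add_mat) auto
      also have "(B1 y * C1) $$ (j, k) = (\<Sum>l<n. y (B_entry l j) * y (C_entry l k))"
        using jk car by (subst index_mult_mat_sum[of _ n n _ n]) (auto simp: B1_def C1_def)
      also have "(B2 * C2) $$ (j, k) = (\<Sum>l<s. y (B_entry (n + l) j) * y (C_entry (n + l) k))"
        using jk car by (subst index_mult_mat_sum[of _ n s _ n]) (auto simp: B2_def C2_def)
      finally show "(B1 y * C1 + B2 * C2) $$ (j, k) = G y $$ (j, k)"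
        using jk by (simp add: G_def r sum_lessThan_add)
    qed (use car in auto)
    also have "B1 y * - (B1i * B2) + B2 * 1\<^sub>m s = 0\<^sub>m n s"
    proof -
      have "B1 y * (B1i * B2) = B2"
        using assoc_mult_mat[OF car(1) B1i(1) car(2)] B1i(2) car(2) by simp
      then have "B1 y * - (B1i * B2) = - B2"
        using car(1) carrier_matD[OF mult_carrier_mat[OF B1i(1) car(2)]]
        by (subst uminus_mult_right_mat) auto
      then show ?thesis using car(2) by (intro eq_matI) auto
    qed
    also have "0\<^sub>m s n * C1 + 1\<^sub>m s * C2 = C2" using car by (intro eq_matI) auto
    also have "0\<^sub>m s n * - (B1i * B2) + 1\<^sub>m s * 1\<^sub>m s = 1\<^sub>m s"
      using left_mult_zero_mat[of "- (B1i * B2)" n s] mult_carrier_mat[OF B1i(1) car(2)] by simp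
    finally show ?thesis unfolding K_def .
  qed
  have "det K = det (G y) * det (1\<^sub>m s)"
    unfolding K_def using car by (intro det_four_block_mat_upper_right_zero) auto
  then have "det H * det R \<noteq> 0" using y(3) det_mult[OF Hc Rc] \<open>H * R = K\<close> by simp
  then have detR: "det R \<noteq> 0" by simp
  \<comment> \<open>\<open>M\<close> has to be \<open>G y\<close>, the product of the matrices of
    second and third factors.\<close>
  define x where "x v = (case v of R_entry i j \<Rightarrow> R $$ (i, j) | M_entry i j \<Rightarrow> G y $$ (i, j)
    | D_entry i l \<Rightarrow> y (A_entry l i))" for v
  have R_x: "R_mat r x = R" using Rc by (intro eq_matI) (auto simp: R_mat_def x_def)
  define Ri where "Ri = 1 / det R \<cdot>\<^sub>m adj_mat R"
  have Ric: "Ri \<in> carrier_mat r r" unfolding Ri_def using adj_mat(1)[OF Rc] by simp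
  \<comment> \<open>Its upper \<open>n\<close> rows say that the second factors are
    \<open>G y\<close> times the first \<open>n\<close> rows of \<open>Ri\<close>, as
    required.\<close>
  have H_eq: "H = K * Ri"
  proof -
    have "H = H * (R * Ri)" using right_inverse_adj_mat[OF Rc detR] Hc by (simp add: Ri_def)
    also have "\<dots> = K * Ri" using assoc_mult_mat[OF Hc Rc Ric] \<open>H * R = K\<close> by simp
    finally show ?thesis .
  qed
  have "factor_num n r x w / det (R_mat r x) = y w" if "w \<in> ?V" for w
  proof (cases w)
    case (A_entry l i)
    then show ?thesis using detR by (simp add: factor_num_def R_x x_def)
  next
    case (B_entry l j)
    then have lj: "l < r" "j < n" using that by (auto simp: factor_entries_def)
    have "y w = H $$ (j, l)"
      using lj car by (auto simp: H_def B1_def B2_def B_entry r)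
    also have "\<dots> = (\<Sum>t<r. K $$ (j, t) * Ri $$ (t, l))"
      unfolding H_eq using lj n by (intro index_mult_mat_sum[OF Kc Ric]) auto
    also have "\<dots> = (\<Sum>t<n. G y $$ (j, t) * Ri $$ (t, l))"
      unfolding r sum_lessThan_add using lj car by (auto simp: K_def intro!: sum.cong)
    also have "\<dots> = factor_num n r x w / det (R_mat r x)"
      unfolding factor_num_def B_entry factor_entry.case R_x sum_divide_distrib
      using lj n adj_mat(1)[OF Rc] by (intro sum.cong) (auto simp: x_def Ri_def)
    finally show ?thesis by simp
  next
    case (C_entry l k)
    then have lk: "l < r" "k < n" using that by (auto simp: factor_entries_def)
    have "R $$ (l, k) = y (C_entry l k)"
      using lk car B1i by (auto simp: R_def C1_def C2_def r)
    then show ?thesis using detR by (simp add: factor_num_def R_x x_def C_entry)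
  qed
  then show ?thesis using y(1) detR R_x by blast
qed

theorem theoremB3:
  fixes n r m :: nat
  assumes "3 \<le> n" and "n \<le> r" and "19 \<le> m"
    and "real r \<le> 2 * real n * (1 - 4 / (real m - 1)) - real m ^ 3 / 4"
  shows "generically (parameters m n r) (\<lambda>x.
    let R = mat r r (\<lambda>(i, j). x (R_entry i j));
        M = mat n n (\<lambda>(i, j). x (M_entry i j));
        D = (\<lambda>i. mat_diag r (\<lambda>j. x (D_entry i j)));
        Z = (\<lambda>i. mat_inv R * D i * R);
        A = (\<lambda>i. upper_left n (Z i));
        outcomes = commuting_extension m n A r M
    in invertible_mat R \<and> invertible_mat M \<and> outcomes \<noteq> {} \<and>
       (\<forall>out\<in>outcomes. \<exists>Zt. out = Some Zt \<and>
          (\<forall>i<m. Zt i \<in> carrier_mat r r) \<and>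
          (\<forall>i<m. \<forall>j<m. Zt i * Zt j = Zt j * Zt i) \<and>
          (\<forall>i<m. upper_left n (Zt i) = A i)))"
    (is "generically _ ?P")
proof -
  define q where "q = Max {q. odd q \<and> q \<le> m}"
  define p where "p = (q - 1) div 2"
  note pq = Max_odd_atMost[OF assms(3) q_def p_def]
  note bounds = rank_bounds[OF assms(3) pq assms(4)]
  let ?y = "\<lambda>x w. factor_num n r x w / det (R_mat r x)"
  have "generically (factor_entries m n r) (generic_factors p q n r)"
    using pq bounds assms(1) by (intro generically_generic_factors) auto
  then have "generically (parameters m n r) (\<lambda>x. det (R_mat r x) \<noteq> 0 \<and> generic_factors p q n r (?y x))"
    by (rule generically_rational_substitution[where V = "parameters m n r" and num = "factor_num n r"
        and den = "\<lambda>x. det (R_mat r x)", OF _ polynomial_in_factor_num[OF assms(2)] polynomial_in_det_R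
          factor_num_dominant[OF assms(2)]])
  moreover have "generically (parameters m n r) (\<lambda>x. det (M_mat n x) \<noteq> 0)"
  proof (rule generically_nonzero[OF polynomial_in_det_M])
    have "M_mat n (\<lambda>v. case v of M_entry i j \<Rightarrow> if i = j then 1 else 0 | _ \<Rightarrow> 0) = 1\<^sub>m n"
      by (intro eq_matI) (auto simp: M_mat_def)
    then show "det (M_mat n (\<lambda>v. case v of M_entry i j \<Rightarrow> if i = j then 1 else 0 | _ \<Rightarrow> 0)) \<noteq> 0" by simp
  qed
  ultimately have "generically (parameters m n r) (\<lambda>x.
      (det (R_mat r x) \<noteq> 0 \<and> generic_factors p q n r (?y x)) \<and> det (M_mat n x) \<noteq> 0)"
    by (rule generically_conj)
  then show ?thesis
  proof (rule generically_mono)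
    fix x
    assume x: "(det (R_mat r x) \<noteq> 0 \<and> generic_factors p q n r (?y x)) \<and> det (M_mat n x) \<noteq> 0"
    define R where "R = R_mat r x"
    define M where "M = M_mat n x"
    define Ri where "Ri = 1 / det R \<cdot>\<^sub>m adj_mat R"
    define Mi where "Mi = 1 / det M \<cdot>\<^sub>m adj_mat M"
    define A where "A i = upper_left n (mat_inv R * mat_diag r (\<lambda>j. x (D_entry i j)) * R)" for i
    define a where "a = first_factor (?y x)"
    define b where "b = second_factor n (?y x)"
    define c where "c = third_factor n (?y x)"
    have Rc: "R \<in> carrier_mat r r" and Mc: "M \<in> carrier_mat n n" by (auto simp: R_def R_mat_def M_def M_mat_def)
    have det: "det R \<noteq> 0" "det M \<noteq> 0" using x by (auto simp: R_def M_def)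
    have Ric: "Ri \<in> carrier_mat r r" and Mic: "Mi \<in> carrier_mat n n"
      unfolding Ri_def Mi_def using adj_mat(1)[OF Rc] adj_mat(1)[OF Mc] by auto
    have RRi: "R * Ri = 1\<^sub>m r" and MMi: "M * Mi = 1\<^sub>m n"
      unfolding Ri_def Mi_def using right_inverse_adj_mat[OF Rc det(1)] right_inverse_adj_mat[OF Mc det(2)] by auto
    have inv: "mat_inv R = Ri" by (rule mat_inv_eqI[OF Rc Ric RRi])
    have a_eq: "a l i = x (D_entry i l)" for l i
      using det by (simp add: a_def first_factor_def factor_num_def R_def)
    have b_eq: "b l j = (\<Sum>t<n. M $$ (j, t) * Ri $$ (t, l))" if "l < r" "j < n" for l j
      using that assms(2) adj_mat(1)[OF Rc]
      by (auto simp: b_def second_factor_def factor_num_def R_def[symmetric] Ri_def M_def M_mat_def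
          sum_divide_distrib intro!: sum.cong)
    have c_eq: "c l k = R $$ (l, k)" if "l < r" "k < n" for l k
      using that det assms(2) by (simp add: c_def third_factor_def factor_num_def R_def R_mat_def)
    have gen: "generic_factors p q n r (?y x)" using x by blast
    have Ac: "A i \<in> carrier_mat n n" for i by (simp add: A_def upper_left_def)
    \<comment> \<open>\<open>A i\<close> uses only the first \<open>n\<close> rows of
      \<open>Ri\<close> and the first \<open>n\<close> columns of \<open>R\<close>, so each slice is
      a sum of \<open>r\<close> rank-one matrices weighted by the diagonal of the
      \<open>i\<close>-th diagonal matrix.\<close>
    have T: "(M * A i) $$ (j, k) = (\<Sum>l<r. a l i * b l j * c l k)"
      if "i < m" "j < n" "k < n" for i j k
    proof -
      have "A i $$ (t, k) = (\<Sum>l<r. Ri $$ (t, l) * x (D_entry i l) * R $$ (l, k))" if "t < n" for t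
        unfolding A_def upper_left_def inv using that \<open>k < n\<close> assms(2)
        by (simp add: index_mult_mat_diag_sum[OF Ric Rc] del: index_mult_mat)
      then have "(M * A i) $$ (j, k) =
          (\<Sum>t<n. \<Sum>l<r. M $$ (j, t) * (Ri $$ (t, l) * x (D_entry i l) * R $$ (l, k)))"
        unfolding index_mult_mat_sum[OF Mc Ac that(2,3)] by (simp add: sum_distrib_left)
      also have "\<dots> = (\<Sum>l<r. \<Sum>t<n. M $$ (j, t) * (Ri $$ (t, l) * x (D_entry i l) * R $$ (l, k)))"
        by (rule sum.swap)
      also have "\<dots> = (\<Sum>l<r. a l i * b l j * c l k)"
      proof (rule sum.cong[OF refl])
        fix l assume "l \<in> {..<r}"
        then have l: "l < r" by simp
        show "(\<Sum>t<n. M $$ (j, t) * (Ri $$ (t, l) * x (D_entry i l) * R $$ (l, k))) = a l i * b l j * c l k"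
          unfolding a_eq b_eq[OF l that(2)] c_eq[OF l that(3)] sum_distrib_left sum_distrib_right
          by (intro sum.cong refl) (simp only: mult_ac)
      qed
      finally show ?thesis .
    qed
    have "succeeds_with (tensor_decomposition m n n (\<lambda>i j k. (M * A i) $$ (j, k)) p q r) (\<lambda>(w, b', c').
        \<exists>\<pi>. \<pi> permutes {..<r} \<and> rescaled r \<pi> b' b \<and> rescaled r \<pi> c' c \<and>
          (\<forall>i<m. \<forall>j<n. \<forall>k<n. (\<Sum>l<r. w l i * b' l j * c' l k) = (M * A i) $$ (j, k)))"
      using gen pq assms(1,2)
      by (intro succeeds_with_tensor_decomposition[where a = a and d = "truncated_first_factor p (?y x)"] T)
        (auto simp: generic_factors_def generic_pair_def a_def b_def c_def second_factor_def third_factor_def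
          truncated_first_factor_def first_factor_def)
    then have "succeeds_with (commuting_extension m n A r M)
     (\<lambda>Zt. (\<forall>i<m. Zt i \<in> carrier_mat r r) \<and> (\<forall>i<m. \<forall>j<m. Zt i * Zt j = Zt j * Zt i) \<and>
        (\<forall>i<m. upper_left n (Zt i) = A i))"
      using gen
      by (intro succeeds_with_commuting_extension[OF assms(2) Rc Ric Mc Mic RRi MMi Ac b_eq c_eq _ q_def p_def])
        (auto simp: generic_factors_def b_def c_def)
    moreover have "invertible_mat R" by (rule invertible_mat_if_right_inverse[OF Rc Ric RRi])
    moreover have "invertible_mat M" by (rule invertible_mat_if_right_inverse[OF Mc Mic MMi])
    ultimately show "?P x"
      unfolding Let_def R_mat_def[symmetric] M_mat_def[symmetric] R_def[symmetric] M_def[symmetric]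
        A_def[symmetric]
      by (simp add: succeeds_with_def)
  qed
qed

end
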